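(* Let $v$ be the solution on $\mathbb R\times[0,\infty)$ of the obstacle problem $\min\{\mathcal L v,1-v\}=0$, $v(\xi,0)=\min\{1,e^{-\xi}\}$, and let $K$ be the traveling wave profile (both specified in the context). As $t\to+\infty$, $v(\cdot,t)$ converges to $K$ uniformly on $\mathbb R$.
   Context: Constants: $\delta>0$, $0<\sigma_H<\sigma_L$ with $\frac12\sigma_H^2<\delta<\frac12\sigma_L^2$, $0<\gamma<1$; $c_L=2\delta/\sigma_L^2<1$, $c_H=2\delta/\sigma_H^2>1$. The operator is $$\mathcal L v=-\frac{\partial v}{\partial t}+\frac12\sigma^2(v)\left(\frac{\partial^2 v}{\partial\xi^2}+\frac{\partial v}{\partial\xi}\right)+\delta\left(\frac{\partial v}{\partial\xi}+v\right),\qquad \sigma(v)=\sigma_H\mathbf 1_{\{v<\gamma\}}+\sigma_L\mathbf 1_{\{v\ge\gamma\}}.$$ With $Q_\rho=(-\rho,\rho)\times(0,\rho^2)$, $v$ is the function on $\mathbb R\times[0,\infty)$ whose restriction to $\mathbb R\times[0,T]$, for each $T>0$, is the unique function in $\big\{\bigcap_{\rho>0}W^{2,1}_\infty((\mathbb R\times[0,T])\setminus\overline{Q}_\rho)\big\}\cap W^{1,0}_\infty(\mathbb R\times[0,T])$ solving $\min\{\mathcal L v,1-v\}=0$ a.e., $v(\xi,0)=\min\{1,e^{-\xi}\}$, with $v_{\xi\xi}+v_\xi\le0$ a.e. and such that for some $B>0$, $v=1$ for $\xi<-B$ and $v\le e^{-\xi}$ for $\xi>B$ (existence and uniqueness hold).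 Here $W^{2,1}_\infty(\Omega)$ is the space of bounded functions whose derivatives up to second order in $\xi$ and first order in $t$ are bounded, and $W^{1,0}_\infty(\Omega)$ the space of bounded functions with bounded $\xi$-derivative. $(K,\eta^*,\kappa^* )$, with $\kappa^*<\eta^*$ real numbers and $K:\mathbb R\to\mathbb R$, is the unique solution of the free boundary problem: $K''+K'+c_H(K'+K)=0$ for $\xi>\eta^*$; $K''+K'+c_L(K'+K)=0$ for $\kappa^*<\xi<\eta^*$; $K(\kappa^*+)=1$, $K'(\kappa^* )=0$; $K(\eta^*+)=K(\eta^*-)=\gamma$, $K'(\eta^*+)=K'(\eta^*-)$; $K(\xi)=1$ for $\xi<\kappa^*$; $\lim_{\xi\to+\infty}e^{\xi}K(\xi)=1$. *)

theory Defs
  imports "HOL-Analysis.Analysis"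
begin

text \<open>Points of the plane are pairs \<open>(\<xi>, t)\<close>.

  A test function on an open set \<open>U\<close> is carried together with all its partial derivatives:
  \<open>D i j\<close> is the \<open>i\<close>-th derivative in \<open>\<xi>\<close> and \<open>j\<close>-th derivative in \<open>t\<close> of \<open>D 0 0\<close>. Requiring every
  \<open>D i j\<close> to be totally differentiable with partials \<open>D (Suc i) j\<close> and \<open>D i (Suc j)\<close> says exactly that
  \<open>D 0 0\<close> is infinitely differentiable, and \<open>D 0 0\<close> determines the other members of the family.\<close>

definition test_function_jet ::
    "(real \<times> real) set \<Rightarrow> (nat \<Rightarrow> nat \<Rightarrow> real \<times> real \<Rightarrow> real) \<Rightarrow> bool" where
  "test_function_jet U D \<longleftrightarrow>
     (\<forall>i j z. (D i j has_derivative (\<lambda>h. fst h * D (Suc i) j z + snd h * D i (Suc j) z)) (at z)) \<and>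
     compact (closure {z. D 0 0 z \<noteq> 0}) \<and> closure {z. D 0 0 z \<noteq> 0} \<subseteq> U"

definition locally_integrable_on :: "(real \<times> real \<Rightarrow> real) \<Rightarrow> (real \<times> real) set \<Rightarrow> bool" where
  "locally_integrable_on f U \<longleftrightarrow> (\<forall>C. compact C \<and> C \<subseteq> U \<longrightarrow> set_integrable lebesgue C f)"

text \<open>\<open>g\<close> is the weak (distributional) derivative of \<open>f\<close> on the open set \<open>U\<close>, of order \<open>i\<close> in \<open>\<xi>\<close> and
  \<open>j\<close> in \<open>t\<close>.\<close>

definition weak_partial ::
    "nat \<Rightarrow> nat \<Rightarrow> (real \<times> real) set \<Rightarrow> (real \<times> real \<Rightarrow> real) \<Rightarrow> (real \<times> real \<Rightarrow> real) \<Rightarrow> bool" where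
  "weak_partial i j U f g \<longleftrightarrow>
     locally_integrable_on f U \<and> locally_integrable_on g U \<and>
     (\<forall>D. test_function_jet U D \<longrightarrow>
        (LINT z:U|lebesgue. f z * D i j z) = (- 1) ^ (i + j) * (LINT z:U|lebesgue. g z * D 0 0 z))"

definition L_infty :: "(real \<times> real) set \<Rightarrow> (real \<times> real \<Rightarrow> real) set" where
  "L_infty \<Omega> = {f. f \<in> borel_measurable (lebesgue_on \<Omega>) \<and>
                    (\<exists>C. AE z in lebesgue_on \<Omega>. \<bar>f z\<bar> \<le> C)}"

text \<open>The sets \<open>\<Omega>\<close> used below are not open but have a null boundary; weak derivatives are taken in
  the interior.\<close>

definition W10_infty :: "(real \<times> real) set \<Rightarrow> (real \<times> real \<Rightarrow> real) set" where
  "W10_infty \<Omega> = {f \<in> L_infty \<Omega>. \<exists>g \<in> L_infty \<Omega>. weak_partial 1 0 (interior \<Omega>) f g}"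

definition W21_infty :: "(real \<times> real) set \<Rightarrow> (real \<times> real \<Rightarrow> real) set" where
  "W21_infty \<Omega> = {f \<in> L_infty \<Omega>.
     (\<exists>g \<in> L_infty \<Omega>. weak_partial 1 0 (interior \<Omega>) f g) \<and>
     (\<exists>g \<in> L_infty \<Omega>. weak_partial 2 0 (interior \<Omega>) f g) \<and>
     (\<exists>g \<in> L_infty \<Omega>. weak_partial 0 1 (interior \<Omega>) f g)}"

definition strip :: "real \<Rightarrow> (real \<times> real) set" where
  "strip T = UNIV \<times> {0..T}"

definition Q :: "real \<Rightarrow> (real \<times> real) set" where
  "Q \<rho> = {-\<rho><..<\<rho>} \<times> {0<..<\<rho>\<^sup>2}"

definition vol :: "real \<Rightarrow> real \<Rightarrow> real \<Rightarrow> real \<Rightarrow> real" where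
  "vol \<sigma>H \<sigma>L \<gamma> y = (if y < \<gamma> then \<sigma>H else \<sigma>L)"

text \<open>The value of \<open>\<L> v\<close> at a point where \<open>v\<close>, \<open>v\<^sub>\<xi>\<close>, \<open>v\<^sub>\<xi>\<^sub>\<xi>\<close>, \<open>v\<^sub>t\<close> take the values \<open>y\<close>, \<open>yx\<close>, \<open>yxx\<close>, \<open>yt\<close>.\<close>

definition L_op :: "real \<Rightarrow> real \<Rightarrow> real \<Rightarrow> real \<Rightarrow> real \<Rightarrow> real \<Rightarrow> real \<Rightarrow> real \<Rightarrow> real" where
  "L_op \<delta> \<sigma>H \<sigma>L \<gamma> y yx yxx yt =
     - yt + 1/2 * (vol \<sigma>H \<sigma>L \<gamma> y)\<^sup>2 * (yxx + yx) + \<delta> * (yx + y)"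

text \<open>Elements of the Sobolev spaces above are classes modulo null sets. The solution has a unique
  continuous representative on the closed strip, and the pointwise conditions (initial
  value, behaviour for large \<open>\<bar>\<xi>\<bar>\<close>) refer to it: hence the clause \<open>continuous_on\<close>.
  The union over \<open>\<rho> > 0\<close> of the interiors of \<open>strip T - closure (Q \<rho>)\<close> is the open strip, so this is where
  the weak derivatives in the equation live.\<close>

definition obstacle_solution ::
    "real \<Rightarrow> real \<Rightarrow> real \<Rightarrow> real \<Rightarrow> real \<Rightarrow> (real \<times> real \<Rightarrow> real) \<Rightarrow> bool" where
  "obstacle_solution \<delta> \<sigma>H \<sigma>L \<gamma> T v \<longleftrightarrow>
     continuous_on (strip T) v \<and>
     (\<forall>\<rho>>0. v \<in> W21_infty (strip T - closure (Q \<rho>))) \<and>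
     v \<in> W10_infty (strip T) \<and>
     (\<exists>vx vxx vt.
        weak_partial 1 0 (interior (strip T)) v vx \<and>
        weak_partial 2 0 (interior (strip T)) v vxx \<and>
        weak_partial 0 1 (interior (strip T)) v vt \<and>
        (AE z in lebesgue_on (strip T).
           min (L_op \<delta> \<sigma>H \<sigma>L \<gamma> (v z) (vx z) (vxx z) (vt z)) (1 - v z) = 0) \<and>
        (AE z in lebesgue_on (strip T). vxx z + vx z \<le> 0)) \<and>
     (\<forall>\<xi>. v (\<xi>, 0) = min 1 (exp (- \<xi>))) \<and>
     (\<exists>B>0. \<forall>t\<in>{0..T}.
        (\<forall>\<xi>. \<xi> < - B \<longrightarrow> v (\<xi>, t) = 1) \<and>
        (\<forall>\<xi>. B < \<xi> \<longrightarrow> v (\<xi>, t) \<le> exp (- \<xi>)))"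

definition profile_ode :: "real \<Rightarrow> (real \<Rightarrow> real) \<Rightarrow> real set \<Rightarrow> bool" where
  "profile_ode c K I \<longleftrightarrow>
     (\<forall>\<xi>\<in>I. K differentiable (at \<xi>) \<and> deriv K differentiable (at \<xi>) \<and>
        deriv (deriv K) \<xi> + deriv K \<xi> + c * (deriv K \<xi> + K \<xi>) = 0)"

text \<open>The one-sided limits do not fix the value of \<open>K\<close> at \<open>\<eta>\<close> itself; \<open>K \<eta> = \<gamma>\<close> makes \<open>K\<close> continuous
  there. At \<open>\<kappa>\<close>, differentiability already forces \<open>K \<kappa> = 1\<close>.\<close>

definition travelling_wave_profile ::
    "real \<Rightarrow> real \<Rightarrow> real \<Rightarrow> (real \<Rightarrow> real) \<Rightarrow> real \<Rightarrow> real \<Rightarrow> bool" where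
  "travelling_wave_profile cH cL \<gamma> K \<eta> \<kappa> \<longleftrightarrow>
     \<kappa> < \<eta> \<and>
     profile_ode cH K {\<eta><..} \<and>
     profile_ode cL K {\<kappa><..<\<eta>} \<and>
     (K \<longlongrightarrow> 1) (at_right \<kappa>) \<and> (K has_real_derivative 0) (at \<kappa>) \<and>
     (K \<longlongrightarrow> \<gamma>) (at_right \<eta>) \<and> (K \<longlongrightarrow> \<gamma>) (at_left \<eta>) \<and> K \<eta> = \<gamma> \<and>
     (\<exists>d. (deriv K \<longlongrightarrow> d) (at_right \<eta>) \<and> (deriv K \<longlongrightarrow> d) (at_left \<eta>)) \<and>
     (\<forall>\<xi><\<kappa>. K \<xi> = 1) \<and>
     ((\<lambda>\<xi>. exp \<xi> * K \<xi>) \<longlongrightarrow> 1) at_top"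

end

(* Let y = v - K. Since v_xx + v_x <= 0 and sigma is nondecreasing, y satisfies the linear inequality
     y_t <= 1/2 sigma(K)^2 (y_xx + y_x) + delta (y_x + y)
   where y >= 0, and the reversed one where y < 0; the coefficient depends on x only. Divided by sigma(K)^2 the second
   order part can be integrated by parts, so energies carry the weight 1/sigma(K)^2.
   The energy of the cubed negative part of y, with the decaying weight exp(-x), satisfies a Gronwall inequality and
   vanishes initially: hence v >= K. As v_x + v is nonincreasing in x, it is then nonnegative, v is nonincreasing
   in x and v <= exp(-x). For the now nonnegative y, consider the linear functional with weight
   (exp(x) - exp(kappa)) / sigma(K)^2. The density exp(x) alone is conserved up to a loss at eta, where sigma(K) jumps;
   subtracting exp(kappa) annihilates the boundary terms at kappa and produces the dissipation
   delta exp(kappa) times the integral of y / sigma(K)^2. So the functional tends to zero, and monotonicity of v in x turns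
   this into uniform convergence. As v is only a strong solution, all integrations by parts are done on almost every time
   slice, where v_x is an indefinite integral of v_xx. *)
theory Submission
  imports Defs
begin

section \<open>Smooth bump functions\<close>

text \<open>The kink of the initial datum at the origin shapes the argument. The time derivative and
  the second \<xi>-derivative are bounded only after a positive time \<tau>, by bounds that may blow
  up as \<tau> tends to 0, so no estimate may use their size. Energy increments are taken between
  times 0 < s \<le> t, and s tends to 0 through the continuity of v alone. The bound on v_x, in
  contrast, is uniform down to t = 0; it controls the flux through the right end R of the space
  interval, which the weight exp(-x) then makes vanish as R grows. The weight of the second
  functional grows, and its boundary terms at R are small only because exp(x) v is squeezed between
  exp(x) K and 1. The resulting error is proportional to the elapsed time, so R tends to infinity
  while the times stay fixed. The cube is the lowest integer power of the negative part whose
  derivative is again continuously differentiable, as the integration by parts requires. The loss at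
  \<eta> has a sign because \<sigma>H < \<sigma>L.\<close>

primrec times_differentiable :: "nat \<Rightarrow> (real \<Rightarrow> real) \<Rightarrow> bool" where
  "times_differentiable 0 f \<longleftrightarrow> True"
| "times_differentiable (Suc n) f \<longleftrightarrow>
     (\<exists>g. (\<forall>x. (f has_real_derivative g x) (at x)) \<and> times_differentiable n g)"

lemma times_differentiable_SucD: "times_differentiable (Suc n) f \<Longrightarrow> times_differentiable n f"
proof (induction n arbitrary: f)
  case (Suc n)
  then obtain g where "\<forall>x. (f has_real_derivative g x) (at x)" "times_differentiable (Suc n) g"
    by (auto simp only: times_differentiable.simps(2)[of "Suc n"])
  with Suc.IH[of g] show ?case by auto
qed auto

lemma times_differentiable_add:
  "times_differentiable n f \<Longrightarrow> times_differentiable n g \<Longrightarrow> times_differentiable n (\<lambda>x. f x + g x)"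
proof (induction n arbitrary: f g)
  case (Suc n)
  then obtain f' g' where "\<forall>x. (f has_real_derivative f' x) (at x)" "times_differentiable n f'"
    "\<forall>x. (g has_real_derivative g' x) (at x)" "times_differentiable n g'" by auto
  with Suc.IH[of f' g'] show ?case
    by (auto intro!: exI[of _ "\<lambda>x. f' x + g' x"] derivative_eq_intros)
qed auto

lemma times_differentiable_mult:
  "times_differentiable n f \<Longrightarrow> times_differentiable n g \<Longrightarrow> times_differentiable n (\<lambda>x. f x * g x)"
proof (induction n arbitrary: f g)
  case (Suc n)
  then obtain f' g' where *: "\<forall>x. (f has_real_derivative f' x) (at x)" "times_differentiable n f'"
    "\<forall>x. (g has_real_derivative g' x) (at x)" "times_differentiable n g'" by auto
  have "times_differentiable n f" "times_differentiable n g"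
    using Suc.prems times_differentiable_SucD by blast+
  with * Suc.IH have "times_differentiable n (\<lambda>x. f' x * g x + f x * g' x)"
    by (intro times_differentiable_add) auto
  with * show ?case
    by (auto intro!: exI[of _ "\<lambda>x. f' x * g x + f x * g' x"] derivative_eq_intros)
qed auto

lemma times_differentiable_const: "times_differentiable n (\<lambda>x. c)"
  by (induction n arbitrary: c) (auto intro!: exI[of _ "\<lambda>x. 0"])

lemma times_differentiable_affine:
  "times_differentiable n f \<Longrightarrow> times_differentiable n (\<lambda>x. f (c * x + d))"
proof (induction n arbitrary: f)
  case (Suc n)
  then obtain f' where *: "\<And>x. (f has_real_derivative f' x) (at x)" "times_differentiable n f'" by auto
  have "((\<lambda>x. f (c * x + d)) has_real_derivative f' (c * x + d) * c) (at x)" for x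
    by (rule DERIV_chain2[OF *(1)]) (auto intro!: derivative_eq_intros)
  with times_differentiable_mult[OF Suc.IH[OF *(2)] times_differentiable_const[of n c]]
  show ?case by (auto intro!: exI[of _ "\<lambda>x. f' (c * x + d) * c"])
qed auto

definition smooth :: "(real \<Rightarrow> real) \<Rightarrow> bool" where
  "smooth f \<longleftrightarrow> (\<forall>n. times_differentiable n f)"

lemma smooth_DERIV: "smooth f \<Longrightarrow> (f has_real_derivative deriv f x) (at x)"
proof -
  assume "smooth f"
  then obtain g where "\<And>x. (f has_real_derivative g x) (at x)"
    using times_differentiable.simps(2)[of 0 f] by (auto simp: smooth_def simp del: times_differentiable.simps)
  then show ?thesis using DERIV_imp_deriv by metis
qed

lemma smooth_deriv: "smooth f \<Longrightarrow> smooth (deriv f)"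
proof -
  assume f: "smooth f"
  have "times_differentiable n (deriv f)" for n
  proof -
    obtain g where g: "\<And>x. (f has_real_derivative g x) (at x)" "times_differentiable n g"
      using f[unfolded smooth_def, rule_format, of "Suc n"] by auto
    then have "deriv f = g" using DERIV_imp_deriv by blast
    with g show ?thesis by simp
  qed
  then show ?thesis by (simp add: smooth_def)
qed

lemma smooth_antideriv:
  assumes "\<And>x. (f has_real_derivative g x) (at x)" "smooth g"
  shows "smooth f"
  unfolding smooth_def
proof
  fix n show "times_differentiable n f"
    using assms by (cases n) (auto simp: smooth_def)
qed

lemma smooth_add: "smooth f \<Longrightarrow> smooth g \<Longrightarrow> smooth (\<lambda>x. f x + g x)"
  and smooth_mult: "smooth f \<Longrightarrow> smooth g \<Longrightarrow> smooth (\<lambda>x. f x * g x)"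
  and smooth_const: "smooth (\<lambda>x. c)"
  and smooth_affine: "smooth f \<Longrightarrow> smooth (\<lambda>x. f (c * x + d))"
  by (auto simp: smooth_def times_differentiable_add times_differentiable_mult
      times_differentiable_const times_differentiable_affine)

lemma smooth_deriv_pow: "smooth f \<Longrightarrow> smooth ((deriv ^^ i) f)"
  by (induction i) (auto intro: smooth_deriv)

lemma smooth_continuous_on: "smooth f \<Longrightarrow> continuous_on A f"
  by (intro continuous_at_imp_continuous_on ballI) (blast intro: DERIV_isCont smooth_DERIV)

lemma smooth_borel: "smooth f \<Longrightarrow> f \<in> borel_measurable borel"
  using smooth_continuous_on borel_measurable_continuous_onI by blast

section \<open>The flat function exp(-1/x) and the bumps built from it\<close>

definition exp_germ :: "real \<Rightarrow> real" where
  "exp_germ x = (if x > 0 then exp (- inverse x) else 0)"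

text \<open>With y = 1/x the derivative of P(y) exp(-y) with respect to x is y^2 (P(y) - P'(y))
  exp(-y), since dy/dx = -y^2. Hence \<open>germ_poly i\<close> is the polynomial factor of the i-th
  derivative of exp(-1/x) on the positive half-line.\<close>

primrec germ_poly :: "nat \<Rightarrow> real poly" where
  "germ_poly 0 = 1"
| "germ_poly (Suc i) = [:0, 0, 1:] * (germ_poly i - pderiv (germ_poly i))"

lemma poly_exp_tendsto_0: "((\<lambda>y. poly q y * exp (- y :: real)) \<longlongrightarrow> 0) at_top"
proof -
  have "((\<lambda>y. \<Sum>i\<le>degree q. coeff q i * (y ^ i / exp y)) \<longlongrightarrow> (\<Sum>i\<le>degree q. coeff q i * 0)) at_top"
    by (intro tendsto_intros tendsto_power_div_exp_0)
  then show ?thesis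
    by (simp add: poly_altdef sum_distrib_right exp_minus divide_inverse mult.assoc)
qed

text \<open>Each candidate derivative \<open>F i\<close>, extended by 0 to x \<le> 0, is
  differentiable with derivative \<open>F (Suc i)\<close>; at 0 this holds because the exponential
  beats every polynomial in 1/x.\<close>

lemma smooth_exp_germ: "smooth exp_germ"
proof -
  define F where "F i x = (if x > 0 then poly (germ_poly i) (inverse x) * exp (- inverse x) else 0)"
    for i and x :: real
  have D: "(F i has_real_derivative F (Suc i) x) (at x)" for i x
  proof -
    consider "x > 0" | "x < 0" | "x = 0" by linarith
    then show ?thesis
    proof cases
      case 1
      have "((\<lambda>x. poly (germ_poly i) (inverse x) * exp (- inverse x)) has_real_derivative F (Suc i) x) (at x)"
        using 1 by (auto intro!: derivative_eq_intros simp: F_def algebra_simps power2_eq_square)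
      then show ?thesis
        by (rule has_field_derivative_transform_within_open[where S="{0<..}"]) (use 1 in \<open>auto simp: F_def\<close>)
    next
      case 2
      have "((\<lambda>x. 0) has_real_derivative F (Suc i) x) (at x)"
        using 2 by (auto simp: F_def)
      then show ?thesis
        by (rule has_field_derivative_transform_within_open[where S="{..<0}"]) (use 2 in \<open>auto simp: F_def\<close>)
    next
      case 3
      \<comment> \<open>The extra factor \<open>[:0, 1:]\<close> is the 1/y of the difference
        quotient at 0.\<close>
      have "((\<lambda>y. poly ([:0, 1:] * germ_poly i) (inverse y) * exp (- inverse y)) \<longlongrightarrow> 0) (at_right 0)"
        by (rule filterlim_compose[OF poly_exp_tendsto_0 filterlim_inverse_at_top_right])
      then have "((\<lambda>y. F i y / y) \<longlongrightarrow> 0) (at_right 0)"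
        by (rule Lim_transform_eventually)
          (auto simp: eventually_at_filter F_def field_simps)
      moreover have "((\<lambda>y. F i y / y) \<longlongrightarrow> 0) (at_left 0)"
        by (rule Lim_transform_eventually[OF tendsto_const])
          (auto simp: eventually_at_filter F_def)
      ultimately have "((\<lambda>y. F i y / y) \<longlongrightarrow> 0) (at 0)"
        by (simp add: filterlim_at_split)
      then show ?thesis
        unfolding 3 by (simp add: has_field_derivative_iff F_def)
    qed
  qed
  have "times_differentiable n (F i)" for n i
    by (induction n arbitrary: i) (use D in auto)
  moreover have "exp_germ = F 0" by (auto simp: fun_eq_iff exp_germ_def F_def)
  ultimately show ?thesis unfolding smooth_def by metis
qed

text \<open>The factor \<open>Suc n\<close> steepens the flanks, so that the sequence in n tends
  pointwise to the indicator of the open interval while staying between 0 and 1. The arguments are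
  written as c * x + d to fit \<open>smooth_affine\<close>.\<close>

definition bump :: "real \<Rightarrow> real \<Rightarrow> nat \<Rightarrow> real \<Rightarrow> real" where
  "bump a b n x = exp_germ (real (Suc n) * x + - real (Suc n) * a) *
                  exp_germ (- real (Suc n) * x + real (Suc n) * b)"

lemma smooth_bump: "smooth (bump a b n)"
  unfolding bump_def by (intro smooth_mult smooth_affine smooth_exp_germ)

lemma bump_arg: "real (Suc n) * x + - real (Suc n) * a = real (Suc n) * (x - a)"
  "- real (Suc n) * x + real (Suc n) * b = real (Suc n) * (b - x)" 
  by (simp_all add: algebra_simps)

lemma bump_eq_0: "x \<notin> {a<..<b} \<Longrightarrow> bump a b n x = 0"
  unfolding bump_def bump_arg exp_germ_def by (auto simp: zero_less_mult_iff)

lemma bump_pos: "x \<in> {a<..<b} \<Longrightarrow> bump a b n x > 0"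
  unfolding bump_def bump_arg exp_germ_def by (auto simp: zero_less_mult_iff)

lemma bump_nonneg: "bump a b n x \<ge> 0"
  using bump_eq_0[of x a b n] bump_pos[of x a b n] by (cases "x \<in> {a<..<b}") auto

lemma bump_le_1: "bump a b n x \<le> 1"
proof -
  have "exp_germ y \<le> 1" "exp_germ y \<ge> 0" for y by (auto simp: exp_germ_def)
  then show ?thesis unfolding bump_def by (intro mult_le_one) auto
qed

lemma bump_tendsto: "(\<lambda>n. bump a b n x) \<longlonglongrightarrow> indicator {a<..<b} x"
proof (cases "x \<in> {a<..<b}")
  case True
  have "(\<lambda>n. exp (- inverse (real (Suc n) * (x - a))) * exp (- inverse (real (Suc n) * (b - x))))
          \<longlonglongrightarrow> exp (- (0 * inverse (x - a))) * exp (- (0 * inverse (b - x)))"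
    unfolding inverse_mult_distrib
    by (intro tendsto_intros LIMSEQ_inverse_real_of_nat)
  then show ?thesis
    using True unfolding bump_def bump_arg exp_germ_def by (simp add: zero_less_mult_iff)
next
  case False then show ?thesis using bump_eq_0[OF False] by simp
qed

section \<open>One-variable test functions and their products\<close>

definition test_on :: "real set \<Rightarrow> (real \<Rightarrow> real) \<Rightarrow> bool" where
  "test_on I f \<longleftrightarrow> smooth f \<and> (\<exists>a b. a < b \<and> {a..b} \<subseteq> I \<and> (\<forall>x. x \<notin> {a..b} \<longrightarrow> f x = 0))"

lemma test_on_bump: "a < b \<Longrightarrow> {a..b} \<subseteq> I \<Longrightarrow> test_on I (bump a b n)"
  unfolding test_on_def by (intro conjI exI[of _ a] exI[of _ b] smooth_bump) (auto intro: bump_eq_0)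

lemma deriv_eq_0_outside:
  assumes "\<forall>x. x \<notin> {a..b} \<longrightarrow> f x = (0::real)" "x \<notin> {a..b}"
  shows "deriv f x = 0"
proof (rule DERIV_imp_deriv)
  have "((\<lambda>x. 0) has_real_derivative 0) (at x)" by simp
  then show "(f has_real_derivative 0) (at x)"
    by (rule has_field_derivative_transform_within_open[where S="- {a..b}"]) (use assms in \<open>auto intro: open_Compl\<close>)
qed

lemma test_on_deriv: "test_on I f \<Longrightarrow> test_on I (deriv f)"
  unfolding test_on_def
  by (elim conjE exE, intro conjI exI allI impI smooth_deriv, assumption+)
    (rule deriv_eq_0_outside, assumption+)

lemma test_on_deriv_pow: "test_on I f \<Longrightarrow> test_on I ((deriv ^^ i) f)"
  by (induction i) (auto intro: test_on_deriv)

text \<open>Products of one-variable test functions have an explicit jet, the products of the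
  iterated derivatives. They are the only two-variable test functions that the argument
  uses.\<close>

lemma test_function_jet_product:
  assumes f: "test_on I f" and g: "test_on J g" and U: "I \<times> J \<subseteq> U"
  shows "test_function_jet U (\<lambda>i j z. (deriv ^^ i) f (fst z) * (deriv ^^ j) g (snd z))"
  unfolding test_function_jet_def
proof (intro conjI allI)
  fix i j and z :: "real \<times> real"
  have "((deriv ^^ i) f has_real_derivative (deriv ^^ Suc i) f x) (at x)"
    "((deriv ^^ j) g has_real_derivative (deriv ^^ Suc j) g x) (at x)" for x
    using smooth_DERIV smooth_deriv_pow f g by (auto simp: test_on_def)
  then have *: "((deriv ^^ i) f has_derivative (\<lambda>h. (deriv ^^ Suc i) f (fst z) * h)) (at (fst z))"
     "((deriv ^^ j) g has_derivative (\<lambda>h. (deriv ^^ Suc j) g (snd z) * h)) (at (snd z))"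
    by (simp_all add: has_field_derivative_def)
  have "((\<lambda>z. (deriv ^^ i) f (fst z)) has_derivative (\<lambda>h. (deriv ^^ Suc i) f (fst z) * fst h)) (at z)"
       "((\<lambda>z. (deriv ^^ j) g (snd z)) has_derivative (\<lambda>h. (deriv ^^ Suc j) g (snd z) * snd h)) (at z)"
    using has_derivative_compose[where f=fst, OF has_derivative_fst[OF has_derivative_ident] *(1)]
      has_derivative_compose[where f=snd, OF has_derivative_snd[OF has_derivative_ident] *(2)]
    by simp_all
  from has_derivative_mult[OF this]
  show "((\<lambda>z. (deriv ^^ i) f (fst z) * (deriv ^^ j) g (snd z)) has_derivative
     (\<lambda>h. fst h * ((deriv ^^ Suc i) f (fst z) * (deriv ^^ j) g (snd z)) +
          snd h * ((deriv ^^ i) f (fst z) * (deriv ^^ Suc j) g (snd z)))) (at z)"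
    by (simp add: algebra_simps)
next
  obtain a b where ab: "{a..b} \<subseteq> I" "\<forall>x. x \<notin> {a..b} \<longrightarrow> f x = 0" using f by (auto simp: test_on_def)
  obtain c d where cd: "{c..d} \<subseteq> J" "\<forall>x. x \<notin> {c..d} \<longrightarrow> g x = 0" using g by (auto simp: test_on_def)
  let ?S = "{z :: real \<times> real. (deriv ^^ 0) f (fst z) * (deriv ^^ 0) g (snd z) \<noteq> 0}"
  have S: "closure ?S \<subseteq> {a..b} \<times> {c..d}"
  proof (rule closure_minimal)
    show "?S \<subseteq> {a..b} \<times> {c..d}" using ab cd by (auto simp: mem_Times_iff)
  qed (auto intro: closed_Times)
  then show "closure ?S \<subseteq> U" using ab cd U by blast
  have "compact ({a..b} \<times> {c..d})" by (intro compact_Times) auto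
  then show "compact (closure ?S)" using S
    using compact_Int_closed[OF _ closed_closure, of "{a..b} \<times> {c..d}" ?S] by (simp add: Int_absorb1)
qed

section \<open>Absolutely continuous functions on the line\<close>

text \<open>Bounds at every point, not just at almost every one: slices, products and Borel
  substitutions stay in the class without exceptional sets. An absolutely continuous function is
  encoded as an N whose increments are the integrals of such an n; it is then even
  Lipschitz.\<close>

definition bounded_borel :: "('a::topological_space \<Rightarrow> real) \<Rightarrow> bool" where
  "bounded_borel f \<longleftrightarrow> f \<in> borel_measurable borel \<and> (\<exists>C. \<forall>x. \<bar>f x\<bar> \<le> C)"

lemma bounded_borelE:
  assumes "bounded_borel f" obtains C where "C \<ge> 0" "\<And>x. \<bar>f x\<bar> \<le> C" "f \<in> borel_measurable borel"
proof -
  obtain C where "\<And>x. \<bar>f x\<bar> \<le> C" "f \<in> borel_measurable borel" using assms by (auto simp: bounded_borel_def)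
  then show ?thesis using that[of "\<bar>C\<bar>"] by (meson abs_ge_self abs_ge_zero order_trans)
qed

lemma bounded_borel_set_integrable:
  fixes f :: "real \<Rightarrow> real"
  assumes "bounded_borel f" shows "set_integrable lborel {a..b} f"
proof -
  obtain C where C: "\<And>x. \<bar>f x\<bar> \<le> C" "f \<in> borel_measurable borel" using bounded_borelE[OF assms] by metis
  have "integrable lborel (\<lambda>x. C * indicat_real {a..b} x)"
    using emeasure_lborel_Icc_eq[of a b] by (intro integrable_mult_right integrable_real_indicator) auto
  then show ?thesis unfolding set_integrable_def
  proof (rule Bochner_Integration.integrable_bound)
    show "AE x in lborel. norm (indicator {a..b} x *\<^sub>R f x) \<le> norm (C * indicator {a..b} x)"
      using C(1) by (auto simp: indicator_def intro!: AE_I2 order_trans[OF C(1)])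
  qed (use C(2) in measurable)
qed

lemma bounded_borel_integral:
  fixes f :: "real \<Rightarrow> real"
  assumes "bounded_borel f"
  shows "f integrable_on {a..b}" "integral {a..b} f = (LINT x:{a..b}|lborel. f x)"
  using set_borel_integral_eq_integral[OF bounded_borel_set_integrable[OF assms]] by auto

lemma bounded_borel_mult:
  assumes "bounded_borel f" "bounded_borel g" shows "bounded_borel (\<lambda>x. f x * g x)"
proof -
  obtain C where C: "C \<ge> 0" "\<And>x. \<bar>f x\<bar> \<le> C" "f \<in> borel_measurable borel" using bounded_borelE[OF assms(1)] by metis
  obtain D where D: "D \<ge> 0" "\<And>x. \<bar>g x\<bar> \<le> D" "g \<in> borel_measurable borel" using bounded_borelE[OF assms(2)] by metis
  have "\<bar>f x * g x\<bar> \<le> C * D" for x using C D by (simp add: abs_mult mult_mono)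
  with C D show ?thesis unfolding bounded_borel_def by (auto intro: borel_measurable_times)
qed

lemma bounded_borel_add:
  assumes "bounded_borel f" "bounded_borel g" shows "bounded_borel (\<lambda>x. f x + g x)"
proof -
  obtain C where C: "C \<ge> 0" "\<And>x. \<bar>f x\<bar> \<le> C" "f \<in> borel_measurable borel" using bounded_borelE[OF assms(1)] by metis
  obtain D where D: "D \<ge> 0" "\<And>x. \<bar>g x\<bar> \<le> D" "g \<in> borel_measurable borel" using bounded_borelE[OF assms(2)] by metis
  have "\<bar>f x + g x\<bar> \<le> C + D" for x using C(2)[of x] D(2)[of x] by linarith
  with C D show ?thesis unfolding bounded_borel_def by (auto intro: borel_measurable_add)
qed

lemma bounded_borel_const: "bounded_borel (\<lambda>x. c)"
  unfolding bounded_borel_def by auto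

lemma continuous_bounded_interval:
  fixes f :: "real \<Rightarrow> real"
  assumes "continuous_on {a..b} f" obtains C where "C \<ge> 0" "\<And>x. x \<in> {a..b} \<Longrightarrow> \<bar>f x\<bar> \<le> C"
proof -
  have "compact (f ` {a..b})" using assms by (intro compact_continuous_image) auto
  then obtain C where "\<And>x. x \<in> {a..b} \<Longrightarrow> \<bar>f x\<bar> \<le> C"
    by (fastforce dest!: compact_imp_bounded simp: bounded_iff)
  then show ?thesis using that[of "\<bar>C\<bar>"] by (meson abs_ge_self abs_ge_zero order_trans)
qed

text \<open>Continuity is given on {a..b} only. Freezing P at its end values yields a bounded Borel
  function on the whole line that agrees with P on that interval.\<close>

lemma bounded_borel_clamped:
  fixes P :: "real \<Rightarrow> real"
  assumes "continuous_on {a..b} P" "a \<le> b"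
  shows "bounded_borel (\<lambda>x. P (max a (min b x)))"
proof -
  have c: "continuous_on UNIV (\<lambda>x. P (max a (min b x)))"
    by (intro continuous_on_compose2[OF assms(1)] continuous_intros) (use assms(2) in auto)
  obtain C where "\<And>x. x \<in> {a..b} \<Longrightarrow> \<bar>P x\<bar> \<le> C"
    using continuous_bounded_interval[OF assms(1)] by metis
  then show ?thesis using c assms(2) unfolding bounded_borel_def
    by (auto intro!: borel_measurable_continuous_onI exI[of _ C])
qed

lemma continuous_times_bounded_borel_integrable:
  fixes P n :: "real \<Rightarrow> real"
  assumes "continuous_on {a..b} P" "bounded_borel n"
  shows "(\<lambda>x. P x * n x) integrable_on {a..b}"
proof (cases "a \<le> b")
  case True
  have "(\<lambda>x. P (max a (min b x)) * n x) integrable_on {a..b}"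
    using bounded_borel_clamped[OF assms(1) True] assms(2) bounded_borel_mult bounded_borel_integral(1) by blast
  then show ?thesis by (rule integrable_eq) auto
qed auto

lemma abs_integral_le:
  fixes f :: "real \<Rightarrow> real"
  assumes "f integrable_on {a..b}" "a \<le> b" "\<And>x. x \<in> {a..b} \<Longrightarrow> \<bar>f x\<bar> \<le> C"
  shows "\<bar>integral {a..b} f\<bar> \<le> C * (b - a)"
proof -
  have "norm (integral {a..b} f) \<le> integral {a..b} (\<lambda>_. C)"
    using assms by (intro integral_norm_bound_integral) auto
  then show ?thesis using assms(2) by (simp add: mult.commute)
qed

lemma bounded_borel_integral_le:
  fixes n :: "real \<Rightarrow> real"
  assumes "bounded_borel n" "\<And>x. \<bar>n x\<bar> \<le> C" "a \<le> b"
  shows "\<bar>integral {a..b} n\<bar> \<le> C * (b - a)"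
  by (rule abs_integral_le[OF bounded_borel_integral(1)[OF assms(1)] assms(3,2)])

text \<open>Every difference quotient of G is at most |C| |y - x|, so the derivative of G is 0 at
  every point, not just at almost every one.\<close>

lemma quadratic_modulus_imp_constant:
  fixes G :: "real \<Rightarrow> real"
  assumes ab: "a \<le> b" and G: "\<And>x y. a \<le> x \<Longrightarrow> x \<le> y \<Longrightarrow> y \<le> b \<Longrightarrow> \<bar>G y - G x\<bar> \<le> C * (y - x)\<^sup>2"
  shows "G a = G b"
proof -
  have "(G has_field_derivative 0) (at x within {a..b})" if x: "x \<in> {a..b}" for x
  proof -
    have *: "\<bar>(G y - G x) / (y - x)\<bar> \<le> \<bar>C\<bar> * \<bar>y - x\<bar>" if "y \<in> {a..b}" for y
    proof (cases "y = x")
      case False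
      have "\<bar>G y - G x\<bar> \<le> C * (y - x)\<^sup>2"
        using G[of x y] G[of y x] x that by (cases "x \<le> y") (auto simp: power2_commute abs_minus_commute)
      also have "\<dots> \<le> \<bar>C\<bar> * (y - x)\<^sup>2" by (intro mult_right_mono) auto
      finally show ?thesis using False
        by (simp add: abs_divide divide_le_eq power2_eq_square mult.assoc)
    qed auto
    have "((\<lambda>y. (G y - G x) / (y - x)) \<longlongrightarrow> 0) (at x within {a..b})"
    proof (rule Lim_null_comparison)
      show "\<forall>\<^sub>F y in at x within {a..b}. norm ((G y - G x) / (y - x)) \<le> \<bar>C\<bar> * \<bar>y - x\<bar>"
        using * by (auto simp: eventually_at_filter)
      have "((\<lambda>y. \<bar>C\<bar> * \<bar>y - x\<bar>) \<longlongrightarrow> \<bar>C\<bar> * \<bar>x - x\<bar>) (at x within {a..b})"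
        by (intro tendsto_intros)
      then show "((\<lambda>y. \<bar>C\<bar> * \<bar>y - x\<bar>) \<longlongrightarrow> 0) (at x within {a..b})" by simp
    qed
    then show ?thesis by (simp add: has_field_derivative_iff)
  qed
  then obtain c where "\<And>x. x \<in> {a..b} \<Longrightarrow> G x = c"
    using has_field_derivative_zero_constant[of "{a..b}" G] by auto
  then show ?thesis using ab by auto
qed

lemma integral_minus_point:
  fixes f :: "real \<Rightarrow> real"
  assumes "f integrable_on {a..b}" "a \<le> x" "x \<le> y" "y \<le> b"
  shows "integral {a..y} f - integral {a..x} f = integral {x..y} f"
  using Henstock_Kurzweil_Integration.integral_combine[OF assms(2,3), of f] integrable_subinterval_real[OF assms(1), of a y] assms by auto

lemma indefinite_integral_continuous_on:
  fixes N n :: "real \<Rightarrow> real"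
  assumes n: "bounded_borel n"
    and N: "\<And>x y. x \<in> S \<Longrightarrow> y \<in> S \<Longrightarrow> x \<le> y \<Longrightarrow> N y - N x = integral {x..y} n"
  shows "continuous_on S N"
proof -
  obtain C where C: "C \<ge> 0" "\<And>x. \<bar>n x\<bar> \<le> C" using bounded_borelE[OF n] by metis
  have "dist (N x) (N y) \<le> C * dist x y" if "x \<in> S" "y \<in> S" for x y
  proof (cases "x \<le> y")
    case True
    then show ?thesis using N[OF that True] bounded_borel_integral_le[OF n C(2) True]
      by (simp add: dist_real_def abs_minus_commute)
  next
    case False
    then show ?thesis using N[OF that(2,1)] bounded_borel_integral_le[OF n C(2), of y x]
      by (simp add: dist_real_def abs_minus_commute)
  qed
  then have "C-lipschitz_on S N" using C by (intro lipschitz_onI) auto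
  then show ?thesis by (rule lipschitz_on_continuous_on)
qed

text \<open>The difference of the two sides, as a function of the right end point, has increments of
  quadratic order; this replaces almost everywhere differentiability of \<open>N\<close>.\<close>

lemma absolutely_continuous_integration_by_parts:
  fixes P P' n N :: "real \<Rightarrow> real"
  assumes ab: "a \<le> b"
    and P: "\<And>x. x \<in> {a..b} \<Longrightarrow> (P has_real_derivative P' x) (at x within {a..b})"
    and P': "continuous_on {a..b} P'" and n: "bounded_borel n"
    and N: "\<And>x y. a \<le> x \<Longrightarrow> x \<le> y \<Longrightarrow> y \<le> b \<Longrightarrow> N y - N x = integral {x..y} n"
  shows "integral {a..b} (\<lambda>x. P x * n x) = P b * N b - P a * N a - integral {a..b} (\<lambda>x. P' x * N x)"
proof -
  have cP: "continuous_on {a..b} P" using P DERIV_continuous_on by blast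
  have cN: "continuous_on {a..b} N" using N by (intro indefinite_integral_continuous_on[OF n]) auto
  obtain C where C: "C \<ge> 0" "\<And>x. \<bar>n x\<bar> \<le> C" using bounded_borelE[OF n] by metis
  obtain D where D: "D \<ge> 0" "\<And>x. x \<in> {a..b} \<Longrightarrow> \<bar>P' x\<bar> \<le> D" using continuous_bounded_interval[OF P'] by metis
  have PN: "(\<lambda>x. P' x * N x) integrable_on {a..b}"
    by (intro integrable_continuous_interval continuous_intros P' cN)
  have Pn: "(\<lambda>x. P x * n x) integrable_on {a..b}"
    by (rule continuous_times_bounded_borel_integrable[OF cP n])
  have P'i: "(P' has_integral P y - P x) {x..y}" if "a \<le> x" "x \<le> y" "y \<le> b" for x y
  proof (rule fundamental_theorem_of_calculus)
    show "(P has_vector_derivative P' z) (at z within {x..y})" if "z \<in> {x..y}" for z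
      using P[of z] that \<open>a \<le> x\<close> \<open>y \<le> b\<close>
      by (auto simp: has_real_derivative_iff_has_vector_derivative intro: has_vector_derivative_within_subset)
  qed fact
  define G where "G y = integral {a..y} (\<lambda>x. P x * n x) - P y * N y + integral {a..y} (\<lambda>x. P' x * N x)" for y
  have "G a = G b"
  proof (rule quadratic_modulus_imp_constant[OF ab, of G "2 * C * D"])
    fix x y assume xy: "a \<le> x" "x \<le> y" "y \<le> b"
    have P'xy: "P' integrable_on {x..y}" using P'i[OF xy] by auto
    have nxy: "n integrable_on {x..y}" using bounded_borel_integral(1)[OF n] .
    have PNxy: "(\<lambda>x. P' x * N x) integrable_on {x..y}" and Pnxy: "(\<lambda>x. P x * n x) integrable_on {x..y}"
      using integrable_subinterval_real[OF PN] integrable_subinterval_real[OF Pn] xy by auto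
    have "G y - G x = integral {x..y} (\<lambda>x. P x * n x) - P y * N y + P x * N x + integral {x..y} (\<lambda>x. P' x * N x)"
      unfolding G_def using integral_minus_point[OF Pn xy] integral_minus_point[OF PN xy] by linarith
    \<comment> \<open>P is compared with its value at the right end y, N with its value at the left
      end x. With opposite end points the boundary terms are absorbed exactly, and each of the two
      integrands becomes of order y - x.\<close>
    also have "\<dots> = (integral {x..y} (\<lambda>s. P s * n s) - P y * integral {x..y} n)
        + (integral {x..y} (\<lambda>s. P' s * N s) - integral {x..y} P' * N x)"
      unfolding N[OF xy, symmetric] integral_unique[OF P'i[OF xy]] by (simp add: algebra_simps)
    also have "\<dots> = integral {x..y} (\<lambda>s. (P s - P y) * n s) + integral {x..y} (\<lambda>s. P' s * (N s - N x))"
    proof -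
      have "integral {x..y} (\<lambda>s. (P s - P y) * n s) = integral {x..y} (\<lambda>s. P s * n s) - P y * integral {x..y} n"
        unfolding left_diff_distrib using nxy Pnxy
        by (subst Henstock_Kurzweil_Integration.integral_diff) (auto intro: integrable_on_mult_right)
      moreover have "integral {x..y} (\<lambda>s. P' s * (N s - N x)) = integral {x..y} (\<lambda>s. P' s * N s) - integral {x..y} P' * N x"
        unfolding right_diff_distrib using P'xy PNxy
        by (subst Henstock_Kurzweil_Integration.integral_diff) (auto intro: integrable_on_mult_left)
      ultimately show ?thesis by simp
    qed
    finally have eq: "G y - G x = integral {x..y} (\<lambda>s. (P s - P y) * n s) + integral {x..y} (\<lambda>s. P' s * (N s - N x))" .
    have "\<bar>integral {x..y} (\<lambda>s. (P s - P y) * n s)\<bar> \<le> (D * (y - x) * C) * (y - x)"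
    proof (rule abs_integral_le)
      show "(\<lambda>s. (P s - P y) * n s) integrable_on {x..y}"
        by (intro continuous_times_bounded_borel_integrable n continuous_intros continuous_on_subset[OF cP]) (use xy in auto)
      fix s assume s: "s \<in> {x..y}"
      have "\<bar>P y - P s\<bar> \<le> D * (y - s)"
        using abs_integral_le[of P' s y D] integral_unique[OF P'i[of s y]] P'i[of s y] D s xy by auto
      also have "\<dots> \<le> D * (y - x)" using s D by (intro mult_left_mono) auto
      finally show "\<bar>(P s - P y) * n s\<bar> \<le> D * (y - x) * C" 
        using C D xy by (simp add: abs_mult abs_minus_commute mult_mono)
    qed (use xy in auto)
    moreover have "\<bar>integral {x..y} (\<lambda>s. P' s * (N s - N x))\<bar> \<le> (D * (C * (y - x))) * (y - x)"
    proof (rule abs_integral_le)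
      show "(\<lambda>s. P' s * (N s - N x)) integrable_on {x..y}"
        by (intro integrable_continuous_interval continuous_intros continuous_on_subset[OF P'] continuous_on_subset[OF cN]) (use xy in auto)
      fix s assume s: "s \<in> {x..y}"
      have "\<bar>N s - N x\<bar> \<le> C * (s - x)" using N[of x s] s xy bounded_borel_integral_le[OF n C(2), of x s] by auto
      also have "\<dots> \<le> C * (y - x)" using s C by (intro mult_left_mono) auto
      finally show "\<bar>P' s * (N s - N x)\<bar> \<le> D * (C * (y - x))"
        using D(2)[of s] D(1) s xy by (simp add: abs_mult mult_mono)
    qed (use xy in auto)
    ultimately show "\<bar>G y - G x\<bar> \<le> 2 * C * D * (y - x)\<^sup>2" unfolding eq power2_eq_square
      by (simp add: algebra_simps)
  qed
  then show ?thesis by (simp add: G_def)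
qed

text \<open>On a short interval the mean value theorem writes the increment of \<Phi> along f as (f
  y - f x) m z with z between f x and f y. Replacing m z by m (f s) costs a factor of order y - x,
  because m is Lipschitz on the bounded range of f; so the defect again has a quadratic
  modulus.\<close>

lemma absolutely_continuous_chain_rule:
  fixes f n \<Phi> m :: "real \<Rightarrow> real"
  assumes ab: "a \<le> b" and n: "bounded_borel n"
    and f: "\<And>x y. a \<le> x \<Longrightarrow> x \<le> y \<Longrightarrow> y \<le> b \<Longrightarrow> f y - f x = integral {x..y} n"
    and \<Phi>: "\<And>s. (\<Phi> has_real_derivative m s) (at s)"
    and m: "\<And>r. \<exists>L. L-lipschitz_on {- r..r} m"
  shows "\<Phi> (f b) - \<Phi> (f a) = integral {a..b} (\<lambda>x. m (f x) * n x)"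
proof -
  have cf: "continuous_on {a..b} f" using f by (intro indefinite_integral_continuous_on[OF n]) auto
  obtain C where C: "C \<ge> 0" "\<And>x. \<bar>n x\<bar> \<le> C" using bounded_borelE[OF n] by metis
  obtain M where M: "M \<ge> 0" "\<And>x. x \<in> {a..b} \<Longrightarrow> \<bar>f x\<bar> \<le> M" using continuous_bounded_interval[OF cf] by metis
  obtain L where L: "L-lipschitz_on {- M..M} m" using m by blast
  have cm: "continuous_on {a..b} (\<lambda>x. m (f x))"
    using lipschitz_on_continuous_on[OF L] cf M(2)
    by (intro continuous_on_compose2[OF lipschitz_on_continuous_on[OF L] cf]) (force simp: abs_le_iff)
  have mn: "(\<lambda>x. m (f x) * n x) integrable_on {a..b}"
    by (rule continuous_times_bounded_borel_integrable[OF cm n])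
  have flip: "\<bar>f s - f x\<bar> \<le> C * (y - x)" if "a \<le> x" "x \<le> s" "s \<le> y" "y \<le> b" for x s y
  proof -
    have "\<bar>f s - f x\<bar> \<le> C * (s - x)" using f[of x s] that bounded_borel_integral_le[OF n C(2), of x s] by auto
    also have "\<dots> \<le> C * (y - x)" using that C by (intro mult_left_mono) auto
    finally show ?thesis .
  qed
  have mlip: "\<bar>m s - m t\<bar> \<le> L * \<bar>s - t\<bar>" if "\<bar>s\<bar> \<le> M" "\<bar>t\<bar> \<le> M" for s t
    using lipschitz_onD[OF L, of s t] that by (auto simp: dist_real_def abs_le_iff)
  have L0: "L \<ge> 0" using lipschitz_on_nonneg[OF L] .
  define G where "G y = \<Phi> (f y) - integral {a..y} (\<lambda>x. m (f x) * n x)" for y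
  have "G a = G b"
  proof (rule quadratic_modulus_imp_constant[OF ab, of G "2 * L * C * C"])
    fix x y assume xy: "a \<le> x" "x \<le> y" "y \<le> b"
    have nxy: "n integrable_on {x..y}" using bounded_borel_integral(1)[OF n] .
    have mnxy: "(\<lambda>x. m (f x) * n x) integrable_on {x..y}" 
      using integrable_subinterval_real[OF mn] xy by auto
    have fx: "\<bar>f x\<bar> \<le> M" "\<bar>f y\<bar> \<le> M" using M xy by auto
    \<comment> \<open>The bound on z keeps it in [-M, M], where L is a Lipschitz constant of
      m.\<close>
    have "\<exists>z. \<bar>z - f x\<bar> \<le> \<bar>f y - f x\<bar> \<and> \<bar>z\<bar> \<le> M \<and> \<Phi> (f y) - \<Phi> (f x) = (f y - f x) * m z"
    proof -
      consider "f x < f y" | "f y < f x" | "f x = f y" by linarith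
      then show ?thesis
      proof cases
        case 1
        then obtain z where "f x < z" "z < f y" "\<Phi> (f y) - \<Phi> (f x) = (f y - f x) * m z"
          using MVT2[of "f x" "f y" \<Phi> m] \<Phi> by auto
        then show ?thesis using fx by (intro exI[of _ z]) auto
      next
        case 2
        then obtain z where "f y < z" "z < f x" "\<Phi> (f x) - \<Phi> (f y) = (f x - f y) * m z"
          using MVT2[of "f y" "f x" \<Phi> m] \<Phi> by auto
        then show ?thesis using fx by (intro exI[of _ z]) (auto simp: algebra_simps)
      qed (use fx in auto)
    qed
    then obtain z where z: "\<bar>z - f x\<bar> \<le> \<bar>f y - f x\<bar>" "\<bar>z\<bar> \<le> M" "\<Phi> (f y) - \<Phi> (f x) = (f y - f x) * m z" by auto
    have "G y - G x = (f y - f x) * m z - integral {x..y} (\<lambda>x. m (f x) * n x)"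
      unfolding G_def using integral_minus_point[OF mn xy] z(3) by linarith
    also have "\<dots> = integral {x..y} (\<lambda>s. (m z - m (f s)) * n s)"
      unfolding left_diff_distrib f[OF xy] using nxy mnxy
      by (subst Henstock_Kurzweil_Integration.integral_diff) (auto intro: integrable_on_mult_right)
    finally have eq: "G y - G x = integral {x..y} (\<lambda>s. (m z - m (f s)) * n s)" .
    have "\<bar>integral {x..y} (\<lambda>s. (m z - m (f s)) * n s)\<bar> \<le> (L * (2 * (C * (y - x))) * C) * (y - x)"
    proof (rule abs_integral_le)
      show "(\<lambda>s. (m z - m (f s)) * n s) integrable_on {x..y}"
        by (intro continuous_times_bounded_borel_integrable n continuous_intros continuous_on_subset[OF cm]) (use xy in auto)
      fix s assume s: "s \<in> {x..y}"
      have "\<bar>z - f s\<bar> \<le> 2 * (C * (y - x))" using flip[of x s y] flip[of x y y] z(1) s xy by auto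
      then have "\<bar>m z - m (f s)\<bar> \<le> L * (2 * (C * (y - x)))"
        using mlip[of z "f s"] z(2) M(2)[of s] s xy L0 by (auto intro: order_trans mult_left_mono)
      then show "\<bar>(m z - m (f s)) * n s\<bar> \<le> L * (2 * (C * (y - x))) * C"
        unfolding abs_mult using C(2)[of s] C(1) L0 xy by (intro mult_mono) auto
    qed (use xy in auto)
    then show "\<bar>G y - G x\<bar> \<le> 2 * L * C * C * (y - x)\<^sup>2" unfolding eq power2_eq_square
      by (simp add: algebra_simps)
  qed
  then show ?thesis by (simp add: G_def)
qed

section \<open>The fundamental lemma of the calculus of variations\<close>

text \<open>Extended by zero, the function integrates to 0 over every half-line. Half-lines are an
  intersection-stable generator of the Borel sets, and the sets with vanishing integral form a
  Dynkin system; so all Borel integrals vanish.\<close>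

lemma AE_zero_if_interval_integrals_zero:
  fixes d :: "real \<Rightarrow> real"
  assumes d: "set_integrable lborel {a..b} d"
    and z: "\<And>x. x \<in> {a..b} \<Longrightarrow> (LINT y:{a..x}|lborel. d y) = 0" and ab: "a \<le> b"
  shows "AE x in lborel. x \<in> {a..b} \<longrightarrow> d x = 0"
proof -
  define f where "f x = indicator {a..b} x * d x" for x
  have f: "integrable lborel f" using d by (simp add: f_def[abs_def] set_integrable_def)
  have fA: "set_integrable lborel A f" if "A \<in> sets borel" for A
    using f that unfolding set_integrable_def by (intro integrable_mult_indicator) auto
  have at: "(LINT y:{..x}|lborel. f y) = 0" for x
  proof (cases "x < a")
    case True
    then have eq: "indicator {..x} y *\<^sub>R f y = 0" for y by (auto simp: f_def indicator_def)
    show ?thesis unfolding set_lebesgue_integral_def eq by simp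
  next
    case False
    have eq: "indicator {..x} y *\<^sub>R f y = indicator {a..min x b} y *\<^sub>R d y" for y by (auto simp: f_def indicator_def)
    show ?thesis using z[of "min x b"] False ab unfolding set_lebesgue_integral_def eq by simp
  qed
  have all: "(LINT y|lborel. f y) = 0"
  proof -
    have eq: "indicator {..b} y *\<^sub>R f y = f y" for y by (auto simp: f_def indicator_def)
    show ?thesis using at[of b] unfolding set_lebesgue_integral_def eq .
  qed
  have "(LINT y:A|lborel. f y) = 0" if "A \<in> sets borel" for A
  proof -
    have "Int_stable (range (\<lambda>a::real. {..a}))" by (auto simp: Int_stable_def)
    moreover have "range (\<lambda>a::real. {..a}) \<subseteq> Pow UNIV" by auto
    moreover have "A \<in> sigma_sets UNIV (range (\<lambda>a::real. {..a}))"
      using that unfolding borel_eq_atMost by simp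
    ultimately show ?thesis
    proof (induction rule: sigma_sets_induct_disjoint)
      case (basic A) then show ?case using at by auto
    next
      case empty then show ?case by (simp add: set_lebesgue_integral_def)
    next
      case (compl A)
      then have A: "A \<in> sets borel" unfolding borel_eq_atMost by simp
      have "(LINT y:UNIV|lborel. f y) = (LINT y:A|lborel. f y) + (LINT y:UNIV - A|lborel. f y)"
        using A by (subst set_integral_Un[symmetric]) (auto intro!: fA)
      then show ?case using compl all by (simp add: set_lebesgue_integral_def)
    next
      case (union A)
      then have A: "A i \<in> sets borel" for i unfolding borel_eq_atMost by auto
      have "(LINT y:(\<Union>i. A i)|lborel. f y) = (\<Sum>i. LINT y:A i|lborel. f y)"
        using A union by (intro lebesgue_integral_countable_add fA) (auto simp: disjoint_family_on_def)
      then show ?case using union by simp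
    qed
  qed
  then have "AE x in lborel. f x = 0"
    by (intro sigma_finite_measure.density_zero[OF sigma_finite_lborel f]) auto
  then show ?thesis by eventually_elim (auto simp: f_def)
qed

text \<open>Dominated convergence in n gives vanishing integrals over rational intervals, and
  continuity of the indefinite integral gives the remaining end points. Countably many test
  functions are enough, which later allows one null set of slices to serve all of them.\<close>

lemma AE_zero_if_orthogonal_to_bumps:
  fixes d :: "real \<Rightarrow> real"
  assumes I: "open I" and d: "\<And>a b. {a..b} \<subseteq> I \<Longrightarrow> set_integrable lborel {a..b} d"
    and z: "\<And>a b n. a \<in> \<rat> \<Longrightarrow> b \<in> \<rat> \<Longrightarrow> a < b \<Longrightarrow> {a..b} \<subseteq> I \<Longrightarrow> (LINT x|lborel. d x * bump a b n x) = 0"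
  shows "AE x in lborel. x \<in> I \<longrightarrow> d x = 0"
proof -
  have 1: "(LINT y:{a..b}|lborel. d y) = 0" if ab: "a \<in> \<rat>" "b \<in> \<rat>" "a < b" "{a..b} \<subseteq> I" for a b
  proof -
    have dm: "(\<lambda>x. indicator {a..b} x * d x) \<in> borel_measurable lborel"
      using d[OF ab(4)] by (auto simp: set_integrable_def)
    have eq: "indicator {a..b} x * d x * bump a b n x = d x * bump a b n x" for x n
      using bump_eq_0[of x a b n] by (cases "x \<in> {a..b}") (auto simp: indicator_def)
    have "(\<lambda>n. LINT x|lborel. indicator {a..b} x * d x * bump a b n x)
       \<longlonglongrightarrow> (LINT x|lborel. indicator {a..b} x * d x * indicator {a<..<b} x)"
    proof (rule integral_dominated_convergence[where w="\<lambda>x. \<bar>indicator {a..b} x * d x\<bar>"])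
      show "AE x in lborel. (\<lambda>n. indicator {a..b} x * d x * bump a b n x) \<longlonglongrightarrow> indicator {a..b} x * d x * indicator {a<..<b} x"
        by (intro AE_I2 tendsto_intros bump_tendsto)
      show "AE x in lborel. norm (indicator {a..b} x * d x * bump a b n x) \<le> \<bar>indicator {a..b} x * d x\<bar>" for n
        using bump_nonneg bump_le_1 by (intro AE_I2) (auto simp: abs_mult intro!: mult_left_le)
      show "integrable lborel (\<lambda>x. \<bar>indicator {a..b} x * d x\<bar>)"
        using d[OF ab(4)] by (auto simp: set_integrable_def)
      show "(\<lambda>x. indicator {a..b} x * d x * bump a b n x) \<in> borel_measurable lborel" for n
        by (intro borel_measurable_times[OF dm]) (simp add: smooth_borel smooth_bump)
    qed (intro borel_measurable_times[OF dm], simp)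
    then have "(LINT x|lborel. indicator {a..b} x * d x * indicator {a<..<b} x) = 0"
      unfolding eq z[OF ab] by (simp add: LIMSEQ_const_iff)
    moreover have "(LINT x|lborel. indicator {a..b} x * d x * indicator {a<..<b} x) = (LINT y:{a..b}|lborel. d y)"
      unfolding set_lebesgue_integral_def
    proof (rule integral_cong_AE)
      show "AE x in lborel. indicator {a..b} x * d x * indicator {a<..<b} x = indicator {a..b} x *\<^sub>R d x"
        using AE_lborel_singleton[of a] AE_lborel_singleton[of b] by eventually_elim (auto simp: indicator_def)
      show "(\<lambda>x. indicator {a..b} x * d x * indicator {a<..<b} x) \<in> borel_measurable lborel"
        by (intro borel_measurable_times[OF dm]) simp
      show "(\<lambda>x. indicator {a..b} x *\<^sub>R d x) \<in> borel_measurable lborel" using dm by simp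
    qed
    ultimately show ?thesis by simp
  qed
  have 2: "AE x in lborel. x \<in> {a..b} \<longrightarrow> d x = 0" if ab: "a \<in> \<rat>" "b \<in> \<rat>" "a < b" "{a..b} \<subseteq> I" for a b
  proof (rule AE_zero_if_interval_integrals_zero)
    show "set_integrable lborel {a..b} d" using d ab by auto
    then have "d integrable_on {a..b}" using set_borel_integral_eq_integral by blast
    then have c: "continuous_on {a..b} (\<lambda>x. integral {a..x} d)"
      by (rule indefinite_integral_continuous_1)
    have eq: "integral {a..x} d = (LINT y:{a..x}|lborel. d y)" if "x \<in> {a..b}" for x
      using set_borel_integral_eq_integral(2)[of "{a..x}" d] d[of a x] that ab by fastforce
    fix x assume x: "x \<in> {a..b}"
    have "integral {a..x} d = 0" 
    proof (rule continuous_constant_on_closure[of "{a<..<b} \<inter> \<rat>" "\<lambda>x. integral {a..x} d"])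
      have "{a<..<b} \<subseteq> closure ({a<..<b} \<inter> \<rat>)"
        using open_Int_closure_subset[of "{a<..<b}" "\<rat>"] by (simp add: Rats_closure_real)
      then have "closure {a<..<b} \<subseteq> closure ({a<..<b} \<inter> \<rat>)" by (intro closure_minimal) auto
      moreover have "closure ({a<..<b} \<inter> \<rat>) \<subseteq> closure {a<..<b}" by (intro closure_mono) auto
      ultimately have "closure ({a<..<b} \<inter> \<rat>) = {a..b}" using ab by (simp add: closure_greaterThanLessThan)
      then show "continuous_on (closure ({a<..<b} \<inter> \<rat>)) (\<lambda>x. integral {a..x} d)"
        "x \<in> closure ({a<..<b} \<inter> \<rat>)"
        using x c by auto
      show "integral {a..y} d = 0" if "y \<in> {a<..<b} \<inter> \<rat>" for y
        using that eq[of y] 1[of a y] ab by force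
    qed
    then show "(LINT y:{a..x}|lborel. d y) = 0" using eq[OF x] by simp
  qed (use ab in auto)
  have "AE x in lborel. \<forall>a\<in>\<rat>. \<forall>b\<in>\<rat>. a < b \<and> {a..b} \<subseteq> I \<longrightarrow> x \<in> {a..b} \<longrightarrow> d x = 0"
    using 2 by (subst AE_ball_countable; simp add: countable_rat)+
  then show ?thesis
  proof eventually_elim
    case (elim x)
    show ?case
    proof
      assume "x \<in> I"
      then obtain e where e: "e > 0" "ball x e \<subseteq> I" using I open_contains_ball by blast
      obtain a where a: "a \<in> \<rat>" "x - e < a" "a < x" using Rats_dense_in_real[of "x - e" x] e by auto
      obtain b where b: "b \<in> \<rat>" "x < b" "b < x + e" using Rats_dense_in_real[of x "x + e"] e by auto
      have "{a..b} \<subseteq> I" using a b e by (auto simp: subset_eq dist_real_def)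
      then show "d x = 0" using elim a b by (auto dest!: bspec[of _ _ a] bspec[of _ _ b])
    qed
  qed
qed

text \<open>Test functions whose derivative is a difference of normalised bumps: a function orthogonal to
  these derivatives is almost everywhere constant.\<close>

definition nbump :: "real \<times> real \<times> nat \<Rightarrow> real \<Rightarrow> real" where
  "nbump = (\<lambda>(a, b, n) x. bump a b n x / integral {a..b} (bump a b n))"

definition bump_primitive :: "real \<times> real \<times> nat \<Rightarrow> real \<times> real \<times> nat \<Rightarrow> real \<Rightarrow> real" where
  "bump_primitive p q x = integral {min (fst p) (fst q) - 1..x} (\<lambda>y. nbump p y - nbump q y)"

definition rational_bumps :: "real set \<Rightarrow> (real \<times> real \<times> nat) set" where
  "rational_bumps I = {(a, b, n). a \<in> \<rat> \<and> b \<in> \<rat> \<and> a < b \<and> {a..b} \<subseteq> I}"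

lemma countable_rational_bumps: "countable (rational_bumps I)"
proof -
  have "rational_bumps I \<subseteq> \<rat> \<times> \<rat> \<times> UNIV" by (auto simp: rational_bumps_def)
  then show ?thesis by (rule countable_subset) (intro countable_SIGMA countable_rat countableI_type)
qed

lemma integral_bump_pos:
  assumes "a < b" shows "integral {a..b} (bump a b n) > 0"
proof -
  have c: "continuous_on {a..b} (bump a b n)" using smooth_continuous_on smooth_bump by blast
  have "integral {a..b} (bump a b n) \<ge> 0" using bump_nonneg by (intro Henstock_Kurzweil_Integration.integral_nonneg integrable_continuous_interval c) auto
  moreover have "integral {a..b} (bump a b n) \<noteq> 0"
    using integral_eq_0_iff[OF c assms] bump_nonneg bump_pos[of "(a+b)/2" a b n] assms by force
  ultimately show ?thesis by linarith
qed

lemma smooth_nbump: "smooth (nbump p)"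
proof -
  obtain a b n where [simp]: "p = (a, b, n)" by (cases p)
  show ?thesis unfolding nbump_def divide_inverse by (simp add: smooth_mult[OF smooth_bump smooth_const])
qed

lemma integral_nbump:
  assumes "l \<le> a" "a < b" "b \<le> u"
  shows "integral {l..u} (nbump (a, b, n)) = 1"
proof -
  have "(nbump (a, b, n) has_integral 1) {a..b}"
    using has_integral_divide[OF integrable_integral[OF integrable_continuous_interval[OF
            smooth_continuous_on[OF smooth_bump[of a b n], of "{a..b}"]]], of "integral {a..b} (bump a b n)"]
      integral_bump_pos[OF assms(2), of n] by (simp add: nbump_def[abs_def])
  then have "(nbump (a, b, n) has_integral 1) {l..u}"
    by (rule has_integral_on_superset) (use assms in \<open>auto simp: nbump_def bump_eq_0\<close>)
  then show ?thesis by (rule integral_unique)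
qed

text \<open>The lower limit of integration lies 1 below both supports, which leaves room for a
  two-sided derivative at their left end. To the right of both supports the two unit masses
  cancel.\<close>

lemma bump_primitive:
  assumes p: "p = (a, b, n)" "a < b" and q: "q = (c, d, k)" "c < d"
  shows "(bump_primitive p q has_real_derivative nbump p x - nbump q x) (at x)"
    and "x \<notin> {min a c<..<max b d} \<Longrightarrow> bump_primitive p q x = 0"
proof -
  let ?l = "min a c - 1"
  define g where "g y = nbump p y - nbump q y" for y
  have g: "smooth g" using smooth_add[OF smooth_nbump[of p] smooth_mult[OF smooth_const[of "-1"] smooth_nbump[of q]]]
    by (simp add: g_def[abs_def])
  have g0: "g y = 0" if "y \<le> min a c" for y using that p q by (simp add: g_def nbump_def bump_eq_0)
  have z: "bump_primitive p q y = 0" if "y \<le> min a c" for y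
  proof -
    have "integral {?l..y} g = integral {?l..y} (\<lambda>_. 0)"
      using that by (intro Henstock_Kurzweil_Integration.integral_cong g0) auto
    then show ?thesis using p q by (simp add: bump_primitive_def g_def[abs_def])
  qed
  show "(bump_primitive p q has_real_derivative nbump p x - nbump q x) (at x)"
  proof (cases "x < min a c")
    case True
    have "((\<lambda>x. 0) has_real_derivative 0) (at x)" by simp
    then have "(bump_primitive p q has_real_derivative 0) (at x)"
      by (rule has_field_derivative_transform_within_open[where S="{..<min a c}"]) (use True z in auto)
    then show ?thesis using g0[of x] True by (simp add: g_def)
  next
    case False
    have "((\<lambda>x. integral {?l..x} g) has_real_derivative g x) (at x within {?l..x + 1})"
      using False by (intro integral_has_real_derivative smooth_continuous_on g) auto
    moreover have "at x within {?l..x + 1} = at x"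
      using False by (intro at_within_Icc_at) auto
    ultimately show ?thesis using p q by (simp add: bump_primitive_def[abs_def] g_def[abs_def])
  qed
  assume x: "x \<notin> {min a c<..<max b d}"
  show "bump_primitive p q x = 0"
  proof (cases "x \<le> min a c")
    case False
    with x have "x \<ge> b" "x \<ge> d" by auto
    then have "integral {?l..x} (nbump p) = 1" "integral {?l..x} (nbump q) = 1"
      using integral_nbump p q by auto
    then show ?thesis unfolding bump_primitive_def using p q
      by (subst Henstock_Kurzweil_Integration.integral_diff)
        (auto intro!: integrable_continuous_interval smooth_continuous_on smooth_nbump)
  qed (use z in auto)
qed

text \<open>The primitive lives on the convex hull of the two supports; this is why I has to be an
  interval.\<close>

lemma test_on_bump_primitive:
  assumes I: "is_interval I" and p: "p = (a, b, n)" "a < b" "{a..b} \<subseteq> I" and q: "q = (c, d, k)" "c < d" "{c..d} \<subseteq> I"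
  shows "test_on I (bump_primitive p q)"
proof -
  have "smooth (\<lambda>y. nbump p y + (-1) * nbump q y)"
    by (intro smooth_add smooth_mult smooth_const smooth_nbump)
  then have "smooth (\<lambda>y. nbump p y - nbump q y)" by simp
  with bump_primitive(1)[OF p(1,2) q(1,2)] have s: "smooth (bump_primitive p q)" by (rule smooth_antideriv)
  have "min a c \<in> I" "max b d \<in> I" using p(2,3) q(2,3) by (auto simp: min_def max_def)
  note mem = mem_is_interval_1_I[OF I this]
  have "{min a c..max b d} \<subseteq> I"
  proof
    fix z assume "z \<in> {min a c..max b d}"
    then show "z \<in> I" by (intro mem) (simp_all only: atLeastAtMost_iff)
  qed
  moreover have "min a c < max b d" using p q by linarith
  moreover have "\<forall>x. x \<notin> {min a c..max b d} \<longrightarrow> bump_primitive p q x = 0"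
    using bump_primitive(2)[OF p(1,2) q(1,2)] by auto
  ultimately show ?thesis using s unfolding test_on_def by blast
qed

section \<open>Weak derivatives on slices\<close>

lemma integrable_times_test:
  fixes h \<phi> :: "real \<Rightarrow> real"
  assumes h: "set_integrable lborel {a..b} h" and \<phi>: "smooth \<phi>" and z: "\<And>x. x \<notin> {a..b} \<Longrightarrow> \<phi> x = 0"
  shows "integrable lborel (\<lambda>x. h x * \<phi> x)"
proof -
  obtain C where C: "\<And>x. x \<in> {a..b} \<Longrightarrow> \<bar>\<phi> x\<bar> \<le> C"
    using continuous_bounded_interval[OF smooth_continuous_on[OF \<phi>]] by metis
  have m: "(\<lambda>x. indicator {a..b} x * h x) \<in> borel_measurable lborel"
    using h by (auto simp: set_integrable_def)
  have "integrable lborel (\<lambda>x. indicator {a..b} x * h x * \<phi> x)"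
  proof (rule Bochner_Integration.integrable_bound[of _ "\<lambda>x. C * (indicator {a..b} x * h x)"])
    show "integrable lborel (\<lambda>x. C * (indicator {a..b} x * h x))"
      using h by (auto simp: set_integrable_def)
    show "(\<lambda>x. indicator {a..b} x * h x * \<phi> x) \<in> borel_measurable lborel"
      by (intro borel_measurable_times[OF m]) (simp add: smooth_borel \<phi>)
    show "AE x in lborel. norm (indicator {a..b} x * h x * \<phi> x) \<le> norm (C * (indicator {a..b} x * h x))"
    proof (rule AE_I2)
      fix x show "norm (indicator {a..b} x * h x * \<phi> x) \<le> norm (C * (indicator {a..b} x * h x))"
        using C[of x] abs_ge_self[of C] by (cases "x \<in> {a..b}") (auto simp: abs_mult mult.commute intro!: mult_right_mono)
    qed
  qed
  moreover have "indicator {a..b} x * h x * \<phi> x = h x * \<phi> x" for x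
    using z[of x] by (cases "x \<in> {a..b}") (auto simp: indicator_def)
  ultimately show ?thesis by simp
qed

lemma integral_times_test:
  fixes h \<phi> :: "real \<Rightarrow> real"
  assumes h: "continuous_on {a..b} h" and \<phi>: "smooth \<phi>" and z: "\<And>x. x \<notin> {a..b} \<Longrightarrow> \<phi> x = 0"
  shows "(LINT x|lborel. h x * \<phi> x) = integral {a..b} (\<lambda>x. h x * \<phi> x)"
proof -
  have "continuous_on {a..b} (\<lambda>x. h x * \<phi> x)"
    by (intro continuous_intros h smooth_continuous_on \<phi>)
  then have "integral {a..b} (\<lambda>x. h x * \<phi> x) = (LINT x:{a..b}|lborel. h x * \<phi> x)"
    using set_borel_integral_eq_integral(2) borel_integrable_atLeastAtMost' by metis
  also have "\<dots> = (LINT x|lborel. h x * \<phi> x)"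
    unfolding set_lebesgue_integral_def
    by (intro Bochner_Integration.integral_cong) (use z in \<open>auto simp: indicator_def\<close>)
  finally show ?thesis by simp
qed

lemma integral_bounded_borel_times_test:
  fixes h \<phi> :: "real \<Rightarrow> real"
  assumes h: "bounded_borel h" and \<phi>: "smooth \<phi>" and z: "\<And>x. x \<notin> {a..b} \<Longrightarrow> \<phi> x = 0"
  shows "(LINT x|lborel. h x * \<phi> x) = integral {a..b} (\<lambda>x. h x * \<phi> x)"
proof -
  have i: "integrable lborel (\<lambda>x. h x * \<phi> x)"
    by (rule integrable_times_test[OF bounded_borel_set_integrable[OF h] \<phi> z])
  have "integral {a..b} (\<lambda>x. h x * \<phi> x) = (LINT x:{a..b}|lborel. h x * \<phi> x)"
    using integrable_mult_indicator[OF _ i, of "{a..b}"]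
    by (intro set_borel_integral_eq_integral(2)[symmetric]) (simp add: set_integrable_def)
  also have "\<dots> = (LINT x|lborel. h x * \<phi> x)"
    unfolding set_lebesgue_integral_def
    by (intro Bochner_Integration.integral_cong) (use z in \<open>auto simp: indicator_def\<close>)
  finally show ?thesis by simp
qed

lemma indefinite_integral_exists:
  fixes g :: "real \<Rightarrow> real"
  assumes g: "bounded_borel g"
  shows "\<exists>N. \<forall>x y. x \<le> y \<longrightarrow> N y - N x = integral {x..y} g"
proof -
  define N where "N x = (if 0 \<le> x then integral {0..x} g else - integral {x..0} g)" for x
  note i = bounded_borel_integral(1)[OF g]
  have "N y - N x = integral {x..y} g" if "x \<le> y" for x y
  proof -
    consider "0 \<le> x" | "x < 0" "0 \<le> y" | "y < 0" by linarith
    then show ?thesis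
    proof cases
      case 1 then show ?thesis using Henstock_Kurzweil_Integration.integral_combine[OF 1 that i] that by (simp add: N_def)
    next
      case 2 then show ?thesis using Henstock_Kurzweil_Integration.integral_combine[of x 0 y g, OF _ _ i] by (simp add: N_def)
    next
      case 3 then show ?thesis using Henstock_Kurzweil_Integration.integral_combine[of x y 0 g, OF _ _ i] that by (simp add: N_def)
    qed
  qed
  then show ?thesis by auto
qed

lemma bump_eq_nbump: "a < b \<Longrightarrow> bump a b n x = integral {a..b} (bump a b n) * nbump (a, b, n) x"
  using integral_bump_pos[of a b n] by (simp add: nbump_def)

lemma nbump_eq_0: "x \<notin> {a<..<b} \<Longrightarrow> nbump (a, b, n) x = 0"
  by (simp add: nbump_def bump_eq_0)

text \<open>The lemma of du Bois-Reymond. For a primitive N of g, the function f - N is orthogonal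
  to every difference of normalised bumps, so it has the same mean c against each of them; f - N - c
  is then orthogonal to all bumps.\<close>

lemma weak_derivative_imp_primitive:
  fixes f g :: "real \<Rightarrow> real"
  assumes I: "open I" "is_interval I" and f: "bounded_borel f" and g: "bounded_borel g"
    and w: "\<And>p q. p \<in> rational_bumps I \<Longrightarrow> q \<in> rational_bumps I \<Longrightarrow>
       (LINT x|lborel. f x * (nbump p x - nbump q x)) = - (LINT x|lborel. g x * bump_primitive p q x)"
  shows "\<exists>N. (\<forall>x y. x \<le> y \<longrightarrow> N y - N x = integral {x..y} g) \<and>
             (AE x in lborel. x \<in> I \<longrightarrow> f x = N x)"
proof -
  obtain N where N: "\<And>x y. x \<le> y \<Longrightarrow> N y - N x = integral {x..y} g"
    using indefinite_integral_exists[OF g] by auto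
  have cN: "continuous_on A N" for A using indefinite_integral_continuous_on[OF g] N by auto
  have eN: "set_integrable lborel {a..b} (\<lambda>x. f x - N x - c)" for a b c
    by (intro set_integral_diff bounded_borel_set_integrable[OF f] borel_integrable_atLeastAtMost' cN continuous_on_const)
  have Npq: "(LINT x|lborel. N x * (nbump p x - nbump q x)) = - (LINT x|lborel. g x * bump_primitive p q x)"
    if pq: "p \<in> rational_bumps I" "q \<in> rational_bumps I" for p q
  proof -
    obtain a b n where p: "p = (a, b, n)" "a < b" using pq by (auto simp: rational_bumps_def)
    obtain c d k where q: "q = (c, d, k)" "c < d" using pq by (auto simp: rational_bumps_def)
    let ?l = "min a c" and ?u = "max b d"
    note D = bump_primitive[OF p q]
    have s: "smooth (\<lambda>y. nbump p y - nbump q y)"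
      using smooth_add[OF smooth_nbump[of p] smooth_mult[OF smooth_const[of "-1"] smooth_nbump[of q]]] by simp
    have s2: "smooth (bump_primitive p q)" by (rule smooth_antideriv[OF D(1) s])
    have "?l \<le> ?u" using p q by auto
    from absolutely_continuous_integration_by_parts[OF this, of "bump_primitive p q" "\<lambda>y. nbump p y - nbump q y" g N]
    have "integral {?l..?u} (\<lambda>x. bump_primitive p q x * g x) =
        - integral {?l..?u} (\<lambda>x. (nbump p x - nbump q x) * N x)"
      using D N g s by (auto intro: has_field_derivative_at_within smooth_continuous_on)
    moreover have "(LINT x|lborel. N x * (nbump p x - nbump q x)) = integral {?l..?u} (\<lambda>x. N x * (nbump p x - nbump q x))"
    proof (intro integral_times_test cN s)
      fix x assume "x \<notin> {?l..?u}"
      then have "x \<notin> {a<..<b}" "x \<notin> {c<..<d}" by auto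
      then show "nbump p x - nbump q x = 0" using p q by (simp add: nbump_eq_0)
    qed
    moreover have "(LINT x|lborel. g x * bump_primitive p q x) = integral {?l..?u} (\<lambda>x. g x * bump_primitive p q x)"
      by (intro integral_bounded_borel_times_test g s2) (use D(2) in auto)
    ultimately show ?thesis by (simp add: mult.commute)
  qed
  show ?thesis
  proof (cases "rational_bumps I = {}")
    case True
    \<comment> \<open>Without a reference bump q the constant c cannot be formed; but an open set
      that contains no rational interval is empty.\<close>
    have "I = {}"
    proof (rule ccontr)
      assume "I \<noteq> {}"
      then obtain x e where e: "e > 0" "ball x e \<subseteq> I" using I open_contains_ball by blast
      obtain a where a: "a \<in> \<rat>" "x - e < a" "a < x" using Rats_dense_in_real[of "x - e" x] e by auto
      obtain b where b: "b \<in> \<rat>" "x < b" "b < x + e" using Rats_dense_in_real[of x "x + e"] e by auto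
      have "{a..b} \<subseteq> I" using a b e by (auto simp: subset_eq dist_real_def)
      then have "(a, b, 0) \<in> rational_bumps I" using a b by (auto simp: rational_bumps_def)
      with True show False by auto
    qed
    then show ?thesis using N by auto
  next
    case False
    then obtain q where q: "q \<in> rational_bumps I" by auto
    define c where "c = (LINT x|lborel. (f x - N x) * nbump q x)"
    have i: "integrable lborel (\<lambda>x. (f x - N x) * nbump p x)" "integrable lborel (\<lambda>x. f x * nbump p x)"
       "integrable lborel (\<lambda>x. N x * nbump p x)"
      if p: "p \<in> rational_bumps I" for p
    proof -
      obtain a b n where pp: "p = (a, b, n)" "a < b" using p by (auto simp: rational_bumps_def)
      show "integrable lborel (\<lambda>x. (f x - N x) * nbump p x)" 
        by (rule integrable_times_test[of a b]) (use eN[of a b 0] pp in \<open>auto simp: smooth_nbump nbump_eq_0\<close>)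
      show "integrable lborel (\<lambda>x. f x * nbump p x)" 
        by (rule integrable_times_test[of a b]) (use bounded_borel_set_integrable[OF f] pp in \<open>auto simp: smooth_nbump nbump_eq_0\<close>)
      show "integrable lborel (\<lambda>x. N x * nbump p x)" 
        by (rule integrable_times_test[of a b]) (use borel_integrable_atLeastAtMost'[OF cN] pp in \<open>auto simp: smooth_nbump nbump_eq_0\<close>)
    qed
    have c: "(LINT x|lborel. (f x - N x) * nbump p x) = c" if p: "p \<in> rational_bumps I" for p
      using w[OF p q] Npq[OF p q] i[OF p] i[OF q] unfolding c_def
      by (simp add: left_diff_distrib right_diff_distrib)
    have "AE x in lborel. x \<in> I \<longrightarrow> f x - N x - c = 0"
    proof (rule AE_zero_if_orthogonal_to_bumps[OF I(1) eN])
      fix a b :: real and n assume ab: "a \<in> \<rat>" "b \<in> \<rat>" "a < b" "{a..b} \<subseteq> I"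
      then have p: "(a, b, n) \<in> rational_bumps I" by (auto simp: rational_bumps_def)
      have s: "smooth (nbump (a, b, n))" by (rule smooth_nbump)
      have "(LINT x|lborel. (f x - N x - c) * nbump (a, b, n) x) =
        (LINT x|lborel. (f x - N x) * nbump (a, b, n) x) - (LINT x|lborel. c * nbump (a, b, n) x)"
        unfolding left_diff_distrib[of _ c] using i(1)[OF p]
        by (intro Bochner_Integration.integral_diff integrable_times_test[of a b "\<lambda>_. c"]
             bounded_borel_set_integrable bounded_borel_const s) (auto simp: nbump_eq_0)
      also have "(LINT x|lborel. c * nbump (a, b, n) x) = integral {a..b} (\<lambda>x. c * nbump (a, b, n) x)"
        by (intro integral_times_test s) (auto simp: nbump_eq_0)
      also have "\<dots> = c" using integral_nbump[of a a b b n] ab by simp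
      finally have "(LINT x|lborel. (f x - N x - c) * nbump (a, b, n) x) = 0" using c[OF p] by simp
      then show "(LINT x|lborel. (f x - N x - c) * bump a b n x) = 0"
      proof -
        obtain m where m: "\<And>x. bump a b n x = m * nbump (a, b, n) x" using bump_eq_nbump[OF ab(3)] by blast
        have eq: "(f x - N x - c) * bump a b n x = m * ((f x - N x - c) * nbump (a, b, n) x)" for x
          unfolding m by (simp only: mult.left_commute)
        show ?thesis
          unfolding eq using \<open>(LINT x|lborel. (f x - N x - c) * nbump (a, b, n) x) = 0\<close> by simp
      qed
    qed
    then show ?thesis using N by (intro exI[of _ "\<lambda>x. N x + c"]) auto
  qed
qed

section \<open>Passing between the plane and almost every slice\<close>

lemma integrable_lborel_pair_bounded:
  fixes F :: "real \<times> real \<Rightarrow> real"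
  assumes "bounded_borel F" "\<And>z. z \<notin> {a..b} \<times> {c..d} \<Longrightarrow> F z = 0"
  shows "integrable lborel F"
proof -
  obtain C where C: "\<And>x. \<bar>F x\<bar> \<le> C" "F \<in> borel_measurable borel" using bounded_borelE[OF assms(1)] by metis
  have "integrable lborel (\<lambda>z. C * indicator (cbox (a, c) (b, d)) z)"
    using emeasure_lborel_cbox_finite[of "(a,c)" "(b,d)"]
    by (intro integrable_mult_right integrable_real_indicator) auto
  then show ?thesis
  proof (rule Bochner_Integration.integrable_bound)
    show "AE z in lborel. norm (F z) \<le> norm (C * indicator (cbox (a, c) (b, d)) z)"
    proof (rule AE_I2)
      fix z show "norm (F z) \<le> norm (C * indicator (cbox (a, c) (b, d)) z)"
        using C(1)[of z] assms(2)[of z] by (cases "z \<in> {a..b} \<times> {c..d}") (auto simp: cbox_Pair_eq)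
    qed
  qed (use C(2) in auto)
qed

lemma lborel_Fubini:
  fixes F :: "real \<times> real \<Rightarrow> real"
  assumes "integrable lborel F"
  shows "integrable lborel (\<lambda>t. LINT x|lborel. F (x, t))"
    "(LINT t|lborel. LINT x|lborel. F (x, t)) = (LINT z|lborel. F z)"
    "integrable lborel (\<lambda>x. LINT t|lborel. F (x, t))"
    "(LINT x|lborel. LINT t|lborel. F (x, t)) = (LINT z|lborel. F z)"
    "AE t in lborel. integrable lborel (\<lambda>x. F (x, t))"
  using lborel_pair.integrable_snd[of "\<lambda>x t. F (x, t)"] lborel_pair.integral_snd[of "\<lambda>x t. F (x, t)"]
    lborel_pair.integrable_fst[of "\<lambda>x t. F (x, t)"] lborel_pair.integral_fst[of "\<lambda>x t. F (x, t)"]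
    lborel_pair.AE_integrable_snd[of "\<lambda>x t. F (x, t)"] assms
  by (simp_all add: lborel_prod)

text \<open>Integration in x first leaves a function of t that is orthogonal to every rational bump.
  Integrability is asked only over compact time intervals inside J, since nothing is known at its
  ends.\<close>

lemma AE_slice_integral_zero:
  fixes F :: "real \<times> real \<Rightarrow> real"
  assumes J: "open J" and F: "\<And>c d. {c..d} \<subseteq> J \<Longrightarrow> integrable lborel (\<lambda>z. F z * indicator {c..d} (snd z))"
    and z: "\<And>c d n. (c, d, n) \<in> rational_bumps J \<Longrightarrow> (LINT z|lborel. F z * bump c d n (snd z)) = 0"
  shows "AE t in lborel. t \<in> J \<longrightarrow> (LINT x|lborel. F (x, t)) = 0"
proof (rule AE_zero_if_orthogonal_to_bumps[OF J])
  fix c d assume "{c..d} \<subseteq> J"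
  from lborel_Fubini(1)[OF F[OF this]]
  show "set_integrable lborel {c..d} (\<lambda>t. LINT x|lborel. F (x, t))"
    by (simp add: set_integrable_def mult.commute)
next
  fix c d :: real and n assume cd: "c \<in> \<rat>" "d \<in> \<rat>" "c < d" "{c..d} \<subseteq> J"
  have "integrable lborel (\<lambda>z. F z * indicator {c..d} (snd z) * bump c d n (snd z))"
  proof (rule Bochner_Integration.integrable_bound[OF F[OF cd(4)]])
    have m: "(\<lambda>z::real \<times> real. bump c d n (snd z)) \<in> borel_measurable borel"
      by (intro measurable_compose[OF borel_measurable_continuous_onI smooth_borel[OF smooth_bump]] continuous_on_snd continuous_on_id)
    show "(\<lambda>z. F z * indicator {c..d} (snd z) * bump c d n (snd z)) \<in> borel_measurable lborel"
      by (rule borel_measurable_times[OF borel_measurable_integrable[OF F[OF cd(4)]]]) (use m in simp)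
    show "AE z in lborel. norm (F z * indicator {c..d} (snd z) * bump c d n (snd z)) \<le> norm (F z * indicator {c..d} (snd z))"
      using bump_nonneg bump_le_1 by (intro AE_I2) (auto simp: abs_mult intro!: mult_left_le)
  qed
  moreover have "F z * indicator {c..d} (snd z) * bump c d n (snd z) = F z * bump c d n (snd z)" for z
    using bump_eq_0[of "snd z" c d n] by (cases "snd z \<in> {c..d}") (auto simp: indicator_def)
  ultimately have i: "integrable lborel (\<lambda>z. F z * bump c d n (snd z))" by simp
  have "(LINT t|lborel. (LINT x|lborel. F (x, t)) * bump c d n t) = (LINT z|lborel. F z * bump c d n (snd z))"
    using lborel_Fubini(2)[OF i] by simp
  also have "\<dots> = 0" using z cd by (auto simp: rational_bumps_def)
  finally show "(LINT t|lborel. (LINT x|lborel. F (x, t)) * bump c d n t) = 0" .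
qed

lemma bounded_borel_compose:
  assumes f: "bounded_borel f" and g: "g \<in> borel_measurable borel"
  shows "bounded_borel (\<lambda>x. f (g x))"
  using f measurable_compose[OF g] unfolding bounded_borel_def by auto

lemma bounded_borel_slice:
  fixes f :: "real \<times> real \<Rightarrow> real"
  assumes "bounded_borel f" shows "bounded_borel (\<lambda>x. f (x, t))" "bounded_borel (\<lambda>t. f (x, t))"
  by (rule bounded_borel_compose[OF assms], intro borel_measurable_continuous_onI continuous_intros)+

lemma bounded_borel_test:
  assumes "smooth \<phi>" "\<And>x. x \<notin> {a..b} \<Longrightarrow> \<phi> x = 0"
  shows "bounded_borel \<phi>"
proof -
  obtain C where "\<And>x. x \<in> {a..b} \<Longrightarrow> \<bar>\<phi> x\<bar> \<le> C" "C \<ge> 0"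
    using continuous_bounded_interval[OF smooth_continuous_on[OF assms(1)]] by metis
  then have "\<bar>\<phi> x\<bar> \<le> C" for x using assms(2)[of x] by (cases "x \<in> {a..b}") auto
  then show ?thesis using smooth_borel[OF assms(1)] by (auto simp: bounded_borel_def)
qed

lemma bounded_borel_fst: "bounded_borel \<phi> \<Longrightarrow> bounded_borel (\<lambda>z::real \<times> real. \<phi> (fst z))"
  and bounded_borel_snd: "bounded_borel \<phi> \<Longrightarrow> bounded_borel (\<lambda>z::real \<times> real. \<phi> (snd z))"
  for \<phi> :: "real \<Rightarrow> real"
  by (erule bounded_borel_compose, intro borel_measurable_continuous_onI continuous_intros)+

text \<open>For one pair of bumps, product test functions localise in t and give the one-dimensional
  weak identity on almost every slice. The exceptional set depends on the pair; as
  \<open>rational_bumps\<close> is countable, the union of these sets is still null, and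
  \<open>weak_derivative_imp_primitive\<close> asks for no other test functions.\<close>

lemma weak_derivative_slices:
  fixes f g :: "real \<times> real \<Rightarrow> real"
  assumes I: "open I" "is_interval I" and J: "open J" and f: "bounded_borel f" and g: "bounded_borel g"
    and w: "\<forall>\<phi> \<psi>. test_on I \<phi> \<longrightarrow> test_on J \<psi> \<longrightarrow>
       (LINT z|lborel. f z * (deriv \<phi> (fst z) * \<psi> (snd z))) = - (LINT z|lborel. g z * (\<phi> (fst z) * \<psi> (snd z)))"
  shows "AE t in lborel. t \<in> J \<longrightarrow> (\<exists>N. (\<forall>x y. x \<le> y \<longrightarrow> N y - N x = integral {x..y} (\<lambda>s. g (s, t))) \<and>
             (AE x in lborel. x \<in> I \<longrightarrow> f (x, t) = N x))"
proof -
  have 1: "AE t in lborel. t \<in> J \<longrightarrow>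
      (LINT x|lborel. f (x, t) * (nbump p x - nbump q x)) = - (LINT x|lborel. g (x, t) * bump_primitive p q x)"
    if pq: "p \<in> rational_bumps I" "q \<in> rational_bumps I" for p q
  proof -
    obtain a b n where p: "p = (a, b, n)" "a < b" "{a..b} \<subseteq> I" using pq by (auto simp: rational_bumps_def)
    obtain c d k where q: "q = (c, d, k)" "c < d" "{c..d} \<subseteq> I" using pq by (auto simp: rational_bumps_def)
    let ?l = "min a c" and ?u = "max b d"
    note D = bump_primitive[OF p(1,2) q(1,2)]
    let ?\<phi> = "bump_primitive p q"
    have d\<phi>: "deriv ?\<phi> = (\<lambda>x. nbump p x - nbump q x)" using D(1) by (auto intro!: DERIV_imp_deriv)
    have t\<phi>: "test_on I ?\<phi>" by (rule test_on_bump_primitive[OF I(2) p q])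
    have z0: "nbump p x - nbump q x = 0" if "x \<notin> {?l..?u}" for x
    proof -
      have "x \<notin> {a<..<b}" "x \<notin> {c<..<d}" using that by auto
      then show ?thesis using p q by (simp add: nbump_eq_0)
    qed
    have z1: "?\<phi> x = 0" if "x \<notin> {?l..?u}" for x using D(2)[of x] that by auto
    have s: "smooth ?\<phi>" using t\<phi> by (simp add: test_on_def)
    have s': "smooth (\<lambda>x. nbump p x - nbump q x)" using smooth_deriv[OF s] d\<phi> by simp
    have b: "bounded_borel ?\<phi>" by (rule bounded_borel_test[OF s z1])
    have b': "bounded_borel (\<lambda>x. nbump p x - nbump q x)" by (rule bounded_borel_test[OF s' z0])
    define F where "F z = f z * (nbump p (fst z) - nbump q (fst z)) + g z * ?\<phi> (fst z)" for z
    have bF: "bounded_borel F"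
      unfolding F_def by (intro bounded_borel_add bounded_borel_mult f g bounded_borel_fst[OF b] bounded_borel_fst[OF b'])
    have "AE t in lborel. t \<in> J \<longrightarrow> (LINT x|lborel. F (x, t)) = 0"
    proof (rule AE_slice_integral_zero[OF J])
      fix c d :: real
      have bi: "bounded_borel (\<lambda>x. indicator {c..d} x :: real)"
        unfolding bounded_borel_def by (auto intro!: exI[of _ 1] simp: indicator_def)
      show "integrable lborel (\<lambda>z. F z * indicator {c..d} (snd z))"
      proof (rule integrable_lborel_pair_bounded[of _ ?l ?u c d])
        show "bounded_borel (\<lambda>z. F z * indicator {c..d} (snd z))"
          by (rule bounded_borel_mult[OF bF bounded_borel_snd[OF bi]])
        show "F z * indicator {c..d} (snd z) = 0" if "z \<notin> {?l..?u} \<times> {c..d}" for z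
          using that z0[of "fst z"] z1[of "fst z"] by (cases z) (auto simp: F_def indicator_def simp del: atLeastAtMost_iff)
      qed
    next
      fix c d :: real and n assume cd: "(c, d, n) \<in> rational_bumps J"
      let ?\<psi> = "bump c d n"
      have t\<psi>: "test_on J ?\<psi>" using cd by (intro test_on_bump) (auto simp: rational_bumps_def)
      have b\<psi>: "bounded_borel ?\<psi>" by (rule bounded_borel_test[of _ c d]) (auto simp: smooth_bump bump_eq_0)
      have \<psi>0: "?\<psi> y = 0" if "y \<notin> {c..d}" for y using that by (intro bump_eq_0) auto
      have i1: "integrable lborel (\<lambda>z. f z * (deriv ?\<phi> (fst z) * ?\<psi> (snd z)))"
        unfolding d\<phi>
      proof (rule integrable_lborel_pair_bounded[of _ ?l ?u c d])
        show "bounded_borel (\<lambda>z. f z * ((nbump p (fst z) - nbump q (fst z)) * ?\<psi> (snd z)))"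
          by (rule bounded_borel_mult[OF f bounded_borel_mult[OF bounded_borel_fst[OF b'] bounded_borel_snd[OF b\<psi>]]])
        show "f z * ((nbump p (fst z) - nbump q (fst z)) * ?\<psi> (snd z)) = 0" if "z \<notin> {?l..?u} \<times> {c..d}" for z
          using that z0[of "fst z"] \<psi>0[of "snd z"] by (cases z) (auto simp del: atLeastAtMost_iff)
      qed
      have i2: "integrable lborel (\<lambda>z. g z * (?\<phi> (fst z) * ?\<psi> (snd z)))"
      proof (rule integrable_lborel_pair_bounded[of _ ?l ?u c d])
        show "bounded_borel (\<lambda>z. g z * (?\<phi> (fst z) * ?\<psi> (snd z)))"
          by (rule bounded_borel_mult[OF g bounded_borel_mult[OF bounded_borel_fst[OF b] bounded_borel_snd[OF b\<psi>]]])
        show "g z * (?\<phi> (fst z) * ?\<psi> (snd z)) = 0" if "z \<notin> {?l..?u} \<times> {c..d}" for z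
          using that z1[of "fst z"] \<psi>0[of "snd z"] by (cases z) (auto simp del: atLeastAtMost_iff)
      qed
      have "(LINT z|lborel. F z * ?\<psi> (snd z)) =
        (LINT z|lborel. f z * (deriv ?\<phi> (fst z) * ?\<psi> (snd z)) + g z * (?\<phi> (fst z) * ?\<psi> (snd z)))"
        unfolding F_def d\<phi> by (intro Bochner_Integration.integral_cong) (auto simp: algebra_simps)
      also have "\<dots> = 0" using w[rule_format, OF t\<phi> t\<psi>] Bochner_Integration.integral_add[OF i1 i2] by simp
      finally show "(LINT z|lborel. F z * ?\<psi> (snd z)) = 0" .
    qed
    then show ?thesis
    proof eventually_elim
      case (elim t)
      have "integrable lborel (\<lambda>x. f (x, t) * (nbump p x - nbump q x))"
        "integrable lborel (\<lambda>x. g (x, t) * ?\<phi> x)"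
        using integrable_times_test[OF bounded_borel_set_integrable[OF bounded_borel_slice(1)[OF f]] s' z0]
         integrable_times_test[OF bounded_borel_set_integrable[OF bounded_borel_slice(1)[OF g]] s z1] by auto
      from Bochner_Integration.integral_add[OF this] elim show ?case by (auto simp: F_def)
    qed
  qed
  have "AE t in lborel. \<forall>p \<in> rational_bumps I. \<forall>q \<in> rational_bumps I. t \<in> J \<longrightarrow>
      (LINT x|lborel. f (x, t) * (nbump p x - nbump q x)) = - (LINT x|lborel. g (x, t) * bump_primitive p q x)"
    using 1 by (simp only: AE_ball_countable[OF countable_rational_bumps]) blast
  then show ?thesis
  proof eventually_elim
    case (elim t)
    then show ?case
      by (intro impI weak_derivative_imp_primitive[OF I] bounded_borel_slice f g) auto
  qed
qed

text \<open>The one-dimensional criterion is applied twice: in t for each fixed bump in x, then in x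
  on almost every slice. It serves to show that weak derivatives are unique.\<close>

lemma AE_pair_zero_if_orthogonal_to_bumps:
  fixes d :: "real \<times> real \<Rightarrow> real"
  assumes d: "d \<in> borel_measurable borel"
    and i: "\<And>a b c e. \<tau> < c \<Longrightarrow> e < T \<Longrightarrow> integrable lborel (\<lambda>z. d z * indicator ({a..b} \<times> {c..e}) z)"
    and z: "\<And>a b n c e k. a < b \<Longrightarrow> (c, e, k) \<in> rational_bumps {\<tau><..<T} \<Longrightarrow>
       (LINT z|lborel. d z * (bump a b n (fst z) * bump c e k (snd z))) = 0"
  shows "AE z in lborel. snd z \<in> {\<tau><..<T} \<longrightarrow> d z = 0"
proof -
  let ?J = "{\<tau><..<T}"
  have 1: "AE t in lborel. t \<in> ?J \<longrightarrow> (LINT x|lborel. d (x, t) * bump a b n x) = 0" if "a < b" for a b n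
  proof -
    have "AE t in lborel. t \<in> ?J \<longrightarrow> (LINT x|lborel. (\<lambda>z. d z * bump a b n (fst z)) (x, t)) = 0"
    proof (rule AE_slice_integral_zero)
      fix c e assume ce: "{c..e} \<subseteq> ?J"
      show "integrable lborel (\<lambda>z. d z * bump a b n (fst z) * indicator {c..e} (snd z))"
      proof (cases "c \<le> e")
        case False then show ?thesis by simp
      next
        case True
        then have "\<tau> < c" "e < T" using ce by auto
        from i[OF this, of a b] show ?thesis
        proof (rule Bochner_Integration.integrable_bound)
          have m: "(\<lambda>z::real \<times> real. bump a b n (fst z)) \<in> borel_measurable borel"
            by (intro measurable_compose[OF borel_measurable_continuous_onI smooth_borel[OF smooth_bump]] continuous_on_fst continuous_on_id)
          have m2: "(\<lambda>z::real \<times> real. indicator {c..e} (snd z) :: real) \<in> borel_measurable borel"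
            by (intro measurable_compose[OF borel_measurable_continuous_onI borel_measurable_indicator] continuous_on_snd continuous_on_id) auto
          show "(\<lambda>z. d z * bump a b n (fst z) * indicator {c..e} (snd z)) \<in> borel_measurable lborel"
            using d m m2 by (auto intro!: borel_measurable_times)
          show "AE z in lborel. norm (d z * bump a b n (fst z) * indicator {c..e} (snd z)) \<le> norm (d z * indicator ({a..b} \<times> {c..e}) z)"
          proof (rule AE_I2)
            fix z show "norm (d z * bump a b n (fst z) * indicator {c..e} (snd z)) \<le> norm (d z * indicator ({a..b} \<times> {c..e}) z)"
              using bump_nonneg[of a b n "fst z"] bump_le_1[of a b n "fst z"] bump_eq_0[of "fst z" a b n]
              by (cases z; cases "fst z \<in> {a..b}") (auto simp: indicator_def abs_mult intro!: mult_left_le)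
          qed
        qed
      qed
    qed (use z[OF that] in \<open>auto simp: mult.assoc\<close>)
    then show ?thesis by simp
  qed
  have 2: "AE t in lborel. \<forall>p \<in> rational_bumps UNIV. t \<in> ?J \<longrightarrow> (LINT x|lborel. d (x, t) * (\<lambda>(a, b, n). bump a b n) p x) = 0"
    using 1 by (subst AE_ball_countable[OF countable_rational_bumps]) (auto simp: rational_bumps_def)
  \<comment> \<open>A countable exhaustion by rectangles, so that a single null set of times serves
    all compact intervals in x.\<close>
  have 3: "AE t in lborel. \<forall>n m :: nat. integrable lborel (\<lambda>x. d (x, t) *
      indicator ({- real n..real n} \<times> {\<tau> + inverse (Suc m)..T - inverse (Suc m)}) (x, t))"
    by (intro AE_all_countable[THEN iffD2] allI lborel_Fubini(5) i) auto
  have AEt: "AE t in lborel. AE x in lborel. t \<in> ?J \<longrightarrow> d (x, t) = 0"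
    using 2 3
  proof eventually_elim
    case (elim t)
    show ?case
    proof (cases "t \<in> ?J")
      case True
      have "AE x in lborel. x \<in> UNIV \<longrightarrow> d (x, t) = 0"
      proof (rule AE_zero_if_orthogonal_to_bumps)
        fix a b :: real
        have "min (t - \<tau>) (T - t) > 0" using True by auto
        then obtain m where m: "inverse (Suc m) < min (t - \<tau>) (T - t)" using reals_Archimedean by blast
        obtain n :: nat where n: "\<bar>a\<bar> + \<bar>b\<bar> \<le> n" using real_arch_simple by blast
        have "integrable lborel (\<lambda>x. d (x, t) * indicator ({- real n..real n} \<times> {\<tau> + inverse (Suc m)..T - inverse (Suc m)}) (x, t))"
          using elim(2) by blast
        then have "set_integrable lborel {- real n..real n} (\<lambda>x. d (x, t))"
          using m by (simp add: set_integrable_def indicator_times mult.commute)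
        then show "set_integrable lborel {a..b} (\<lambda>x. d (x, t))"
          by (rule set_integrable_subset) (use n in auto)
      next
        fix a b :: real and n assume "a \<in> \<rat>" "b \<in> \<rat>" "a < b"
        then show "(LINT x|lborel. d (x, t) * bump a b n x) = 0"
          using elim(1)[rule_format, of "(a, b, n)"] True by (auto simp: rational_bumps_def)
      qed auto
      then show ?thesis by simp
    qed auto
  qed
  \<comment> \<open>Exchanging the two almost-everywhere quantifiers requires the exceptional set to
    be measurable.\<close>
  have ms: "{z. snd z \<in> ?J \<longrightarrow> d z = 0} \<in> sets borel"
  proof -
    have "{z. snd z \<in> ?J \<longrightarrow> d z = 0} = - (UNIV \<times> ?J) \<union> d -` {0}" by auto
    moreover have "open (UNIV \<times> ?J)" by (intro open_Times) auto
    then have "- (UNIV \<times> ?J) \<in> sets borel" by (intro borel_closed closed_Compl)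
    moreover have "d -` {0} \<in> sets borel" using measurable_sets_borel[OF d, of "{0}"] by auto
    ultimately show ?thesis by (metis sets.Un)
  qed
  have sp: "{z \<in> space (lborel \<Otimes>\<^sub>M lborel). snd z \<in> ?J \<longrightarrow> d z = 0} \<in> sets (lborel \<Otimes>\<^sub>M lborel)"
    using ms by (simp only: lborel_prod sets_lborel space_lborel space_borel UNIV_I simp_thms)
  have "AE x in lborel. AE t in lborel. snd (x, t) \<in> ?J \<longrightarrow> d (x, t) = 0"
    using lborel_pair.AE_commute[of "\<lambda>x t. t \<in> ?J \<longrightarrow> d (x, t) = 0"] sp AEt by simp
  then have "AE z in lborel \<Otimes>\<^sub>M lborel. snd z \<in> ?J \<longrightarrow> d z = 0"
    by (intro lborel_pair.AE_pair_measure sp)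
  then show ?thesis by (simp only: lborel_prod)
qed

section \<open>Representatives of weak derivatives\<close>

text \<open>The set where f exceeds C is open and null, hence empty.\<close>

lemma AE_continuous_le:
  fixes f :: "'a::euclidean_space \<Rightarrow> real"
  assumes U: "open U" and f: "continuous_on U f" and ae: "AE x in lborel. x \<in> U \<longrightarrow> f x \<le> C" and x: "x \<in> U"
  shows "f x \<le> C"
proof (rule ccontr)
  assume "\<not> f x \<le> C"
  let ?A = "U \<inter> f -` {C<..}"
  have o: "open ?A" using continuous_open_preimage[OF f U] by auto
  have "AE x in lebesgue. x \<notin> ?A" using AE_completion[OF ae] by eventually_elim auto
  then have "negligible ?A"
    using o by (subst negligible_iff_null_sets) (auto simp: AE_iff_null_sets)
  moreover have "?A \<noteq> {}" using x \<open>\<not> f x \<le> C\<close> by auto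
  ultimately show False using open_not_negligible[OF o] by blast
qed

lemma AE_continuous_eq:
  fixes f g :: "'a::euclidean_space \<Rightarrow> real"
  assumes U: "open U" and f: "continuous_on U f" "continuous_on U g"
    and ae: "AE x in lborel. x \<in> U \<longrightarrow> f x = g x" and x: "x \<in> U"
  shows "f x = g x"
proof -
  have "AE x in lborel. x \<in> U \<longrightarrow> f x - g x \<le> 0" using ae by eventually_elim auto
  from AE_continuous_le[OF U _ this x] f have 1: "f x - g x \<le> 0" by (auto intro: continuous_intros)
  have "AE x in lborel. x \<in> U \<longrightarrow> g x - f x \<le> 0" using ae by eventually_elim auto
  from AE_continuous_le[OF U _ this x] f have "g x - f x \<le> 0" by (auto intro: continuous_intros)
  with 1 show ?thesis by simp
qed

lemma AE_restrict_lebesgue: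
  assumes "AE z in lebesgue_on \<Omega>. P z" "\<Omega> \<in> sets lebesgue"
  shows "AE z in lebesgue. z \<in> \<Omega> \<longrightarrow> P z"
  using assms by (subst (asm) AE_restrict_space_iff) auto

lemma AE_lebesgueD: "AE z in lebesgue. P z \<Longrightarrow> AE z in lborel. P z"
  by (simp add: AE_completion_iff)

text \<open>Weak derivatives are defined with the completed measure, while Fubini is used for
  \<open>lborel\<close>. Cutting f off to an exhausting sequence of compact rectangles shows that it
  is Lebesgue measurable on the open strip, and completion supplies a Borel version.\<close>

lemma locally_integrable_borel_rep:
  assumes f: "locally_integrable_on f W" and U: "UNIV \<times> {\<tau><..<T} \<subseteq> W"
  shows "\<exists>f'. f' \<in> borel_measurable borel \<and> (AE z in lborel. snd z \<in> {\<tau><..<T} \<longrightarrow> f' z = f z)"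
proof -
  define R where "R n = {- real n..real n} \<times> {\<tau> + inverse (Suc n)..T - inverse (Suc n)}" for n
  define F where "F z = (if snd z \<in> {\<tau><..<T} then f z else 0)" for z
  have RU: "R n \<subseteq> UNIV \<times> {\<tau><..<T}" for n
    by (auto simp: R_def) (smt (verit) inverse_positive_iff_positive of_nat_0_less_iff zero_less_Suc)+
  have "F \<in> borel_measurable lebesgue"
  proof (rule borel_measurable_LIMSEQ_real)
    show "(\<lambda>z. indicator (R n) z * f z) \<in> borel_measurable lebesgue" for n
    proof -
      have "compact (R n)" unfolding R_def by (intro compact_Times) auto
      then have "set_integrable lebesgue (R n) f" using f RU U unfolding locally_integrable_on_def by blast
      then show ?thesis by (auto simp: set_integrable_def)
    qed
    show "(\<lambda>n. indicator (R n) z * f z) \<longlonglongrightarrow> F z" for z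
    proof (cases "snd z \<in> {\<tau><..<T}")
      case True
      then have "min (snd z - \<tau>) (T - snd z) > 0" by auto
      then obtain m where m: "inverse (Suc m) < min (snd z - \<tau>) (T - snd z)" using reals_Archimedean by blast
      obtain k :: nat where k: "\<bar>fst z\<bar> \<le> k" using real_arch_simple by blast
      have "indicator (R n) z * f z = F z" if "n \<ge> max m k" for n
      proof -
        have "inverse (real (Suc n)) \<le> inverse (real (Suc m))" using that by (intro le_imp_inverse_le) auto
        moreover have "\<bar>fst z\<bar> \<le> real n" using k that by (auto intro: order_trans)
        moreover have "inverse (real (Suc m)) < snd z - \<tau>" "inverse (real (Suc m)) < T - snd z" using m by auto
        ultimately have "fst z \<in> {- real n..real n}"
          "snd z \<in> {\<tau> + inverse (real (Suc n))..T - inverse (real (Suc n))}"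
          unfolding atLeastAtMost_iff by linarith+
        then have "z \<in> R n" unfolding R_def mem_Times_iff by blast
        then show ?thesis using True by (simp add: F_def)
      qed
      then have "\<forall>\<^sub>F n in sequentially. F z = indicator (R n) z * f z"
        unfolding eventually_sequentially by (intro exI[of _ "max m k"]) simp
      then show ?thesis by (rule Lim_transform_eventually[OF tendsto_const])
    next
      case False
      then have "z \<notin> R n" for n using RU[of n] by auto
      moreover have "F z = 0" using False by (auto simp: F_def)
      ultimately show ?thesis by simp
    qed
  qed
  then obtain f' where f': "f' \<in> borel_measurable lborel" "AE z in lborel. F z = f' z"
    using completion_ex_borel_measurable_real by blast
  from f'(2) have "AE z in lborel. snd z \<in> {\<tau><..<T} \<longrightarrow> f' z = f z"
    by eventually_elim (auto simp: F_def)
  with f'(1) show ?thesis by auto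
qed

text \<open>The weak identity is carried over to Borel representatives and \<open>lborel\<close>.
  Since the support of the test function is a compact rectangle inside the strip, the values outside
  the strip do not enter.\<close>

lemma weak_partial_product:
  assumes w: "weak_partial i j W f g" and U: "UNIV \<times> {\<tau><..<T} \<subseteq> W"
    and f': "f' \<in> borel_measurable borel" "AE z in lborel. snd z \<in> {\<tau><..<T} \<longrightarrow> f' z = f z"
    and g': "g' \<in> borel_measurable borel" "AE z in lborel. snd z \<in> {\<tau><..<T} \<longrightarrow> g' z = g z"
    and \<phi>: "test_on UNIV \<phi>" and \<psi>: "test_on {\<tau><..<T} \<psi>"
  shows "(LINT z|lborel. f' z * ((deriv ^^ i) \<phi> (fst z) * (deriv ^^ j) \<psi> (snd z))) =
     (- 1) ^ (i + j) * (LINT z|lborel. g' z * (\<phi> (fst z) * \<psi> (snd z)))"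
proof -
  have int: "(LINT z:W|lebesgue. h z * (k (fst z) * l (snd z))) = (LINT z|lborel. h' z * (k (fst z) * l (snd z)))"
    if h: "locally_integrable_on h W" and h': "h' \<in> borel_measurable borel" "AE z in lborel. snd z \<in> {\<tau><..<T} \<longrightarrow> h' z = h z"
      and k: "test_on UNIV k" and l: "test_on {\<tau><..<T} l"
    for h h' :: "real \<times> real \<Rightarrow> real" and k l :: "real \<Rightarrow> real"
  proof -
    obtain a b where ab: "a < b" "\<And>x. x \<notin> {a..b} \<Longrightarrow> k x = 0" "smooth k"
      using k unfolding test_on_def by blast
    obtain c d where cd: "c < d" "{c..d} \<subseteq> {\<tau><..<T}" "\<And>x. x \<notin> {c..d} \<Longrightarrow> l x = 0" "smooth l"
      using l unfolding test_on_def by blast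
    let ?R = "{a..b} \<times> {c..d}"
    have "compact ?R" by (intro compact_Times) auto
    moreover have RW: "?R \<subseteq> W" using cd(2) U by auto
    ultimately have "set_integrable lebesgue ?R h" using h unfolding locally_integrable_on_def by blast
    then have hm: "(\<lambda>z. indicator ?R z * h z) \<in> borel_measurable lebesgue" by (auto simp: set_integrable_def)
    have klm: "(\<lambda>z. k (fst z) * l (snd z)) \<in> borel_measurable borel"
      by (intro borel_measurable_times measurable_compose[OF borel_measurable_continuous_onI smooth_borel]
          continuous_on_fst continuous_on_snd continuous_on_id ab cd)
    have zero: "k (fst z) * l (snd z) = 0" if "z \<notin> ?R" for z
      using that ab(2)[of "fst z"] cd(3)[of "snd z"] by (cases z) (auto simp del: atLeastAtMost_iff)
    have eq: "indicator W z *\<^sub>R (h z * (k (fst z) * l (snd z))) = indicator ?R z * h z * (k (fst z) * l (snd z))" for z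
      using zero[of z] RW by (cases "z \<in> ?R") (auto simp: indicator_def)
    have "(LINT z:W|lebesgue. h z * (k (fst z) * l (snd z))) = (LINT z|lebesgue. h' z * (k (fst z) * l (snd z)))"
      unfolding set_lebesgue_integral_def eq
    proof (rule integral_cong_AE)
      show "(\<lambda>z. indicator ?R z * h z * (k (fst z) * l (snd z))) \<in> borel_measurable lebesgue"
        by (intro borel_measurable_times[OF hm] measurable_completion) (use klm in simp)
      show "(\<lambda>z. h' z * (k (fst z) * l (snd z))) \<in> borel_measurable lebesgue"
        using h'(1) klm by (intro measurable_completion) simp
      show "AE z in lebesgue. indicator ?R z * h z * (k (fst z) * l (snd z)) = h' z * (k (fst z) * l (snd z))"
        using AE_completion[OF h'(2)]
      proof eventually_elim
        case (elim z)
        then show ?case using zero[of z] cd(2) by (cases "z \<in> ?R") (auto simp: indicator_def)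
      qed
    qed
    also have "\<dots> = (LINT z|lborel. h' z * (k (fst z) * l (snd z)))"
      using h'(1) klm by (intro integral_completion) simp
    finally show ?thesis .
  qed
  let ?D = "\<lambda>i j z. (deriv ^^ i) \<phi> (fst z) * (deriv ^^ j) \<psi> (snd z)"
  have "test_function_jet W ?D" by (rule test_function_jet_product[OF \<phi> \<psi> U])
  then have "(LINT z:W|lebesgue. f z * ?D i j z) = (- 1) ^ (i + j) * (LINT z:W|lebesgue. g z * ?D 0 0 z)"
    using w by (auto simp: weak_partial_def)
  then show ?thesis
    using int[OF _ f' test_on_deriv_pow[OF \<phi>] test_on_deriv_pow[OF \<psi>]] int[OF _ g' \<phi> \<psi>] w
    by (simp add: weak_partial_def)
qed

text \<open>Two sources of derivatives have to be identified: those in the differential equation,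
  known only to be locally integrable, and the bounded ones of the Sobolev spaces, given on another
  open set. Both satisfy the same identity against product test functions, so they agree almost
  everywhere. Truncation at |C| turns the almost-everywhere bound into one that holds at every
  point.\<close>

lemma weak_partial_bounded_rep:
  assumes w: "weak_partial i j W f g" and U: "UNIV \<times> {\<tau><..<T} \<subseteq> W"
    and w2: "weak_partial i j W2 f g2" and U2: "UNIV \<times> {\<tau><..<T} \<subseteq> W2" 
    and g2: "AE z in lebesgue. z \<in> W2 \<longrightarrow> \<bar>g2 z\<bar> \<le> C"
  shows "\<exists>p. p \<in> borel_measurable borel \<and> (\<forall>z. \<bar>p z\<bar> \<le> \<bar>C\<bar>) \<and> (AE z in lborel. snd z \<in> {\<tau><..<T} \<longrightarrow> p z = g z)"
proof -
  obtain f' where f': "f' \<in> borel_measurable borel" "AE z in lborel. snd z \<in> {\<tau><..<T} \<longrightarrow> f' z = f z"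
    using locally_integrable_borel_rep[OF _ U] w by (auto simp: weak_partial_def)
  obtain g' where g': "g' \<in> borel_measurable borel" "AE z in lborel. snd z \<in> {\<tau><..<T} \<longrightarrow> g' z = g z"
    using locally_integrable_borel_rep[OF _ U] w by (auto simp: weak_partial_def)
  obtain g2' where g2': "g2' \<in> borel_measurable borel" "AE z in lborel. snd z \<in> {\<tau><..<T} \<longrightarrow> g2' z = g2 z"
    using locally_integrable_borel_rep[OF _ U2] w2 by (auto simp: weak_partial_def)
  define p where "p z = max (- \<bar>C\<bar>) (min \<bar>C\<bar> (g2' z))" for z
  have pm: "p \<in> borel_measurable borel" unfolding p_def using g2'(1) by measurable
  have p2: "AE z in lborel. snd z \<in> {\<tau><..<T} \<longrightarrow> p z = g2 z"
    using g2'(2) AE_lebesgueD[OF g2]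
  proof eventually_elim
    case (elim z)
    moreover have "snd z \<in> {\<tau><..<T} \<Longrightarrow> z \<in> W2" using U2 by (cases z) (auto simp: subset_iff)
    ultimately show ?case by (auto simp: p_def)
  qed
  have pC: "\<bar>p z\<bar> \<le> \<bar>C\<bar>" for z by (auto simp: p_def)
  have bp: "bounded_borel p" using pm pC unfolding bounded_borel_def by auto
  have ig: "integrable lborel (\<lambda>z. g' z * indicator ({a..b} \<times> {c..e}) z)" if ce: "\<tau> < c" "e < T" for a b c e
  proof -
    let ?R = "{a..b} \<times> {c..e}"
    have "?R \<subseteq> W" using ce U by auto
    moreover have "compact ?R" by (intro compact_Times) auto
    ultimately have i: "integrable lebesgue (\<lambda>z. indicator ?R z *\<^sub>R g z)"
      using w by (auto simp: weak_partial_def locally_integrable_on_def set_integrable_def)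
    have Rm: "?R \<in> sets borel" by (intro borel_closed closed_Times) auto
    have m: "(\<lambda>z. g' z * indicator ?R z) \<in> borel_measurable lborel" using g'(1) Rm by simp
    have "integrable lebesgue (\<lambda>z. g' z * indicator ?R z)"
    proof (rule integrable_cong_AE_imp[OF i])
      show "(\<lambda>z. g' z * indicator ?R z) \<in> borel_measurable lebesgue" by (rule measurable_completion[OF m])
      show "AE z in lebesgue. indicator ?R z *\<^sub>R g z = g' z * indicator ?R z"
        using AE_completion[OF g'(2)] by eventually_elim (use ce in \<open>auto simp: indicator_def\<close>)
    qed
    then show ?thesis using m by (simp add: integrable_completion)
  qed
  have ip: "integrable lborel (\<lambda>z. p z * indicator ({a..b} \<times> {c..e}) z)" for a b c e
  proof (rule integrable_lborel_pair_bounded[of _ a b c e])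
    have "bounded_borel (indicat_real ({a..b} \<times> {c..e}))"
      unfolding bounded_borel_def by (auto intro!: exI[of _ 1] borel_measurable_indicator borel_closed closed_Times simp: indicator_def)
    then show "bounded_borel (\<lambda>z. p z * indicator ({a..b} \<times> {c..e}) z)" by (intro bounded_borel_mult bp)
  qed auto
  have "AE z in lborel. snd z \<in> {\<tau><..<T} \<longrightarrow> p z - g' z = 0"
  proof (rule AE_pair_zero_if_orthogonal_to_bumps)
    show "(\<lambda>z. p z - g' z) \<in> borel_measurable borel" using pm g'(1) by simp
    show "integrable lborel (\<lambda>z. (p z - g' z) * indicator ({a..b} \<times> {c..e}) z)" if "\<tau> < c" "e < T" for a b c e
      unfolding left_diff_distrib by (intro Bochner_Integration.integrable_diff ip ig that)
    fix a b :: real and n and c e :: real and k assume ab: "a < b" and ce: "(c, e, k) \<in> rational_bumps {\<tau><..<T}"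
    let ?X = "\<lambda>z. bump a b n (fst z) * bump c e k (snd z)"
    have ce': "c < e" "{c..e} \<subseteq> {\<tau><..<T}" using ce by (auto simp: rational_bumps_def)
    have t: "test_on UNIV (bump a b n)" "test_on {\<tau><..<T} (bump c e k)"
      using ab ce' by (auto intro: test_on_bump)
    have Xm: "?X \<in> borel_measurable borel"
      by (intro borel_measurable_times measurable_compose[OF borel_measurable_continuous_onI smooth_borel]
          continuous_on_fst continuous_on_snd continuous_on_id smooth_bump)
    have X0: "?X z = 0" if "z \<notin> {a..b} \<times> {c..e}" for z
      using that bump_eq_0[of "fst z" a b n] bump_eq_0[of "snd z" c e k] by (cases z) auto
    have X1: "\<bar>?X z\<bar> \<le> 1" for z
      using bump_nonneg bump_le_1 by (auto simp: abs_mult intro!: mult_le_one)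
    have iX: "integrable lborel (\<lambda>z. h z * ?X z)"
      if h: "integrable lborel (\<lambda>z. h z * indicator ({a..b} \<times> {c..e}) z)" "h \<in> borel_measurable borel" for h
    proof (rule Bochner_Integration.integrable_bound[OF h(1)])
      show "(\<lambda>z. h z * ?X z) \<in> borel_measurable lborel" using h(2) Xm by simp
      show "AE z in lborel. norm (h z * ?X z) \<le> norm (h z * indicator ({a..b} \<times> {c..e}) z)"
      proof (rule AE_I2)
        fix z show "norm (h z * ?X z) \<le> norm (h z * indicator ({a..b} \<times> {c..e}) z)"
        proof (cases "z \<in> {a..b} \<times> {c..e}")
          case True then show ?thesis using X1[of z] unfolding real_norm_def abs_mult[of "h z"]
            by (simp add: mult_left_le)
        next
          case False
          show ?thesis unfolding X0[OF False] by simp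
        qed
      qed
    qed
    have "(- 1) ^ (i + j) * (LINT z|lborel. p z * ?X z) = (- 1) ^ (i + j) * (LINT z|lborel. g' z * ?X z)"
      using weak_partial_product[OF w U f' g' t] weak_partial_product[OF w2 U2 f' pm p2 t] by simp
    then have "(LINT z|lborel. p z * ?X z) = (LINT z|lborel. g' z * ?X z)" by simp
    moreover have "c > \<tau>" "e < T" using ce'(1) subsetD[OF ce'(2), of c] subsetD[OF ce'(2), of e] by auto
    ultimately show "(LINT z|lborel. (p z - g' z) * ?X z) = 0"
      unfolding left_diff_distrib using iX[OF ip pm] iX[OF ig g'(1)]
      by (subst Bochner_Integration.integral_diff) auto
  qed
  then have "AE z in lborel. snd z \<in> {\<tau><..<T} \<longrightarrow> p z = g z"
    using g'(2) by eventually_elim auto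
  with pm pC show ?thesis by blast
qed

section \<open>Regularity of solutions of the obstacle problem\<close>

lemma interior_strip: "interior (strip T) = UNIV \<times> {0<..<T}"
  by (simp add: strip_def interior_Times)

lemma sets_strip: "strip T \<in> sets lebesgue" "strip T - closure (Q \<rho>) \<in> sets lebesgue"
proof -
  have "strip T \<in> sets borel" unfolding strip_def by (intro borel_closed closed_Times) auto
  then show "strip T \<in> sets lebesgue" "strip T - closure (Q \<rho>) \<in> sets lebesgue" by auto
qed

text \<open>The excluded rectangle has height \<rho>^2, so after that time the whole line is
  available. With \<rho> = sqrt \<tau> the singular corner is avoided at the price of an initial
  time layer.\<close>

lemma strip_minus_Q:
  assumes "\<rho>\<^sup>2 \<le> \<tau>" "0 < \<tau>"
  shows "UNIV \<times> {\<tau><..<T} \<subseteq> interior (strip T - closure (Q \<rho>))"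
proof (rule interior_maximal)
  have "closure (Q \<rho>) \<subseteq> UNIV \<times> {0..\<rho>\<^sup>2}"
    by (rule closure_minimal) (auto simp: Q_def intro!: closed_Times)
  then show "UNIV \<times> {\<tau><..<T} \<subseteq> strip T - closure (Q \<rho>)"
    using assms by (auto simp: strip_def)
qed (intro open_Times, auto)

lemma continuous_on_clamp:
  assumes "continuous_on (strip T) v" "0 < T"
  shows "continuous_on UNIV (\<lambda>z. v (fst z, max 0 (min T (snd z))))"
  by (rule continuous_on_compose2[OF assms(1)])
    (use assms(2) in \<open>auto simp: strip_def intro!: continuous_intros\<close>)

lemma AE_strip_le:
  fixes v :: "real \<times> real \<Rightarrow> real"
  assumes v: "continuous_on (strip T) v" and T: "0 < T"
    and ae: "AE z in lebesgue_on (strip T). v z \<le> C" and t: "t \<in> {0..T}"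
  shows "v (x, t) \<le> C"
proof -
  have U: "open (UNIV \<times> {0<..<T} :: (real \<times> real) set)" by (intro open_Times) auto
  have sub: "UNIV \<times> {0<..<T} \<subseteq> strip T" by (auto simp: strip_def)
  have "AE z in lborel. z \<in> strip T \<longrightarrow> v z \<le> C"
    using AE_restrict_lebesgue[OF ae sets_strip(1)] by (rule AE_lebesgueD)
  then have "AE z in lborel. z \<in> UNIV \<times> {0<..<T} \<longrightarrow> v z \<le> C"
    by eventually_elim (use sub in auto)
  from AE_continuous_le[OF U continuous_on_subset[OF v sub] this]
  have le: "v z \<le> C" if "z \<in> UNIV \<times> {0<..<T}" for z using that by blast
  have "closure (UNIV \<times> {0<..<T}) = (strip T :: (real \<times> real) set)"
    using T by (simp add: closure_Times strip_def closure_greaterThanLessThan)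
  then show ?thesis
    using continuous_le_on_closure[of "UNIV \<times> {0<..<T}" v "(x, t)" C] v le t
    by (auto simp: strip_def)
qed

text \<open>Passing to a Borel null superset N provides the measurability that the exchange of the
  variables requires; the predicate itself need not be measurable.\<close>

lemma AE_lborel_slices:
  assumes "AE z in lborel. P (z :: real \<times> real)"
  shows "AE t in lborel. AE x in lborel. P (x, t)"
proof -
  obtain N where N: "N \<in> null_sets lborel" "{z. \<not> P z} \<subseteq> N"
    using assms by (auto simp: eventually_ae_filter)
  then have "AE z in lborel \<Otimes>\<^sub>M lborel. z \<notin> N" by (simp add: lborel_prod AE_not_in)
  from lborel_pair.AE_pair[OF this] have "AE x in lborel. AE t in lborel. (x, t) \<notin> N" .
  moreover have "{z \<in> space (lborel \<Otimes>\<^sub>M lborel). (fst z, snd z) \<notin> N} \<in> sets (lborel \<Otimes>\<^sub>M lborel)"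
  proof -
    have "N \<in> sets borel" using N(1) by (simp add: null_sets_def)
    then have "- N \<in> sets borel" by auto
    then show ?thesis by (simp only: lborel_prod sets_lborel space_lborel space_borel prod.collapse UNIV_I simp_thms Compl_eq[symmetric])
  qed
  ultimately have "AE t in lborel. AE x in lborel. (x, t) \<notin> N"
    using lborel_pair.AE_commute[of "\<lambda>x t. (x, t) \<notin> N"] by simp
  then show ?thesis
  proof eventually_elim
    case (elim t) then show ?case by eventually_elim (use N(2) in auto)
  qed
qed

text \<open>\<open>p\<close>, \<open>q\<close>, \<open>r\<close>, \<open>H\<close> stand for \<open>v\<^sub>\<xi>\<close>, \<open>v\<^sub>\<xi>\<^sub>\<xi>\<close>, \<open>v\<^sub>t\<close>, \<open>v\<^sub>\<xi> + v\<close>.\<close>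

definition regular_slice :: "real \<Rightarrow> real \<Rightarrow> real \<Rightarrow> real \<Rightarrow> (real \<times> real \<Rightarrow> real) \<Rightarrow> (real \<times> real \<Rightarrow> real) \<Rightarrow>
    (real \<times> real \<Rightarrow> real) \<Rightarrow> (real \<times> real \<Rightarrow> real) \<Rightarrow> real \<Rightarrow> real \<Rightarrow> (real \<Rightarrow> real) \<Rightarrow> bool" where
  "regular_slice \<delta> \<sigma>H \<sigma>L \<gamma> v p q r M t H \<longleftrightarrow>
     (\<forall>x. ((\<lambda>x. v (x, t)) has_real_derivative H x - v (x, t)) (at x)) \<and>
     (\<forall>x y. x \<le> y \<longrightarrow> H y - H x = integral {x..y} (\<lambda>x. p (x, t) + q (x, t))) \<and>
     (AE x in lborel. H x = p (x, t) + v (x, t)) \<and> (\<forall>x. \<bar>H x - v (x, t)\<bar> \<le> M) \<and>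
     (AE x in lborel. min (L_op \<delta> \<sigma>H \<sigma>L \<gamma> (v (x, t)) (p (x, t)) (q (x, t)) (r (x, t))) (1 - v (x, t)) = 0 \<and>
        q (x, t) + p (x, t) \<le> 0)"

definition regular_derivatives :: "real \<Rightarrow> real \<Rightarrow> real \<Rightarrow> real \<Rightarrow> (real \<times> real \<Rightarrow> real) \<Rightarrow> (real \<times> real \<Rightarrow> real) \<Rightarrow>
    (real \<times> real \<Rightarrow> real) \<Rightarrow> (real \<times> real \<Rightarrow> real) \<Rightarrow> real \<Rightarrow> real \<Rightarrow> real \<Rightarrow> bool" where
  "regular_derivatives \<delta> \<sigma>H \<sigma>L \<gamma> v p q r M \<tau> T \<longleftrightarrow>
     bounded_borel p \<and> bounded_borel q \<and> bounded_borel r \<and>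
     (AE x in lborel. \<forall>s t. \<tau> < s \<longrightarrow> s \<le> t \<longrightarrow> t < T \<longrightarrow> v (x, t) - v (x, s) = integral {s..t} (\<lambda>t. r (x, t))) \<and>
     (AE t in lborel. t \<in> {\<tau><..<T} \<longrightarrow> (\<exists>H. regular_slice \<delta> \<sigma>H \<sigma>L \<gamma> v p q r M t H))"

text \<open>The bound \<open>M\<close> of the \<open>\<xi>\<close>-derivative does not depend on \<open>\<tau>\<close>: it comes from \<open>W10_infty\<close>.\<close>

theorem obstacle_solution_regularity:
  fixes v :: "real \<times> real \<Rightarrow> real"
  assumes sol: "obstacle_solution \<delta> \<sigma>H \<sigma>L \<gamma> T v"
  shows "\<exists>M. \<forall>\<tau>. 0 < \<tau> \<longrightarrow> \<tau> < T \<longrightarrow> (\<exists>p q r. regular_derivatives \<delta> \<sigma>H \<sigma>L \<gamma> v p q r M \<tau> T)"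
proof -
  let ?W = "UNIV \<times> {0<..<T} :: (real \<times> real) set"
  obtain vx vxx vt where
    vx: "weak_partial 1 0 ?W v vx" and vxx: "weak_partial 2 0 ?W v vxx" and vt: "weak_partial 0 1 ?W v vt"
    and pde: "AE z in lebesgue_on (strip T). min (L_op \<delta> \<sigma>H \<sigma>L \<gamma> (v z) (vx z) (vxx z) (vt z)) (1 - v z) = 0"
    and conc: "AE z in lebesgue_on (strip T). vxx z + vx z \<le> 0"
    using sol unfolding obstacle_solution_def interior_strip by blast
  have cont: "continuous_on (strip T) v" using sol by (simp add: obstacle_solution_def)
  obtain M0 where M0: "AE z in lebesgue_on (strip T). \<bar>v z\<bar> \<le> M0"
    using sol by (auto simp: obstacle_solution_def W10_infty_def L_infty_def)
  obtain g M where g: "weak_partial 1 0 ?W v g" "AE z in lebesgue_on (strip T). \<bar>g z\<bar> \<le> M"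
    using sol by (auto simp: obstacle_solution_def W10_infty_def L_infty_def interior_strip)
  have "\<exists>p q r. regular_derivatives \<delta> \<sigma>H \<sigma>L \<gamma> v p q r \<bar>M\<bar> \<tau> T"
    if \<tau>: "0 < \<tau>" "\<tau> < T" for \<tau>
  proof -
    let ?J = "{\<tau><..<T}"
    \<comment> \<open>v is controlled only on the strip. Freezing it in time outside [0, T] gives a
      bounded continuous function on the plane, to which the slicing lemmas apply.\<close>
    define V where "V z = v (fst z, max 0 (min T (snd z)))" for z
    have T: "0 < T" using \<tau> by simp
    have cV: "continuous_on UNIV V" unfolding V_def using continuous_on_clamp[OF cont T] .
    have Veq: "V z = v z" if "snd z \<in> {0..T}" for z using that by (cases z) (auto simp: V_def)
    have VJ: "V (x, t) = v (x, t)" if "t \<in> ?J" for x t using that \<tau> by (intro Veq) auto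
    have Vb: "\<bar>V z\<bar> \<le> M0" for z
    proof -
      have M1: "AE z in lebesgue_on (strip T). v z \<le> M0" "AE z in lebesgue_on (strip T). - v z \<le> M0"
        using M0 by (eventually_elim, linarith)+
      have "v (fst z, max 0 (min T (snd z))) \<le> M0"
        by (rule AE_strip_le[OF cont T M1(1)]) (use T in auto)
      moreover have "- v (fst z, max 0 (min T (snd z))) \<le> M0"
        by (rule AE_strip_le[of T "\<lambda>z. - v z", OF continuous_on_minus[OF cont] T M1(2)]) (use T in auto)
      ultimately show ?thesis by (simp add: V_def)
    qed
    have bV: "bounded_borel V"
      unfolding bounded_borel_def using Vb borel_measurable_continuous_onI[OF cV] by blast
    have Vm: "V \<in> borel_measurable borel" using bV by (simp add: bounded_borel_def)
    have Vae: "AE z in lborel. snd z \<in> ?J \<longrightarrow> V z = v z"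
      using \<tau> by (intro AE_I2 impI Veq) auto
    have U: "UNIV \<times> ?J \<subseteq> ?W" using \<tau> by auto
    have U': "UNIV \<times> ?J \<subseteq> interior (strip T - closure (Q (sqrt \<tau>)))"
      by (rule strip_minus_Q) (use \<tau> in auto)
    have Linf: "\<exists>C. AE z in lebesgue. z \<in> interior (strip T - closure (Q (sqrt \<tau>))) \<longrightarrow> \<bar>h z\<bar> \<le> C"
      if h: "h \<in> L_infty (strip T - closure (Q (sqrt \<tau>)))" for h
    proof -
      obtain C where "AE z in lebesgue_on (strip T - closure (Q (sqrt \<tau>))). \<bar>h z\<bar> \<le> C"
        using h by (auto simp: L_infty_def)
      from AE_restrict_lebesgue[OF this sets_strip(2)]
      have "AE z in lebesgue. z \<in> interior (strip T - closure (Q (sqrt \<tau>))) \<longrightarrow> \<bar>h z\<bar> \<le> C"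
        by eventually_elim (use interior_subset in blast)
      then show ?thesis ..
    qed
    have W21: "v \<in> W21_infty (strip T - closure (Q (sqrt \<tau>)))"
      using sol \<tau> by (simp add: obstacle_solution_def)
    obtain p where p: "p \<in> borel_measurable borel" "\<And>z. \<bar>p z\<bar> \<le> \<bar>M\<bar>" "AE z in lborel. snd z \<in> ?J \<longrightarrow> p z = vx z"
    proof -
      have "AE z in lebesgue. z \<in> ?W \<longrightarrow> \<bar>g z\<bar> \<le> M"
        using AE_restrict_lebesgue[OF g(2) sets_strip(1)] by eventually_elim (auto simp: strip_def)
      from weak_partial_bounded_rep[OF vx U g(1) U this] that show ?thesis by blast
    qed
    obtain q Cq where q: "q \<in> borel_measurable borel" "\<And>z. \<bar>q z\<bar> \<le> Cq" "AE z in lborel. snd z \<in> ?J \<longrightarrow> q z = vxx z"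
    proof -
      obtain h where h: "h \<in> L_infty (strip T - closure (Q (sqrt \<tau>)))"
        "weak_partial 2 0 (interior (strip T - closure (Q (sqrt \<tau>)))) v h"
        using W21 by (auto simp: W21_infty_def)
      obtain C where "AE z in lebesgue. z \<in> interior (strip T - closure (Q (sqrt \<tau>))) \<longrightarrow> \<bar>h z\<bar> \<le> C"
        using Linf[OF h(1)] by blast
      from weak_partial_bounded_rep[OF vxx U h(2) U' this] that show ?thesis by blast
    qed
    obtain r Cr where r: "r \<in> borel_measurable borel" "\<And>z. \<bar>r z\<bar> \<le> Cr" "AE z in lborel. snd z \<in> ?J \<longrightarrow> r z = vt z"
    proof -
      obtain h where h: "h \<in> L_infty (strip T - closure (Q (sqrt \<tau>)))"
        "weak_partial 0 1 (interior (strip T - closure (Q (sqrt \<tau>)))) v h"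
        using W21 by (auto simp: W21_infty_def)
      obtain C where "AE z in lebesgue. z \<in> interior (strip T - closure (Q (sqrt \<tau>))) \<longrightarrow> \<bar>h z\<bar> \<le> C"
        using Linf[OF h(1)] by blast
      from weak_partial_bounded_rep[OF vt U h(2) U' this] that show ?thesis by blast
    qed
    have bp: "bounded_borel p" and bq: "bounded_borel q" and br: "bounded_borel r"
      using p q r unfolding bounded_borel_def by blast+
    have eqn: "AE z in lborel. snd z \<in> ?J \<longrightarrow>
         min (L_op \<delta> \<sigma>H \<sigma>L \<gamma> (v z) (p z) (q z) (r z)) (1 - v z) = 0 \<and> q z + p z \<le> 0"
      using p(3) q(3) r(3) AE_lebesgueD[OF AE_restrict_lebesgue[OF pde sets_strip(1)]]
        AE_lebesgueD[OF AE_restrict_lebesgue[OF conc sets_strip(1)]]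
    proof eventually_elim
      case (elim z)
      have "snd z \<in> ?J \<Longrightarrow> z \<in> strip T" using \<tau> by (cases z) (auto simp: strip_def)
      with elim show ?case by auto
    qed
    have w1: "(LINT z|lborel. V z * (deriv \<phi> (fst z) * \<psi> (snd z))) = - (LINT z|lborel. p z * (\<phi> (fst z) * \<psi> (snd z)))"
      if "test_on UNIV \<phi>" "test_on ?J \<psi>" for \<phi> \<psi>
      using weak_partial_product[OF vx U Vm Vae p(1,3) that] by simp
    \<comment> \<open>The second weak derivative of v becomes the first weak derivative of p: the
      identity for p is applied with \<open>deriv \<phi>\<close> as the test function.\<close>
    have w2: "(LINT z|lborel. p z * (deriv \<phi> (fst z) * \<psi> (snd z))) = - (LINT z|lborel. q z * (\<phi> (fst z) * \<psi> (snd z)))"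
      if "test_on UNIV \<phi>" "test_on ?J \<psi>" for \<phi> \<psi>
      using weak_partial_product[OF vxx U Vm Vae q(1,3) that] w1[OF test_on_deriv[OF that(1)] that(2)]
      by (simp add: numeral_2_eq_2)
    \<comment> \<open>The coordinates are swapped because the slicing lemma differentiates in the
      first variable.\<close>
    have w3: "(LINT z|lborel. V (snd z, fst z) * (deriv \<psi> (fst z) * \<phi> (snd z))) =
        - (LINT z|lborel. r (snd z, fst z) * (\<psi> (fst z) * \<phi> (snd z)))"
      if "test_on ?J \<psi>" "test_on UNIV \<phi>" for \<phi> \<psi>
    proof -
      have sw: "(LINT z|lborel. h (snd z, fst z) * (\<alpha> (fst z) * \<beta> (snd z))) = (LINT z|lborel. h z * (\<beta> (fst z) * \<alpha> (snd z)))"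
        if "h \<in> borel_measurable borel" "smooth \<alpha>" "smooth \<beta>" for h :: "real \<times> real \<Rightarrow> real" and \<alpha> \<beta> :: "real \<Rightarrow> real"
      proof -
        have m: "(\<lambda>z. h z * (\<beta> (fst z) * \<alpha> (snd z))) \<in> borel_measurable (lborel \<Otimes>\<^sub>M lborel)"
        proof -
          have "(\<lambda>z. h z * (\<beta> (fst z) * \<alpha> (snd z))) \<in> borel_measurable borel"
            by (intro borel_measurable_times that measurable_compose[OF borel_measurable_continuous_onI smooth_borel]
                continuous_on_fst continuous_on_snd continuous_on_id)
          then show ?thesis by (simp add: lborel_prod)
        qed
        from lborel_pair.integral_product_swap[OF m] show ?thesis
          by (simp add: lborel_prod case_prod_unfold mult.commute mult.left_commute)
      qed
      have s: "smooth \<phi>" "smooth \<psi>" "smooth (deriv \<psi>)" using that by (auto simp: test_on_def smooth_deriv)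
      show ?thesis
        using weak_partial_product[OF vt U Vm Vae r(1,3) that(2,1)] sw[OF Vm s(3,1)] sw[OF r(1) s(2,1)] by simp
    qed
    have W1: "\<forall>\<phi> \<psi>. test_on UNIV \<phi> \<longrightarrow> test_on ?J \<psi> \<longrightarrow>
        (LINT z|lborel. V z * (deriv \<phi> (fst z) * \<psi> (snd z))) = - (LINT z|lborel. p z * (\<phi> (fst z) * \<psi> (snd z)))"
      and W2: "\<forall>\<phi> \<psi>. test_on UNIV \<phi> \<longrightarrow> test_on ?J \<psi> \<longrightarrow>
        (LINT z|lborel. p z * (deriv \<phi> (fst z) * \<psi> (snd z))) = - (LINT z|lborel. q z * (\<phi> (fst z) * \<psi> (snd z)))"
      and W3: "\<forall>\<psi> \<phi>. test_on ?J \<psi> \<longrightarrow> test_on UNIV \<phi> \<longrightarrow>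
        (LINT z|lborel. V (snd z, fst z) * (deriv \<psi> (fst z) * \<phi> (snd z))) =
        - (LINT z|lborel. r (snd z, fst z) * (\<psi> (fst z) * \<phi> (snd z)))"
      using w1 w2 w3 by blast+
    have swm: "(\<lambda>z::real \<times> real. (snd z, fst z)) \<in> borel_measurable borel"
      by (intro borel_measurable_continuous_onI continuous_intros)
    have oJ: "open ?J" "is_interval ?J" by (auto simp: is_interval_1)
    have Vc1: "continuous_on A (\<lambda>x. V (x, t))" "continuous_on A (\<lambda>t. V (x, t))" for A x t
      by (intro continuous_on_compose2[OF cV] continuous_intros; simp)+
    have tsl: "AE x in lborel. \<forall>s t. \<tau> < s \<longrightarrow> s \<le> t \<longrightarrow> t < T \<longrightarrow> v (x, t) - v (x, s) = integral {s..t} (\<lambda>t. r (x, t))"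
      using weak_derivative_slices[OF oJ open_UNIV bounded_borel_compose[OF bV swm] bounded_borel_compose[OF br swm] W3]
    proof eventually_elim
      case (elim x)
      then obtain N where N: "\<And>s t. s \<le> t \<Longrightarrow> N t - N s = integral {s..t} (\<lambda>t. r (x, t))"
        "AE t in lborel. t \<in> ?J \<longrightarrow> V (x, t) = N t" by auto
      have "continuous_on ?J N"
        by (rule indefinite_integral_continuous_on[OF bounded_borel_slice(2)[OF br]]) (use N in auto)
      from AE_continuous_eq[OF oJ(1) Vc1(2) this N(2)] have "v (x, t) = N t" if "t \<in> ?J" for t
        using that VJ by simp
      with N show ?case by auto
    qed
    have xsl: "AE t in lborel. t \<in> ?J \<longrightarrow> (\<exists>H. regular_slice \<delta> \<sigma>H \<sigma>L \<gamma> v p q r \<bar>M\<bar> t H)"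
      using AE_lborel_slices[OF eqn] weak_derivative_slices[OF open_UNIV is_interval_univ oJ(1) bV bp W1]
        weak_derivative_slices[OF open_UNIV is_interval_univ oJ(1) bp bq W2]
    proof eventually_elim
      case (elim t)
      show ?case
      proof
        assume t: "t \<in> ?J"
        obtain N1 where N1: "\<And>x y. x \<le> y \<Longrightarrow> N1 y - N1 x = integral {x..y} (\<lambda>x. p (x, t))"
          "AE x in lborel. V (x, t) = N1 x" using elim(2) t by auto
        obtain N2 where N2: "\<And>x y. x \<le> y \<Longrightarrow> N2 y - N2 x = integral {x..y} (\<lambda>x. q (x, t))"
          "AE x in lborel. p (x, t) = N2 x" using elim(3) t by auto
        note bpt = bounded_borel_slice(1)[OF bp, of t] and bqt = bounded_borel_slice(1)[OF bq, of t]
        have cN1: "continuous_on A N1" for A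
          by (rule indefinite_integral_continuous_on[OF bpt]) (use N1 in auto)
        have cN2: "continuous_on A N2" for A
          by (rule indefinite_integral_continuous_on[OF bqt]) (use N2 in auto)
        have VN: "V (x, t) = N1 x" for x
          by (rule AE_continuous_eq[OF open_UNIV Vc1(1) cN1]) (use N1(2) in auto)
        have vN: "v (x, t) = N1 x" for x using VN VJ[OF t] by simp
        have ipN: "integral {x..y} (\<lambda>x. p (x, t)) = integral {x..y} N2" for x y
        proof (rule integral_spike)
          have "AE x in lebesgue. x \<notin> {x. p (x, t) \<noteq> N2 x}" using AE_completion[OF N2(2)] by eventually_elim auto
          moreover have "{x. p (x, t) \<noteq> N2 x} \<in> sets lebesgue"
          proof -
            have "N2 \<in> borel_measurable borel" by (rule borel_measurable_continuous_onI[OF cN2])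
            moreover have "(\<lambda>x. p (x, t)) \<in> borel_measurable borel" using bpt by (simp add: bounded_borel_def)
            ultimately have "(\<lambda>x. p (x, t) - N2 x) \<in> borel_measurable borel" by simp
            from measurable_sets_borel[OF this, of "- {0}"]
            have "{x. p (x, t) \<noteq> N2 x} \<in> sets borel" by (simp add: vimage_def)
            then show ?thesis by simp
          qed
          ultimately show "negligible {x. p (x, t) \<noteq> N2 x}"
            by (simp only: negligible_iff_null_sets AE_iff_null_sets)
        qed auto
        define H where "H x = N2 x + v (x, t)" for x
        \<comment> \<open>On this slice v is a primitive of p, which agrees almost everywhere with
          the continuous N2; so v is classically differentiable in x at every point.\<close>
        have d: "((\<lambda>x. v (x, t)) has_real_derivative N2 x) (at x)" for x
        proof -
          have "((\<lambda>y. integral {x - 1..y} N2) has_real_derivative N2 x) (at x within {x - 1..x + 1})"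
            by (intro integral_has_real_derivative cN2) auto
          moreover have "at x within {x - 1..x + 1} = at x" by (intro at_within_Icc_at) auto
          ultimately have "((\<lambda>y. integral {x - 1..y} N2) has_real_derivative N2 x) (at x)" by simp
          from DERIV_add[OF this DERIV_const[of "v (x - 1, t)"]]
          have "((\<lambda>y. integral {x - 1..y} N2 + v (x - 1, t)) has_real_derivative N2 x) (at x)" by simp
          then show ?thesis
          proof (rule has_field_derivative_transform_within_open[where S="{x - 1<..}"])
            fix y assume "y \<in> {x - 1<..}"
            then show "integral {x - 1..y} N2 + v (x - 1, t) = v (y, t)"
              using N1(1)[of "x - 1" y] ipN[of "x - 1" y] by (simp add: vN)
          qed auto
        qed
        have "AE x in lborel. x \<in> UNIV \<longrightarrow> N2 x \<le> \<bar>M\<bar>"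
          using N2(2) by eventually_elim (metis abs_le_D1 p(2))
        then have M1: "N2 x \<le> \<bar>M\<bar>" for x by (rule AE_continuous_le[OF open_UNIV cN2]) auto
        have "AE x in lborel. x \<in> UNIV \<longrightarrow> - N2 x \<le> \<bar>M\<bar>"
          using N2(2) by eventually_elim (metis abs_le_D2 p(2))
        then have M2: "- N2 x \<le> \<bar>M\<bar>" for x
          by (rule AE_continuous_le[OF open_UNIV continuous_on_minus[OF cN2]]) auto
        have "H y - H x = integral {x..y} (\<lambda>x. p (x, t) + q (x, t))" if "x \<le> y" for x y
          using N1(1)[OF that] N2(1)[OF that] bounded_borel_integral(1)[OF bpt, of x y] bounded_borel_integral(1)[OF bqt, of x y]
          by (subst Henstock_Kurzweil_Integration.integral_add) (auto simp: H_def vN)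
        moreover have "AE x in lborel. H x = p (x, t) + v (x, t)"
          using N2(2) by eventually_elim (simp add: H_def)
        moreover have "\<bar>H x - v (x, t)\<bar> \<le> \<bar>M\<bar>" for x using M1[of x] M2[of x] by (simp add: H_def abs_le_iff)
        moreover have "AE x in lborel. min (L_op \<delta> \<sigma>H \<sigma>L \<gamma> (v (x, t)) (p (x, t)) (q (x, t)) (r (x, t))) (1 - v (x, t)) = 0 \<and>
            q (x, t) + p (x, t) \<le> 0" using elim(1) t by simp
        ultimately show "\<exists>H. regular_slice \<delta> \<sigma>H \<sigma>L \<gamma> v p q r \<bar>M\<bar> t H"
          using d unfolding regular_slice_def by (intro exI[of _ H]) (auto simp: H_def)
      qed
    qed
    show ?thesis unfolding regular_derivatives_def using bp bq br tsl xsl by blast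
  qed
  then show ?thesis by blast
qed

section \<open>The travelling wave profile\<close>

lemma exponential_from_ode:
  fixes D :: "real \<Rightarrow> real"
  assumes I: "convex I" "open I" and D: "\<And>x. x \<in> I \<Longrightarrow> (D has_real_derivative - c * D x) (at x)"
  shows "\<exists>s. \<forall>x\<in>I. D x = s * exp (- c * x)"
proof -
  have "((\<lambda>x. exp (c * x) * D x) has_real_derivative 0) (at x within I)" if "x \<in> I" for x
    using D[OF that] by (auto intro!: derivative_eq_intros intro: has_field_derivative_at_within simp: algebra_simps)
  from has_field_derivative_zero_constant[OF I(1) this]
  obtain s where s: "\<And>x. x \<in> I \<Longrightarrow> exp (c * x) * D x = s" by auto
  have "D x = s * exp (- c * x)" if "x \<in> I" for x
    using s[OF that] by (auto simp: exp_minus field_simps)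
  then show ?thesis by blast
qed

text \<open>In terms of K' + K the second-order equation is the first-order equation (K' + K)' = - c
  (K' + K).\<close>

lemma profile_ode_exponential:
  assumes K: "profile_ode c K I" and I: "convex I" "open I"
  shows "\<exists>s. \<forall>x\<in>I. (K has_real_derivative s * exp (- c * x) - K x) (at x) \<and> deriv K x = s * exp (- c * x) - K x"
proof -
  have 1: "(K has_real_derivative deriv K x) (at x)" if "x \<in> I" for x
    using K that unfolding profile_ode_def by (auto simp: DERIV_deriv_iff_real_differentiable)
  have "((\<lambda>x. deriv K x + K x) has_real_derivative - c * (deriv K x + K x)) (at x)" if x: "x \<in> I" for x
  proof -
    have "(deriv K has_real_derivative deriv (deriv K) x) (at x)"
      using K x unfolding profile_ode_def by (auto simp: DERIV_deriv_iff_real_differentiable)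
    moreover have "deriv (deriv K) x + deriv K x = - c * (deriv K x + K x)"
      using K x unfolding profile_ode_def by (auto simp: algebra_simps)
    ultimately show ?thesis using DERIV_add[OF _ 1[OF x]] by metis
  qed
  from exponential_from_ode[OF I this] obtain s where "\<And>x. x \<in> I \<Longrightarrow> deriv K x + K x = s * exp (- c * x)" by blast
  then have "deriv K x = s * exp (- c * x) - K x" if "x \<in> I" for x using that by (simp add: algebra_simps)
  then show ?thesis using 1 by metis
qed

text \<open>\<open>flux\<close> is \<open>K' + K\<close> and \<open>flux_deriv\<close> its derivative \<open>K'' + K'\<close>.\<close>

definition flux :: "real \<Rightarrow> real \<Rightarrow> real \<Rightarrow> real \<Rightarrow> real \<Rightarrow> real" where
  "flux cH cL \<eta> \<kappa> x = (if x \<le> \<kappa> then 1 else if x \<le> \<eta> then exp (- cL * (x - \<kappa>))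
      else exp (- cL * (\<eta> - \<kappa>)) * exp (- cH * (x - \<eta>)))"

definition flux_deriv :: "real \<Rightarrow> real \<Rightarrow> real \<Rightarrow> real \<Rightarrow> real \<Rightarrow> real" where
  "flux_deriv cH cL \<eta> \<kappa> x = (if x \<le> \<kappa> then 0 else if x \<le> \<eta> then - cL * flux cH cL \<eta> \<kappa> x
      else - cH * flux cH cL \<eta> \<kappa> x)"

lemma continuous_flux: assumes "\<kappa> < \<eta>" shows "continuous_on A (flux cH cL \<eta> \<kappa>)"
proof -
  have "continuous_on UNIV (flux cH cL \<eta> \<kappa>)"
  proof -
    have eq: "flux cH cL \<eta> \<kappa> x = exp (- cL * (max \<kappa> (min \<eta> x) - \<kappa>)) * exp (- cH * (max \<eta> x - \<eta>))" for x
      using assms by (auto simp: flux_def)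
    show ?thesis unfolding eq[abs_def] by (intro continuous_intros)
  qed
  then show ?thesis using continuous_on_subset by blast
qed

lemma flux_pos: "flux cH cL \<eta> \<kappa> x > 0" by (auto simp: flux_def)

lemma flux_le_1:
  assumes "0 \<le> cL" "0 \<le> cH" "\<kappa> < \<eta>" shows "flux cH cL \<eta> \<kappa> x \<le> 1"
  using assms by (auto simp: flux_def intro!: mult_le_one)

lemma flux_has_derivative:
  assumes "\<kappa> < \<eta>" "x \<noteq> \<kappa>" "x \<noteq> \<eta>"
  shows "(flux cH cL \<eta> \<kappa> has_real_derivative flux_deriv cH cL \<eta> \<kappa> x) (at x)"
proof -
  consider "x < \<kappa>" | "\<kappa> < x" "x < \<eta>" | "\<eta> < x" using assms by linarith
  then show ?thesis
  proof cases
    case 1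
    have "((\<lambda>x. 1) has_real_derivative flux_deriv cH cL \<eta> \<kappa> x) (at x)" using 1 by (auto simp: flux_deriv_def)
    then show ?thesis
      by (rule has_field_derivative_transform_within_open[where S="{..<\<kappa>}"]) (use 1 in \<open>auto simp: flux_def\<close>)
  next
    case 2
    have "((\<lambda>x. exp (- cL * (x - \<kappa>))) has_real_derivative flux_deriv cH cL \<eta> \<kappa> x) (at x)"
      using 2 by (auto simp: flux_deriv_def flux_def intro!: derivative_eq_intros)
    then show ?thesis
      by (rule has_field_derivative_transform_within_open[where S="{\<kappa><..<\<eta>}"]) (use 2 in \<open>auto simp: flux_def\<close>)
  next
    case 3
    have "((\<lambda>x. exp (- cL * (\<eta> - \<kappa>)) * exp (- cH * (x - \<eta>))) has_real_derivative flux_deriv cH cL \<eta> \<kappa> x) (at x)"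
      using 3 assms by (auto simp: flux_deriv_def flux_def intro!: derivative_eq_intros)
    then show ?thesis
      by (rule has_field_derivative_transform_within_open[where S="{\<eta><..}"]) (use 3 assms in \<open>auto simp: flux_def\<close>)
  qed
qed

lemma flux_increment:
  assumes "\<kappa> < \<eta>" "x \<le> y"
  shows "flux cH cL \<eta> \<kappa> y - flux cH cL \<eta> \<kappa> x = integral {x..y} (flux_deriv cH cL \<eta> \<kappa>)"
proof -
  have "(flux_deriv cH cL \<eta> \<kappa> has_integral flux cH cL \<eta> \<kappa> y - flux cH cL \<eta> \<kappa> x) {x..y}"
  proof (rule fundamental_theorem_of_calculus_interior_strong[of "{\<kappa>, \<eta>}"])
    show "continuous_on {x..y} (flux cH cL \<eta> \<kappa>)" by (rule continuous_flux[OF assms(1)])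
    fix z assume "z \<in> {x<..<y} - {\<kappa>, \<eta>}"
    then show "(flux cH cL \<eta> \<kappa> has_vector_derivative flux_deriv cH cL \<eta> \<kappa> z) (at z)"
      using flux_has_derivative[OF assms(1), of z cH cL]
      by (auto simp: has_real_derivative_iff_has_vector_derivative)
  qed (use assms in auto)
  then show ?thesis by (simp add: integral_unique)
qed

lemma bounded_borel_flux_deriv:
  assumes "0 \<le> cL" "0 \<le> cH" "\<kappa> < \<eta>"
  shows "bounded_borel (flux_deriv cH cL \<eta> \<kappa>)"
proof -
  have m: "flux cH cL \<eta> \<kappa> \<in> borel_measurable borel"
    by (intro borel_measurable_continuous_onI continuous_flux assms)
  have "(\<lambda>x. if x \<le> \<kappa> then 0 else if x \<le> \<eta> then - cL * flux cH cL \<eta> \<kappa> x else - cH * flux cH cL \<eta> \<kappa> x) \<in> borel_measurable borel"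
    using m by measurable
  then have "flux_deriv cH cL \<eta> \<kappa> \<in> borel_measurable borel" by (simp add: flux_deriv_def[abs_def])
  moreover have "\<bar>flux_deriv cH cL \<eta> \<kappa> x\<bar> \<le> max cL cH" for x
    using flux_le_1[OF assms, of x] flux_pos[of cH cL \<eta> \<kappa> x] assms
    by (auto simp: flux_deriv_def abs_mult max_def intro: order_trans[OF mult_right_le_one_le])
  ultimately show ?thesis by (auto simp: bounded_borel_def)
qed

lemma profile_value_at_left:
  assumes "travelling_wave_profile cH cL \<gamma> K \<eta> \<kappa>" "x \<le> \<kappa>" shows "K x = 1"
proof (cases "x = \<kappa>")
  case True
  have d: "(K has_real_derivative 0) (at \<kappa>)" and l: "\<forall>\<xi><\<kappa>. K \<xi> = 1"
    using assms by (auto simp: travelling_wave_profile_def)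
  have "(K \<longlongrightarrow> K \<kappa>) (at_left \<kappa>)"
    using DERIV_isCont[OF d] by (auto simp: isCont_def intro: tendsto_mono[OF at_le])
  moreover have "(K \<longlongrightarrow> 1) (at_left \<kappa>)"
    by (rule Lim_transform_eventually[OF tendsto_const]) (use l in \<open>auto simp: eventually_at_filter\<close>)
  ultimately show ?thesis using True tendsto_unique trivial_limit_at_left_real by blast
qed (use assms in \<open>auto simp: travelling_wave_profile_def\<close>)

text \<open>On each side of \<eta> the function K' + K is a multiple of exp(-c x). Smooth contact at
  \<kappa> fixes the first factor, continuity of K' across \<eta> the second. The points \<kappa>
  and \<eta>, where no differential equation is given, have to be treated separately.\<close>

lemma profile_has_derivative:
  assumes tw: "travelling_wave_profile cH cL \<gamma> K \<eta> \<kappa>" and cL: "cL < 1"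
  shows "(K has_real_derivative flux cH cL \<eta> \<kappa> x - K x) (at x)"
proof -
  let ?S = "flux cH cL \<eta> \<kappa>"
  have \<kappa>\<eta>: "\<kappa> < \<eta>" and oH: "profile_ode cH K {\<eta><..}" and oL: "profile_ode cL K {\<kappa><..<\<eta>}"
    and d0: "(K has_real_derivative 0) (at \<kappa>)"
    and KR: "(K \<longlongrightarrow> \<gamma>) (at_right \<eta>)" and KL: "(K \<longlongrightarrow> \<gamma>) (at_left \<eta>)" and K\<eta>: "K \<eta> = \<gamma>"
    using tw by (auto simp: travelling_wave_profile_def)
  obtain d where dR: "(deriv K \<longlongrightarrow> d) (at_right \<eta>)" and dL: "(deriv K \<longlongrightarrow> d) (at_left \<eta>)"
    using tw by (auto simp: travelling_wave_profile_def)
  obtain s1 where s1: "\<And>x. x \<in> {\<kappa><..<\<eta>} \<Longrightarrow> (K has_real_derivative s1 * exp (- cL * x) - K x) (at x)"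
      "\<And>x. x \<in> {\<kappa><..<\<eta>} \<Longrightarrow> deriv K x = s1 * exp (- cL * x) - K x"
    using profile_ode_exponential[OF oL convex_real_interval(8) open_greaterThanLessThan] by blast
  obtain s2 where s2: "\<And>x. x \<in> {\<eta><..} \<Longrightarrow> (K has_real_derivative s2 * exp (- cH * x) - K x) (at x)"
      "\<And>x. x \<in> {\<eta><..} \<Longrightarrow> deriv K x = s2 * exp (- cH * x) - K x"
    using profile_ode_exponential[OF oH convex_real_interval(3) open_greaterThan] by blast
  have K\<kappa>: "K \<kappa> = 1" using profile_value_at_left[OF tw] by simp
  have cont\<kappa>: "isCont K \<kappa>" using DERIV_isCont[OF d0] .
  have cont\<eta>: "isCont K \<eta>" using KL KR K\<eta> by (simp add: isCont_def filterlim_at_split)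
  have cK: "isCont K x" for x
  proof -
    consider "x < \<kappa>" | "x = \<kappa>" | "x \<in> {\<kappa><..<\<eta>}" | "x = \<eta>" | "x \<in> {\<eta><..}" by force
    then show ?thesis
    proof cases
      case 1
      have "((\<lambda>_. 1) has_real_derivative 0) (at x)" by simp
      then have "(K has_real_derivative 0) (at x)"
        by (rule has_field_derivative_transform_within_open[where S="{..<\<kappa>}"])
          (use 1 profile_value_at_left[OF tw] in auto)
      then show ?thesis by (rule DERIV_isCont)
    qed (use cont\<kappa> cont\<eta> DERIV_isCont[OF s1(1)] DERIV_isCont[OF s2(1)] in auto)
  qed
  \<comment> \<open>A first integral of K' + K = s1 exp(-cL x) on [\<kappa>, \<eta>), well defined
    because cL < 1. Its constancy yields the closed form \<open>f\<close> of K on that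
    interval.\<close>
  define k where "k x = exp x * K x - s1 / (1 - cL) * exp ((1 - cL) * x)" for x
  have "k x = k \<kappa>" if "x \<in> {\<kappa>..<\<eta>}" for x
  proof (cases "x = \<kappa>")
    case False
    then have x: "\<kappa> < x" "x < \<eta>" using that by auto
    have "k x = k \<kappa>"
    proof (rule DERIV_isconst2[of \<kappa> x k x])
      show "continuous_on {\<kappa>..x} k" unfolding k_def
        by (intro continuous_intros continuous_at_imp_continuous_on ballI) (use cK cL in auto)
      fix z assume z: "\<kappa> < z" "z < x"
      then show "(k has_real_derivative 0) (at z)"
        unfolding k_def using s1(1)[of z] x cL
        by (auto intro!: derivative_eq_intros simp: field_simps simp flip: exp_add)
    qed (use x in auto)
    then show ?thesis .
  qed auto
  then have kx: "k x = k \<kappa>" if "x \<in> {\<kappa>..<\<eta>}" for x using that .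
  define A where "A = s1 / (1 - cL)"
  have A: "s1 = (1 - cL) * A" using cL by (simp add: A_def)
  define f where "f x = exp (- x) * k \<kappa> + A * exp (- cL * x)" for x
  have Kf: "K x = f x" if "x \<in> {\<kappa>..<\<eta>}" for x
  proof -
    have "exp x * K x = k \<kappa> + A * exp ((1 - cL) * x)"
      using kx[OF that] by (simp add: k_def[of x] A_def)
    then have "exp (- x) * (exp x * K x) = exp (- x) * (k \<kappa> + A * exp ((1 - cL) * x))" by simp
    then show ?thesis by (simp add: f_def algebra_simps flip: exp_add mult.assoc)
  qed
  have fd: "(f has_real_derivative s1 * exp (- cL * x) - f x) (at x)" for x
    unfolding f_def A by (auto intro!: derivative_eq_intros simp: algebra_simps)
  \<comment> \<open>At \<kappa> only the derivative of K is prescribed, not a one-sided limit of K'.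
    The right difference quotients of K and of the closed form coincide, so the derivative of
    \<open>f\<close> at \<kappa> must be 0, and this determines s1.\<close>
  have "((\<lambda>y. (f y - f \<kappa>) / (y - \<kappa>)) \<longlongrightarrow> s1 * exp (- cL * \<kappa>) - f \<kappa>) (at_right \<kappa>)"
    using has_field_derivative_at_within[OF fd[of \<kappa>], of "{\<kappa><..}"] by (simp add: has_field_derivative_iff)
  moreover have "((\<lambda>y. (f y - f \<kappa>) / (y - \<kappa>)) \<longlongrightarrow> 0) (at_right \<kappa>)"
  proof (rule Lim_transform_eventually)
    show "((\<lambda>y. (K y - K \<kappa>) / (y - \<kappa>)) \<longlongrightarrow> 0) (at_right \<kappa>)"
      using has_field_derivative_at_within[OF d0, of "{\<kappa><..}"] by (simp add: has_field_derivative_iff)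
    have "\<forall>\<^sub>F y in at_right \<kappa>. y < \<eta>" using \<kappa>\<eta> eventually_at_right by blast
    then show "\<forall>\<^sub>F y in at_right \<kappa>. (K y - K \<kappa>) / (y - \<kappa>) = (f y - f \<kappa>) / (y - \<kappa>)"
      using eventually_at_right_less[of \<kappa>]
      by eventually_elim (use Kf \<kappa>\<eta> in auto)
  qed
  ultimately have "s1 * exp (- cL * \<kappa>) - f \<kappa> = 0"
    using tendsto_unique trivial_limit_at_right_real by blast
  moreover have "f \<kappa> = 1" using Kf[of \<kappa>] K\<kappa> \<kappa>\<eta> by simp
  ultimately have s1e: "s1 = exp (cL * \<kappa>)" by (simp add: exp_minus field_simps)
  have SL: "?S x = s1 * exp (- cL * x)" if "\<kappa> < x" "x \<le> \<eta>" for x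
    using that by (simp add: flux_def s1e algebra_simps flip: exp_add)
  have "((\<lambda>x. s1 * exp (- cL * x) - K x) \<longlongrightarrow> s1 * exp (- cL * \<eta>) - \<gamma>) (at_left \<eta>)"
    by (intro tendsto_intros KL)
  moreover have "((\<lambda>x. s1 * exp (- cL * x) - K x) \<longlongrightarrow> d) (at_left \<eta>)"
  proof (rule Lim_transform_eventually[OF dL])
    have "\<forall>\<^sub>F y in at_left \<eta>. \<kappa> < y" using \<kappa>\<eta> eventually_at_left by blast
    moreover have "\<forall>\<^sub>F y in at_left \<eta>. y < \<eta>" by (auto simp: eventually_at_filter)
    ultimately show "\<forall>\<^sub>F y in at_left \<eta>. deriv K y = s1 * exp (- cL * y) - K y"
      by eventually_elim (use s1 in auto)
  qed
  ultimately have 1: "s1 * exp (- cL * \<eta>) - \<gamma> = d" using tendsto_unique trivial_limit_at_left_real by blast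
  have "((\<lambda>x. s2 * exp (- cH * x) - K x) \<longlongrightarrow> s2 * exp (- cH * \<eta>) - \<gamma>) (at_right \<eta>)"
    by (intro tendsto_intros KR)
  moreover have "((\<lambda>x. s2 * exp (- cH * x) - K x) \<longlongrightarrow> d) (at_right \<eta>)"
    by (rule Lim_transform_eventually[OF dR]) (use s2 in \<open>auto simp: eventually_at_filter\<close>)
  ultimately have 2: "s2 * exp (- cH * \<eta>) - \<gamma> = d" using tendsto_unique trivial_limit_at_right_real by blast
  have s2e: "s2 = ?S \<eta> * exp (cH * \<eta>)"
  proof -
    have "?S \<eta> = s2 * exp (- cH * \<eta>)" using 1 2 SL[of \<eta>] \<kappa>\<eta> by simp
    then show ?thesis by (simp add: exp_minus)
  qed
  have SR: "?S x = s2 * exp (- cH * x)" if "\<eta> < x" for x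
    using that \<kappa>\<eta> unfolding s2e by (simp add: flux_def algebra_simps flip: exp_add)
  have Kd: "(K has_real_derivative ?S x - K x) (at x)" if ne: "x \<noteq> \<eta>" for x
  proof -
    consider "x < \<kappa>" | "x = \<kappa>" | "x \<in> {\<kappa><..<\<eta>}" | "x \<in> {\<eta><..}"
      using ne by (cases "x < \<kappa>"; cases "x = \<kappa>"; cases "x < \<eta>") auto
    then show ?thesis
    proof cases
      case 1
      have "((\<lambda>_. 1) has_real_derivative ?S x - K x) (at x)" using 1 profile_value_at_left[OF tw] by (simp add: flux_def)
      then show ?thesis
        by (rule has_field_derivative_transform_within_open[where S="{..<\<kappa>}"])
          (use 1 profile_value_at_left[OF tw] in auto)
    next
      case 2 then show ?thesis using d0 K\<kappa> by (simp add: flux_def)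
    next
      case 3 then show ?thesis using s1(1)[OF 3] SL by auto
    next
      case 4 then show ?thesis using s2(1)[OF 4] SR by auto
    qed
  qed
  show ?thesis
  proof (cases "x = \<eta>")
    case True
    \<comment> \<open>The hypotheses give one-sided limits of K' at \<eta> but no derivative there.
      Since exp(y) K is continuous and has the continuous derivative exp(y) S off \<kappa> and
      \<eta>, it is a constant plus the integral \<open>?F\<close>, which is differentiable at
      \<eta> as well.\<close>
    let ?F = "\<lambda>y. integral {\<kappa>..y} (\<lambda>s. exp s * ?S s)"
    have cS: "continuous_on A (\<lambda>s. exp s * ?S s)" for A
      by (intro continuous_intros continuous_flux \<kappa>\<eta>)
    have Fd: "(?F has_real_derivative exp y * ?S y) (at y)" if "\<kappa> < y" for y
    proof -
      have "(?F has_real_derivative exp y * ?S y) (at y within {\<kappa>..y + 1})"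
        by (intro integral_has_real_derivative cS) (use that in auto)
      moreover have "at y within {\<kappa>..y + 1} = at y" using that by (intro at_within_Icc_at) auto
      ultimately show ?thesis by simp
    qed
    define E where "E y = exp y * K y - ?F y" for y
    have E: "E y = E \<kappa>" if "y \<in> {\<kappa>..\<eta> + 1}" for y
    proof (rule has_derivative_zero_unique_strong_interval[of "{\<kappa>, \<eta>}" \<kappa> "\<eta> + 1" E "E \<kappa>" y])
      show "continuous_on {\<kappa>..\<eta> + 1} E" unfolding E_def
        by (intro continuous_intros indefinite_integral_continuous_1 integrable_continuous_interval cS
            continuous_at_imp_continuous_on ballI cK)
      fix z assume z: "z \<in> {\<kappa>..\<eta> + 1} - {\<kappa>, \<eta>}"
      have "(E has_real_derivative 0) (at z)"
        unfolding E_def using Kd[of z] Fd[of z] z by (auto intro!: derivative_eq_intros simp: algebra_simps)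
      then have "(E has_derivative (*) 0) (at z within {\<kappa>..\<eta> + 1})"
        unfolding has_field_derivative_def by (rule has_derivative_at_withinI)
      moreover have "(*) 0 = (\<lambda>h::real. 0)" by auto
      ultimately show "(E has_derivative (\<lambda>h. 0)) (at z within {\<kappa>..\<eta> + 1})" by metis
    qed (use that in auto)
    have EF: "E \<kappa> + ?F y = exp y * K y" if "y \<in> {\<kappa>..\<eta> + 1}" for y
      using E[OF that] by (simp add: E_def[of y])
    have ee: "exp (- y) * (exp y * c) = c" for y c :: real by (simp add: exp_minus)
    have "((\<lambda>y. exp (- y) * (E \<kappa> + ?F y)) has_real_derivative
        exp (- \<eta>) * (exp \<eta> * ?S \<eta>) - exp (- \<eta>) * (E \<kappa> + ?F \<eta>)) (at \<eta>)"
      by (rule derivative_eq_intros refl Fd[OF \<kappa>\<eta>])+ (simp add: algebra_simps)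
    moreover have "exp (- \<eta>) * (exp \<eta> * ?S \<eta>) - exp (- \<eta>) * (E \<kappa> + ?F \<eta>) = ?S \<eta> - K \<eta>"
      using \<kappa>\<eta> by (subst EF) (auto simp only: ee atLeastAtMost_iff)
    ultimately have "((\<lambda>y. exp (- y) * (E \<kappa> + ?F y)) has_real_derivative ?S \<eta> - K \<eta>) (at \<eta>)" by simp
    then show ?thesis unfolding True
    proof (rule has_field_derivative_transform_within_open[where S="{\<kappa><..<\<eta> + 1}"])
      fix y assume "y \<in> {\<kappa><..<\<eta> + 1}"
      then show "exp (- y) * (E \<kappa> + ?F y) = K y" by (subst EF) (auto simp: ee)
    qed (use \<kappa>\<eta> in auto)
  qed (rule Kd)
qed

text \<open>exp(x) (K - S) vanishes at \<kappa>, and its derivative - exp(x) S' is positive to the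
  right of it, with an interruption at \<eta> where S has a kink. In view of K' = S - K the result
  says that K decreases strictly.\<close>

lemma profile_gt_flux:
  assumes tw: "travelling_wave_profile cH cL \<gamma> K \<eta> \<kappa>" and c: "0 < cL" "cL < 1" "0 < cH" and x: "\<kappa> < x"
  shows "flux cH cL \<eta> \<kappa> x < K x"
proof -
  let ?S = "flux cH cL \<eta> \<kappa>"
  have \<kappa>\<eta>: "\<kappa> < \<eta>" using tw by (auto simp: travelling_wave_profile_def)
  note Kd = profile_has_derivative[OF tw c(2)]
  define f where "f y = exp y * (K y - ?S y)" for y
  have fd: "(f has_real_derivative - exp y * flux_deriv cH cL \<eta> \<kappa> y) (at y)" if "y \<noteq> \<kappa>" "y \<noteq> \<eta>" for y
    unfolding f_def using Kd[of y] flux_has_derivative[OF \<kappa>\<eta> that, of cH cL]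
    by (auto intro!: derivative_eq_intros simp: algebra_simps)
  have cf: "continuous_on A f" for A unfolding f_def
    by (intro continuous_intros continuous_flux \<kappa>\<eta> continuous_at_imp_continuous_on ballI DERIV_isCont[OF Kd])
  have pos: "0 < - exp y * flux_deriv cH cL \<eta> \<kappa> y" if "\<kappa> < y" for y
    using that c flux_pos[of cH cL \<eta> \<kappa> y] by (auto simp: flux_deriv_def mult_less_0_iff)
  have inc: "f a < f b" if "a < b" "\<kappa> \<le> a" "\<eta> \<notin> {a<..<b}" for a b
  proof (rule DERIV_pos_imp_increasing_open[OF that(1)])
    show "\<exists>y. (f has_real_derivative y) (at z) \<and> y > 0" if z: "a < z" "z < b" for z
      using fd[of z] pos[of z] z \<open>\<kappa> \<le> a\<close> \<open>\<eta> \<notin> {a<..<b}\<close> by (metis greaterThanLessThan_iff le_less_trans less_irrefl)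
  qed (rule cf)
  have f0: "f \<kappa> = 0" using profile_value_at_left[OF tw, of \<kappa>] by (simp add: f_def flux_def)
  have "f x > 0"
  proof (cases "x \<le> \<eta>")
    case True then show ?thesis using inc[of \<kappa> x] f0 x by auto
  next
    case False then show ?thesis using inc[of \<kappa> \<eta>] inc[of \<eta> x] f0 \<kappa>\<eta> by auto
  qed
  then show ?thesis by (simp add: f_def zero_less_mult_iff)
qed

lemma profile_strict_decreasing:
  assumes tw: "travelling_wave_profile cH cL \<gamma> K \<eta> \<kappa>" and c: "0 < cL" "cL < 1" "0 < cH" and x: "\<kappa> \<le> x" "x < y"
  shows "K y < K x"
proof (rule DERIV_neg_imp_decreasing_open[OF x(2)])
  note Kd = profile_has_derivative[OF tw c(2)]
  show "continuous_on {x..y} K" by (intro continuous_at_imp_continuous_on ballI DERIV_isCont[OF Kd])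
  fix z assume "x < z" "z < y"
  then show "\<exists>d. (K has_real_derivative d) (at z) \<and> d < 0"
    using Kd[of z] profile_gt_flux[OF tw c, of z] x by force
qed

text \<open>To the right of \<eta> the derivative exp(x) S of exp(x) K is a multiple of exp(-(cH -
  1) x), which is integrable since cH > 1. The limit 1 at infinity fixes the constant of
  integration.\<close>

lemma profile_tail:
  assumes tw: "travelling_wave_profile cH cL \<gamma> K \<eta> \<kappa>" and c: "0 < cL" "cL < 1" "1 < cH"
  shows "\<exists>C. \<forall>x\<ge>\<eta>. 1 - exp x * K x = C * exp (- (cH - 1) * x)"
proof -
  let ?S = "flux cH cL \<eta> \<kappa>"
  have \<kappa>\<eta>: "\<kappa> < \<eta>" and lim: "((\<lambda>\<xi>. exp \<xi> * K \<xi>) \<longlongrightarrow> 1) at_top"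
    using tw by (auto simp: travelling_wave_profile_def)
  note Kd = profile_has_derivative[OF tw c(2)]
  define A where "A = exp (- cL * (\<eta> - \<kappa>)) * exp (cH * \<eta>) / (cH - 1)"
  define f where "f x = exp x * K x + A * exp (- (cH - 1) * x)" for x
  have fd: "(f has_real_derivative 0) (at x)" if "\<eta> < x" for x
  proof -
    have "?S x = exp (- cL * (\<eta> - \<kappa>)) * exp (cH * \<eta>) * exp (- cH * x)"
      using that \<kappa>\<eta> by (simp add: flux_def algebra_simps flip: exp_add)
    then have "exp x * ?S x = exp (- cL * (\<eta> - \<kappa>)) * exp (cH * \<eta>) * exp (- (cH - 1) * x)"
      by (simp add: algebra_simps flip: exp_add)
    also have "\<dots> = (cH - 1) * A * exp (- (cH - 1) * x)" using c by (simp add: A_def)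
    finally show ?thesis unfolding f_def using Kd[of x]
      by (auto intro!: derivative_eq_intros simp: algebra_simps)
  qed
  have const: "f x = f \<eta>" if "\<eta> \<le> x" for x
  proof (cases "x = \<eta>")
    case False
    have cf: "continuous_on {\<eta>..x} f" unfolding f_def
      by (intro continuous_intros continuous_at_imp_continuous_on ballI DERIV_isCont[OF Kd])
    show ?thesis using False that by (intro DERIV_isconst2[OF _ cf] fd) auto
  qed auto
  have lim2: "((\<lambda>x. exp (- (cH - 1) * x)) \<longlongrightarrow> 0) at_top"
  proof -
    have "filterlim (\<lambda>x. (cH - 1) * x) at_top at_top"
      using c by (intro filterlim_tendsto_pos_mult_at_top[OF tendsto_const] filterlim_ident) auto
    then show ?thesis unfolding mult_minus_left
      by (intro filterlim_compose[OF exp_at_bot] filterlim_compose[OF filterlim_uminus_at_bot_at_top])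
  qed
  have "(f \<longlongrightarrow> 1 + A * 0) at_top" unfolding f_def[abs_def]
    by (rule tendsto_add[OF lim tendsto_mult[OF tendsto_const lim2]])
  moreover have "(f \<longlongrightarrow> f \<eta>) at_top"
  proof (rule Lim_transform_eventually[OF tendsto_const])
    show "\<forall>\<^sub>F x in at_top. f \<eta> = f x"
      using eventually_ge_at_top[of \<eta>] by eventually_elim (rule const[symmetric])
  qed
  ultimately have "1 + A * 0 = f \<eta>" by (intro tendsto_unique[OF trivial_limit_at_top_linorder])
  then have "f \<eta> = 1" by simp
  then have "1 - exp x * K x = A * exp (- (cH - 1) * x)" if "\<eta> \<le> x" for x
    using const[OF that] by (simp add: f_def)
  then show ?thesis by blast
qed

text \<open>exp(x) K has the positive derivative exp(x) S and the limit 1 at infinity.\<close>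

lemma profile_le_exp:
  assumes tw: "travelling_wave_profile cH cL \<gamma> K \<eta> \<kappa>" and c: "0 < cL" "cL < 1" "1 < cH"
  shows "mono (\<lambda>x. exp x * K x)" "K x \<le> exp (- x)"
proof -
  note Kd = profile_has_derivative[OF tw c(2)]
  have lim: "((\<lambda>\<xi>. exp \<xi> * K \<xi>) \<longlongrightarrow> 1) at_top" using tw by (auto simp: travelling_wave_profile_def)
  show m: "mono (\<lambda>x. exp x * K x)"
  proof (rule monoI)
    fix x y :: real assume "x \<le> y"
    then show "exp x * K x \<le> exp y * K y"
    proof (rule DERIV_nonneg_imp_nondecreasing)
      fix z
      have "((\<lambda>x. exp x * K x) has_real_derivative exp z * flux cH cL \<eta> \<kappa> z) (at z)"
        using Kd[of z] by (auto intro!: derivative_eq_intros simp: algebra_simps)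
      then show "\<exists>d. ((\<lambda>x. exp x * K x) has_real_derivative d) (at z) \<and> 0 \<le> d"
        using flux_pos[of cH cL \<eta> \<kappa> z] by (intro exI conjI) auto
    qed
  qed
  have "\<forall>\<^sub>F y in at_top. exp x * K x \<le> exp y * K y"
    using eventually_ge_at_top[of x] by eventually_elim (rule monoD[OF m])
  from tendsto_lowerbound[OF lim this] have "exp x * K x \<le> 1" by simp
  then show "K x \<le> exp (- x)" by (simp add: exp_minus field_simps)
qed

section \<open>Integration tools\<close>

lemma AE_lborel_negligible:
  fixes P :: "real \<Rightarrow> bool"
  assumes "AE x in lborel. P x" shows "negligible {x. \<not> P x}"
proof -
  obtain N where N: "N \<in> null_sets lborel" "{x. \<not> P x} \<subseteq> N"
    using assms by (auto simp: eventually_ae_filter)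
  then have "N \<in> null_sets lebesgue" by (intro null_sets_completionI)
  then have "negligible N" by (simp add: negligible_iff_null_sets)
  then show ?thesis using N(2) by (rule negligible_subset)
qed

lemma integral_cong_AE_lborel:
  fixes f g :: "real \<Rightarrow> real"
  assumes "AE x in lborel. x \<in> {a..b} \<longrightarrow> f x = g x"
  shows "integral {a..b} f = integral {a..b} g"
  by (rule integral_spike[OF AE_lborel_negligible[OF assms]]) auto

lemma integral_mono_AE_lborel:
  fixes f g :: "real \<Rightarrow> real"
  assumes "AE x in lborel. x \<in> {a..b} \<longrightarrow> f x \<le> g x" "f integrable_on {a..b}" "g integrable_on {a..b}"
  shows "integral {a..b} f \<le> integral {a..b} g"
proof -
  let ?h = "\<lambda>x. if f x \<le> g x then f x else g x"
  have n: "negligible {x. \<not> (x \<in> {a..b} \<longrightarrow> f x \<le> g x)}" by (rule AE_lborel_negligible[OF assms(1)])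
  have h: "?h integrable_on {a..b}" by (rule integrable_spike[OF assms(2) n]) auto
  have "integral {a..b} f = integral {a..b} ?h" by (rule integral_spike[OF n]) auto
  also have "\<dots> \<le> integral {a..b} g" by (rule integral_le[OF h assms(3)]) auto
  finally show ?thesis .
qed

lemma borel_bounded_on_interval:
  fixes f :: "real \<Rightarrow> real"
  assumes m: "f \<in> borel_measurable borel" and C: "\<And>x. x \<in> {a..b} \<Longrightarrow> \<bar>f x\<bar> \<le> C"
  shows "f integrable_on {a..b}" "integral {a..b} f = (LINT x|lborel. f x * indicator {a..b} x)"
proof -
  have b: "bounded_borel (\<lambda>x. f x * indicator {a..b} x)"
    unfolding bounded_borel_def using m C by (auto intro!: exI[of _ "\<bar>C\<bar>"] simp: indicator_def order_trans[OF C abs_ge_self])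
  have "(\<lambda>x. f x * indicator {a..b} x) integrable_on {a..b}" by (rule bounded_borel_integral(1)[OF b])
  then show "f integrable_on {a..b}" by (rule integrable_eq) auto
  have "integral {a..b} f = integral {a..b} (\<lambda>x. f x * indicator {a..b} x)" 
    by (intro Henstock_Kurzweil_Integration.integral_cong) auto
  also have "\<dots> = (LINT x:{a..b}|lborel. f x * indicator {a..b} x)" by (rule bounded_borel_integral(2)[OF b])
  also have "\<dots> = (LINT x|lborel. f x * indicator {a..b} x)"
    unfolding set_lebesgue_integral_def by (intro Bochner_Integration.integral_cong) (auto simp: indicator_def)
  finally show "integral {a..b} f = (LINT x|lborel. f x * indicator {a..b} x)" .
qed

lemma integral_swap_bounded_borel:
  fixes f :: "real \<times> real \<Rightarrow> real"
  assumes m: "f \<in> borel_measurable borel" and C: "\<And>x t. x \<in> {a..b} \<Longrightarrow> t \<in> {c..d} \<Longrightarrow> \<bar>f (x, t)\<bar> \<le> C"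
  shows "integral {a..b} (\<lambda>x. integral {c..d} (\<lambda>t. f (x, t))) = integral {c..d} (\<lambda>t. integral {a..b} (\<lambda>x. f (x, t)))"
    and "(\<lambda>t. integral {a..b} (\<lambda>x. f (x, t))) integrable_on {c..d}"
    and "(\<lambda>x. integral {c..d} (\<lambda>t. f (x, t))) integrable_on {a..b}"
proof -
  define F where "F z = f z * indicator ({a..b} \<times> {c..d}) z" for z
  have Rm: "{a..b} \<times> {c..d} \<in> sets borel" by (intro borel_closed closed_Times) auto
  have Fb: "bounded_borel F"
    unfolding bounded_borel_def F_def using m Rm C
    by (auto intro!: exI[of _ "\<bar>C\<bar>"] simp: indicator_def order_trans[OF C abs_ge_self])
  have i: "integrable lborel F"
    by (rule integrable_lborel_pair_bounded[OF Fb, of a b c d]) (auto simp: F_def)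
  have sl: "(\<lambda>x. f (x, t)) \<in> borel_measurable borel" "(\<lambda>t. f (x, t)) \<in> borel_measurable borel" for x t
    by (rule measurable_compose[OF _ m], intro borel_measurable_continuous_onI continuous_intros)+
  have 1: "integral {a..b} (\<lambda>x. f (x, t)) = (LINT x|lborel. F (x, t))" if "t \<in> {c..d}" for t
    using borel_bounded_on_interval(2)[OF sl(1), of a b t C] C that by (simp add: F_def indicator_times)
  have 2: "integral {c..d} (\<lambda>t. f (x, t)) = (LINT t|lborel. F (x, t))" if "x \<in> {a..b}" for x
    using borel_bounded_on_interval(2)[OF sl(2), of c d x C] C that by (simp add: F_def indicator_times)
  have conv: "g integrable_on {l..u} \<and> integral {l..u} g = (LINT s|lborel. h s)"
    if h: "integrable lborel h" "\<And>s. s \<notin> {l..u} \<Longrightarrow> h s = 0" "\<And>s. s \<in> {l..u} \<Longrightarrow> g s = h s"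
    for g h :: "real \<Rightarrow> real" and l u
  proof -
    have eq: "indicator {l..u} s *\<^sub>R h s = h s" for s using h(2)[of s] by (auto simp: indicator_def)
    have s: "set_integrable lborel {l..u} h" unfolding set_integrable_def eq by (rule h(1))
    have "h integrable_on {l..u}" "integral {l..u} h = (LINT s|lborel. h s)"
      using set_borel_integral_eq_integral[OF s] unfolding set_lebesgue_integral_def eq by simp_all
    moreover have "integral {l..u} g = integral {l..u} h" by (intro Henstock_Kurzweil_Integration.integral_cong h(3))
    moreover have "g integrable_on {l..u}" by (rule integrable_eq[OF calculation(1)]) (use h(3) in auto)
    ultimately show ?thesis by simp
  qed
  have z1: "(LINT x|lborel. F (x, t)) = 0" if "t \<notin> {c..d}" for t using that by (simp add: F_def indicator_times)
  have z2: "(LINT t|lborel. F (x, t)) = 0" if "x \<notin> {a..b}" for x using that by (simp add: F_def indicator_times)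
  note t = conv[OF lborel_Fubini(1)[OF i] z1 1] and x = conv[OF lborel_Fubini(3)[OF i] z2 2]
  show "integral {a..b} (\<lambda>x. integral {c..d} (\<lambda>t. f (x, t))) = integral {c..d} (\<lambda>t. integral {a..b} (\<lambda>x. f (x, t)))"
    using t x lborel_Fubini(2,4)[OF i] by simp
  show "(\<lambda>t. integral {a..b} (\<lambda>x. f (x, t))) integrable_on {c..d}" using t by simp
  show "(\<lambda>x. integral {c..d} (\<lambda>t. f (x, t))) integrable_on {a..b}" using x by simp
qed

text \<open>With G the right-hand side of the integral inequality, exp(-C s) (G + D / C) is
  nonincreasing, since G' = C f + D \<le> C G + D. The shift D / C absorbs the
  inhomogeneity.\<close>

lemma integral_gronwall:
  fixes f :: "real \<Rightarrow> real"
  assumes f: "continuous_on {0..T} f" and C: "0 < C" "0 \<le> D"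
    and le: "\<And>t. t \<in> {0..T} \<Longrightarrow> f t \<le> integral {0..t} (\<lambda>s. C * f s + D)" and t: "t \<in> {0..T}"
  shows "f t \<le> D / C * exp (C * T)"
proof -
  define G where "G t = integral {0..t} (\<lambda>s. C * f s + D)" for t
  have c: "continuous_on {0..T} (\<lambda>s. C * f s + D)" by (intro continuous_intros f)
  have Gd: "(G has_real_derivative C * f s + D) (at s within {0..T})" if "s \<in> {0..T}" for s
    unfolding G_def using integral_has_real_derivative[OF c that] .
  define E where "E s = exp (- C * s) * (G s + D / C)" for s
  have Ed: "(E has_real_derivative exp (- C * s) * (C * f s - C * G s)) (at s within {0..T})" if "s \<in> {0..T}" for s
    unfolding E_def using Gd[OF that] C
    by (auto intro!: derivative_eq_intros simp: field_simps)
  have "E t \<le> E 0"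
  proof (rule DERIV_nonpos_imp_decreasing_open[where f=E])
    show "continuous_on {0..t} E"
      using DERIV_continuous_on[OF Ed] continuous_on_subset[of "{0..T}" E "{0..t}"] t by auto
    fix s assume s: "0 < s" "s < t"
    then have "at s within {0..T} = at s" using t by (intro at_within_Icc_at) auto
    moreover have "C * f s - C * G s \<le> 0" using le[of s] s t C by (simp add: G_def)
    ultimately show "\<exists>y. (E has_real_derivative y) (at s) \<and> y \<le> 0"
      using Ed[of s] s t by (intro exI[of _ "exp (- C * s) * (C * f s - C * G s)"]) (auto simp: mult_nonneg_nonpos)
  qed (use t in auto)
  then have "exp (- C * t) * (G t + D / C) \<le> D / C" by (simp add: E_def G_def)
  then have "exp (C * t) * (exp (- C * t) * (G t + D / C)) \<le> exp (C * t) * (D / C)" by (intro mult_left_mono) auto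
  then have "G t + D / C \<le> D / C * exp (C * t)" by (simp add: mult.assoc[symmetric] mult.commute flip: exp_add)
  also have "\<dots> \<le> D / C * exp (C * T)" using C t by (intro mult_left_mono) auto
  finally have "G t \<le> D / C * exp (C * T)" using C by (smt (verit) divide_nonneg_pos)
  then show ?thesis using le[OF t] by (simp add: G_def)
qed

section \<open>The linearised inequality\<close>

locale credit_migration =
  fixes \<delta> \<sigma>H \<sigma>L \<gamma> \<eta> \<kappa> :: real and v :: "real \<times> real \<Rightarrow> real" and K :: "real \<Rightarrow> real"
  assumes \<delta>: "0 < \<delta>" and \<sigma>H: "0 < \<sigma>H" and \<sigma>: "\<sigma>H < \<sigma>L"
    and \<delta>H: "1/2 * \<sigma>H\<^sup>2 < \<delta>" and \<delta>L: "\<delta> < 1/2 * \<sigma>L\<^sup>2"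
    and sol: "\<And>T. 0 < T \<Longrightarrow> obstacle_solution \<delta> \<sigma>H \<sigma>L \<gamma> T v"
    and profile: "travelling_wave_profile (2 * \<delta> / \<sigma>H\<^sup>2) (2 * \<delta> / \<sigma>L\<^sup>2) \<gamma> K \<eta> \<kappa>"
begin

abbreviation "cH \<equiv> 2 * \<delta> / \<sigma>H\<^sup>2"
abbreviation "cL \<equiv> 2 * \<delta> / \<sigma>L\<^sup>2"
abbreviation "S \<equiv> flux cH cL \<eta> \<kappa>"
abbreviation "Z \<equiv> flux_deriv cH cL \<eta> \<kappa>"

text \<open>The reciprocal of \<sigma>(K)^2, written through the position relative to \<eta>;
  \<open>vol_K\<close> confirms that the two agree.\<close>

definition w :: "real \<Rightarrow> real" where
  "w x = (if x \<le> \<eta> then 1 / \<sigma>L\<^sup>2 else 1 / \<sigma>H\<^sup>2)"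

lemma \<sigma>L: "0 < \<sigma>L" using \<sigma>H \<sigma> by simp

lemma c_bounds: "0 < cL" "cL < 1" "1 < cH" "0 < cH"
  using \<delta> \<sigma>H \<sigma>L \<delta>H \<delta>L by (auto simp: field_simps)

lemma \<kappa>\<eta>: "\<kappa> < \<eta>" and K\<eta>: "K \<eta> = \<gamma>"
  using profile by (auto simp: travelling_wave_profile_def)

lemma w_pos: "0 < w x" using \<sigma>H \<sigma>L by (auto simp: w_def)

lemma w_bounds: "1 / \<sigma>L\<^sup>2 \<le> w x" "w x \<le> 1 / \<sigma>H\<^sup>2"
proof -
  have "\<sigma>H\<^sup>2 \<le> \<sigma>L\<^sup>2" using \<sigma>H \<sigma> by (intro power_mono) auto
  then have "1 / \<sigma>L\<^sup>2 \<le> 1 / \<sigma>H\<^sup>2" using \<sigma>H \<sigma>L by (intro divide_left_mono) auto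
  then show "1 / \<sigma>L\<^sup>2 \<le> w x" "w x \<le> 1 / \<sigma>H\<^sup>2" by (auto simp: w_def)
qed

lemma w_borel: "bounded_borel w"
  unfolding bounded_borel_def
proof
  show "w \<in> borel_measurable borel" unfolding w_def[abs_def] by measurable
  show "\<exists>C. \<forall>x. \<bar>w x\<bar> \<le> C" using w_bounds(2) w_pos by (intro exI[of _ "1 / \<sigma>H\<^sup>2"]) (simp add: less_imp_le)
qed

lemmas K_deriv = profile_has_derivative[OF profile c_bounds(2)]
lemmas K_left = profile_value_at_left[OF profile]
lemmas K_decreasing = profile_strict_decreasing[OF profile c_bounds(1,2,4)]
lemmas K_gt_S = profile_gt_flux[OF profile c_bounds(1,2,4)]
lemmas K_le_exp = profile_le_exp(2)[OF profile c_bounds(1-3)]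
lemmas K_tail = profile_tail[OF profile c_bounds(1-3)]
lemmas S_incr = flux_increment[OF \<kappa>\<eta>, where cH = "2 * \<delta> / \<sigma>H\<^sup>2" and cL = "2 * \<delta> / \<sigma>L\<^sup>2"]

lemma S_pos: "0 < S x" and S_le_1: "S x \<le> 1"
  using flux_pos flux_le_1[of cL cH \<kappa> \<eta>] c_bounds \<kappa>\<eta> by auto

lemma Z_borel: "bounded_borel Z"
  using bounded_borel_flux_deriv[of cL cH \<kappa> \<eta>] c_bounds \<kappa>\<eta> by auto

lemma K_cont: "continuous_on A K"
  by (intro continuous_at_imp_continuous_on ballI DERIV_isCont[OF K_deriv])

lemma K_le_1: "K x \<le> 1"
  using K_left[of x] K_left[of \<kappa>] K_decreasing[of \<kappa> x] by (cases "x \<le> \<kappa>") auto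

lemma K_pos: "0 < K x"
  using K_left[of x] K_gt_S[of x] S_pos[of x] by (cases "x \<le> \<kappa>") auto

lemma K_level: "\<gamma> \<le> K x \<longleftrightarrow> x \<le> \<eta>"
proof -
  have "\<gamma> \<le> K x" if "x \<le> \<eta>"
  proof (cases "\<kappa> \<le> x")
    case True then show ?thesis using that K_decreasing[of x \<eta>] K\<eta> by (cases "x = \<eta>") auto
  next
    case False then show ?thesis using K_left[of x] K_le_1[of \<eta>] K\<eta> by auto
  qed
  moreover have "K x < \<gamma>" if "\<eta> < x" using that K_decreasing[of \<eta> x] K\<eta> \<kappa>\<eta> by auto
  ultimately show ?thesis by force
qed

lemma vol_K: "(vol \<sigma>H \<sigma>L \<gamma> (K x))\<^sup>2 = 1 / w x"
  using K_level[of x] by (auto simp: vol_def w_def)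

lemma vol_mono: "a \<le> b \<Longrightarrow> (vol \<sigma>H \<sigma>L \<gamma> a)\<^sup>2 \<le> (vol \<sigma>H \<sigma>L \<gamma> b)\<^sup>2"
  using \<sigma>H \<sigma> by (auto simp: vol_def intro!: power_mono)

text \<open>To the right of \<kappa> this is the equation of the profile. To the left K lies on the
  obstacle, Z = 0 and S = 1, and only the inequality is left.\<close>

lemma K_equation: "\<kappa> < x \<Longrightarrow> 1/2 * Z x + \<delta> * w x * S x = 0"
  "0 \<le> 1/2 * Z x + \<delta> * w x * S x"
proof -
  show "\<kappa> < x \<Longrightarrow> 1/2 * Z x + \<delta> * w x * S x = 0" using \<kappa>\<eta> by (auto simp: flux_deriv_def w_def)
  then show "0 \<le> 1/2 * Z x + \<delta> * w x * S x"
    using \<delta> w_pos[of x] S_pos[of x] by (cases "\<kappa> < x") (auto simp: flux_deriv_def)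
qed

text \<open>Since \<open>v\<^sub>\<xi>\<^sub>\<xi> + v\<^sub>\<xi> \<le> 0\<close> and the volatility is nondecreasing in \<open>v\<close>, replacing \<open>\<sigma>(v)\<close> by \<open>\<sigma>(K)\<close>
  changes the equation in the favourable direction on either side of \<open>v = K\<close>: the difference
  \<open>v - K\<close> satisfies a linear differential inequality with a coefficient that does not depend on time.\<close>

lemma linearised_inequality:
  assumes eq: "min (L_op \<delta> \<sigma>H \<sigma>L \<gamma> a yx yxx yt) (1 - a) = 0" and neg: "yxx + yx \<le> 0"
  shows "a < K x \<Longrightarrow> 1/2 * (yxx + yx - Z x) + \<delta> * w x * (yx + a - S x) \<le> w x * yt"
    and "K x \<le> a \<Longrightarrow> \<kappa> < x \<Longrightarrow> w x * yt \<le> 1/2 * (yxx + yx - Z x) + \<delta> * w x * (yx + a - S x)"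
proof -
  have wx: "0 < w x" by (rule w_pos)
  {
    assume a: "a < K x"
    \<comment> \<open>Below K \<le> 1 the solution stays off the obstacle, so the equation holds
      exactly.\<close>
    then have "L_op \<delta> \<sigma>H \<sigma>L \<gamma> a yx yxx yt = 0" using eq K_le_1[of x] by linarith
    then have yt: "yt = 1/2 * (vol \<sigma>H \<sigma>L \<gamma> a)\<^sup>2 * (yxx + yx) + \<delta> * (yx + a)" by (simp add: L_op_def)
    have "w x * (vol \<sigma>H \<sigma>L \<gamma> a)\<^sup>2 \<le> w x * (vol \<sigma>H \<sigma>L \<gamma> (K x))\<^sup>2"
      using a wx by (intro mult_left_mono vol_mono) auto
    also have "\<dots> = 1" using wx by (simp add: vol_K)
    finally have "1 * (yxx + yx) \<le> w x * (vol \<sigma>H \<sigma>L \<gamma> a)\<^sup>2 * (yxx + yx)"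
      using neg by (intro mult_right_mono_neg) auto
    moreover have "w x * yt = 1/2 * (w x * (vol \<sigma>H \<sigma>L \<gamma> a)\<^sup>2 * (yxx + yx)) + \<delta> * w x * (yx + a)"
      unfolding yt by (simp add: algebra_simps)
    ultimately show "1/2 * (yxx + yx - Z x) + \<delta> * w x * (yx + a - S x) \<le> w x * yt"
      using K_equation(2)[of x] by (simp add: algebra_simps)
  }
  {
    assume a: "K x \<le> a" and x: "\<kappa> < x"
    \<comment> \<open>Above K the obstacle may be active, and only L v \<ge> 0 remains, which points
      the right way. The profile must then satisfy its equation exactly, hence the condition
      \<kappa> < x.\<close>
    have "0 \<le> L_op \<delta> \<sigma>H \<sigma>L \<gamma> a yx yxx yt" using eq by linarith
    then have yt: "yt \<le> 1/2 * (vol \<sigma>H \<sigma>L \<gamma> a)\<^sup>2 * (yxx + yx) + \<delta> * (yx + a)" by (simp add: L_op_def)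
    have "1 = w x * (vol \<sigma>H \<sigma>L \<gamma> (K x))\<^sup>2" using wx by (simp add: vol_K)
    also have "\<dots> \<le> w x * (vol \<sigma>H \<sigma>L \<gamma> a)\<^sup>2"
      using a wx by (intro mult_left_mono vol_mono) auto
    finally have "w x * (vol \<sigma>H \<sigma>L \<gamma> a)\<^sup>2 * (yxx + yx) \<le> 1 * (yxx + yx)"
      using neg by (intro mult_right_mono_neg) auto
    moreover have "w x * yt \<le> w x * (1/2 * (vol \<sigma>H \<sigma>L \<gamma> a)\<^sup>2 * (yxx + yx) + \<delta> * (yx + a))"
      using yt wx by (intro mult_left_mono) auto
    moreover have "\<dots> = 1/2 * (w x * (vol \<sigma>H \<sigma>L \<gamma> a)\<^sup>2 * (yxx + yx)) + \<delta> * w x * (yx + a)"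
      by (simp add: algebra_simps)
    moreover have "\<delta> * w x * (yx + a - S x) = \<delta> * w x * (yx + a) - \<delta> * w x * S x"
      by (simp add: algebra_simps)
    ultimately show "w x * yt \<le> 1/2 * (yxx + yx - Z x) + \<delta> * w x * (yx + a - S x)"
      using K_equation(1)[OF x] by argo
  }
qed

section \<open>The multiplier estimate on a time slice\<close>

abbreviation "regular \<equiv> regular_slice \<delta> \<sigma>H \<sigma>L \<gamma> v"
abbreviation "derivatives \<equiv> regular_derivatives \<delta> \<sigma>H \<sigma>L \<gamma> v"

lemmas regularity = obstacle_solution_regularity[OF sol]

text \<open>Multiplication of the linearised inequality by \<psi> m(y) and one integration by parts.
  The second-order part is the derivative of h = (v_x + v) - (K' + K), and y' = h - y, so only h and
  y survive in \<open>bulk\<close>. By \<open>sign\<close>, m(y) is negative only where v < K and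
  positive only where v \<ge> K to the right of \<kappa>, that is, where the inequality of the
  matching direction is available. Both functionals are covered: m = \<open>neg_cube'\<close> and m
  = 1.\<close>

lemma slice_estimate:
  assumes rs: "regular p q r M t H" and b: "bounded_borel p" "bounded_borel q" "bounded_borel r"
    and x12: "x1 \<le> x2"
    and \<psi>: "\<And>x. (\<psi> has_real_derivative \<psi>' x) (at x)" "continuous_on UNIV \<psi>'" "\<And>x. x1 \<le> x \<Longrightarrow> x \<le> x2 \<Longrightarrow> 0 \<le> \<psi> x"
    and m: "\<And>s. (m has_real_derivative m' s) (at s)" "continuous_on UNIV m'"
    and sign: "\<And>x. x1 < x \<Longrightarrow> x < x2 \<Longrightarrow> (v (x, t) < K x \<and> m (v (x, t) - K x) \<le> 0) \<or>
        (K x \<le> v (x, t) \<and> \<kappa> < x \<and> 0 \<le> m (v (x, t) - K x)) \<or> m (v (x, t) - K x) = 0"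
  defines "y \<equiv> \<lambda>x. v (x, t) - K x" and "h \<equiv> \<lambda>x. H x - S x"
  defines "bulk \<equiv> \<lambda>x. - 1/2 * (\<psi>' x * m (y x) + \<psi> x * m' (y x) * (h x - y x)) * h x + \<delta> * w x * (\<psi> x * m (y x) * h x)"
  shows "bulk integrable_on {x1..x2}"
    "integral {x1..x2} (\<lambda>x. \<psi> x * w x * (m (y x) * r (x, t)))
      \<le> 1/2 * (\<psi> x2 * m (y x2) * h x2 - \<psi> x1 * m (y x1) * h x1) + integral {x1..x2} bulk"
proof -
  have vd: "((\<lambda>x. v (x, t)) has_real_derivative H x - v (x, t)) (at x)" for x using rs by (auto simp: regular_slice_def)
  have Hi: "x \<le> y \<Longrightarrow> H y - H x = integral {x..y} (\<lambda>x. p (x, t) + q (x, t))" for x y using rs by (auto simp: regular_slice_def)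
  have bpq: "bounded_borel (\<lambda>x. p (x, t) + q (x, t))"
    by (intro bounded_borel_add bounded_borel_slice b)
  define n where "n x = p (x, t) + q (x, t) - Z x" for x
  have bn: "bounded_borel n"
  proof -
    have "bounded_borel (\<lambda>x. (p (x, t) + q (x, t)) + (-1) * Z x)"
      by (intro bounded_borel_add[OF bpq] bounded_borel_mult bounded_borel_const Z_borel)
    then show ?thesis by (simp add: n_def[abs_def])
  qed
  have hn: "h c - h a = integral {a..c} n" if "a \<le> c" for a c
  proof -
    have "integral {a..c} n = integral {a..c} (\<lambda>x. p (x, t) + q (x, t)) - integral {a..c} Z"
      unfolding n_def[abs_def]
      by (intro Henstock_Kurzweil_Integration.integral_diff bounded_borel_integral(1) bpq Z_borel)
    then show ?thesis using Hi[OF that] S_incr[OF that] by (simp only: h_def)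
  qed
  have ch: "continuous_on A h" for A by (rule indefinite_integral_continuous_on[OF bn]) (use hn in auto)
  have yd: "(y has_real_derivative h x - y x) (at x)" for x
    unfolding y_def h_def using DERIV_diff[OF vd[of x] K_deriv[of x]] by (simp add: algebra_simps)
  have cy: "continuous_on A y" for A
    by (intro continuous_at_imp_continuous_on ballI DERIV_isCont[OF yd])
  have cm: "continuous_on A m" for A
    by (intro continuous_at_imp_continuous_on ballI DERIV_isCont[OF m(1)])
  have c\<psi>: "continuous_on A \<psi>" for A
    by (intro continuous_at_imp_continuous_on ballI DERIV_isCont[OF \<psi>(1)])
  have cmy: "continuous_on A (\<lambda>x. m (y x))" "continuous_on A (\<lambda>x. m' (y x))" for A
    using continuous_on_compose2[OF cm[of UNIV] cy] continuous_on_compose2[OF m(2) cy] by auto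
  have c\<psi>': "continuous_on A \<psi>'" for A using \<psi>(2) continuous_on_subset by blast
  have i1: "(\<lambda>x. - 1/2 * (\<psi>' x * m (y x) + \<psi> x * m' (y x) * (h x - y x)) * h x) integrable_on {x1..x2}"
    by (intro integrable_continuous_interval continuous_intros c\<psi>' c\<psi> cmy ch cy)
  have i2: "(\<lambda>x. \<delta> * w x * (\<psi> x * m (y x) * h x)) integrable_on {x1..x2}"
  proof -
    have "(\<lambda>x. (\<delta> * (\<psi> x * m (y x) * h x)) * w x) integrable_on {x1..x2}"
      by (intro continuous_times_bounded_borel_integrable w_borel continuous_intros c\<psi> cmy ch)
    then show ?thesis by (simp add: mult_ac)
  qed
  show "bulk integrable_on {x1..x2}" unfolding bulk_def by (intro Henstock_Kurzweil_Integration.integrable_add i1 i2)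
  have i3: "(\<lambda>x. (\<psi> x * m (y x)) * n x) integrable_on {x1..x2}"
    by (intro continuous_times_bounded_borel_integrable bn continuous_intros c\<psi> cmy)
  have i4: "(\<lambda>x. \<psi> x * w x * (m (y x) * r (x, t))) integrable_on {x1..x2}"
  proof -
    have "(\<lambda>x. (\<psi> x * m (y x)) * (w x * r (x, t))) integrable_on {x1..x2}"
      by (intro continuous_times_bounded_borel_integrable bounded_borel_mult w_borel bounded_borel_slice b continuous_intros c\<psi> cmy)
    then show ?thesis by (simp add: mult_ac)
  qed
  have ae: "AE x in lborel. x \<in> {x1..x2} \<longrightarrow> \<psi> x * w x * (m (y x) * r (x, t)) \<le>
      1/2 * ((\<psi> x * m (y x)) * n x) + \<delta> * w x * (\<psi> x * m (y x) * h x)"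
  proof -
    have "AE x in lborel. H x = p (x, t) + v (x, t)" 
      "AE x in lborel. min (L_op \<delta> \<sigma>H \<sigma>L \<gamma> (v (x, t)) (p (x, t)) (q (x, t)) (r (x, t))) (1 - v (x, t)) = 0 \<and>
        q (x, t) + p (x, t) \<le> 0" using rs by (auto simp: regular_slice_def)
    \<comment> \<open>The end points are discarded as null sets. \<open>sign\<close> is assumed only
      in the interior, since one application starts at x1 = \<kappa>.\<close>
    then show ?thesis using AE_lborel_singleton[of x1] AE_lborel_singleton[of x2]
    proof eventually_elim
      case (elim x)
      show ?case
      proof
        assume "x \<in> {x1..x2}"
        with elim have x: "x1 < x" "x < x2" by auto
        note lin = linearised_inequality[OF conjunct1[OF elim(2)] conjunct2[OF elim(2)], of x]
        have "(v (x, t) < K x \<and> m (y x) \<le> 0) \<or> (K x \<le> v (x, t) \<and> \<kappa> < x \<and> 0 \<le> m (y x)) \<or> m (y x) = 0"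
          using sign[OF x] by (simp add: y_def)
        then have "m (y x) * (w x * r (x, t)) \<le> m (y x) * (1/2 * n x + \<delta> * w x * h x)" (is ?c)
        proof (elim disjE conjE)
          assume "v (x, t) < K x" "m (y x) \<le> 0"
          then show ?c using lin(1) elim(1) by (intro mult_left_mono_neg) (auto simp: n_def h_def algebra_simps)
        next
          assume "K x \<le> v (x, t)" "\<kappa> < x" "0 \<le> m (y x)"
          then show ?c using lin(2) elim(1) by (intro mult_left_mono) (auto simp: n_def h_def algebra_simps)
        qed simp
        from mult_left_mono[OF this \<psi>(3)[of x]] x
        show "\<psi> x * w x * (m (y x) * r (x, t)) \<le> 1/2 * ((\<psi> x * m (y x)) * n x) + \<delta> * w x * (\<psi> x * m (y x) * h x)"
          by (simp add: algebra_simps)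
      qed
    qed
  qed
  have "integral {x1..x2} (\<lambda>x. \<psi> x * w x * (m (y x) * r (x, t)))
     \<le> integral {x1..x2} (\<lambda>x. 1/2 * ((\<psi> x * m (y x)) * n x) + \<delta> * w x * (\<psi> x * m (y x) * h x))"
    by (intro integral_mono_AE_lborel[OF ae i4] Henstock_Kurzweil_Integration.integrable_add i2 integrable_on_mult_right i3)
  also have "\<dots> = 1/2 * integral {x1..x2} (\<lambda>x. (\<psi> x * m (y x)) * n x) + integral {x1..x2} (\<lambda>x. \<delta> * w x * (\<psi> x * m (y x) * h x))"
    by (subst Henstock_Kurzweil_Integration.integral_add) (use i2 i3 integrable_on_mult_right in auto)
  also have "integral {x1..x2} (\<lambda>x. (\<psi> x * m (y x)) * n x) = \<psi> x2 * m (y x2) * h x2 - \<psi> x1 * m (y x1) * h x1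
      - integral {x1..x2} (\<lambda>x. (\<psi>' x * m (y x) + \<psi> x * m' (y x) * (h x - y x)) * h x)"
  proof (rule absolutely_continuous_integration_by_parts[OF x12])
    fix x assume "x \<in> {x1..x2}"
    have "((\<lambda>x. m (y x)) has_real_derivative m' (y x) * (h x - y x)) (at x)"
      by (rule DERIV_chain2[OF m(1) yd])
    from DERIV_mult[OF \<psi>(1) this]
    have "((\<lambda>x. \<psi> x * m (y x)) has_real_derivative \<psi>' x * m (y x) + \<psi> x * m' (y x) * (h x - y x)) (at x)"
      by (simp add: algebra_simps)
    then show "((\<lambda>x. \<psi> x * m (y x)) has_real_derivative \<psi>' x * m (y x) + \<psi> x * m' (y x) * (h x - y x)) (at x within {x1..x2})"
      by (rule has_field_derivative_at_within)
  next
    show "continuous_on {x1..x2} (\<lambda>x. \<psi>' x * m (y x) + \<psi> x * m' (y x) * (h x - y x))"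
      by (intro continuous_intros c\<psi>' c\<psi> cmy ch cy)
  qed (use bn hn in auto)
  finally have le: "integral {x1..x2} (\<lambda>x. \<psi> x * w x * (m (y x) * r (x, t)))
     \<le> 1/2 * (\<psi> x2 * m (y x2) * h x2 - \<psi> x1 * m (y x1) * h x1
      - integral {x1..x2} (\<lambda>x. (\<psi>' x * m (y x) + \<psi> x * m' (y x) * (h x - y x)) * h x))
      + integral {x1..x2} (\<lambda>x. \<delta> * w x * (\<psi> x * m (y x) * h x))" by simp
  have "integral {x1..x2} bulk = integral {x1..x2} (\<lambda>x. - 1/2 * (\<psi>' x * m (y x) + \<psi> x * m' (y x) * (h x - y x)) * h x)
      + integral {x1..x2} (\<lambda>x. \<delta> * w x * (\<psi> x * m (y x) * h x))"
    unfolding bulk_def by (rule Henstock_Kurzweil_Integration.integral_add[OF i1 i2])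
  then have "integral {x1..x2} bulk = - 1/2 * integral {x1..x2} (\<lambda>x. (\<psi>' x * m (y x) + \<psi> x * m' (y x) * (h x - y x)) * h x)
      + integral {x1..x2} (\<lambda>x. \<delta> * w x * (\<psi> x * m (y x) * h x))"
    unfolding mult.assoc[of "- 1/2"] by simp
  with le show "integral {x1..x2} (\<lambda>x. \<psi> x * w x * (m (y x) * r (x, t)))
      \<le> 1/2 * (\<psi> x2 * m (y x2) * h x2 - \<psi> x1 * m (y x1) * h x1) + integral {x1..x2} bulk"
    by argo
qed

end

section \<open>Energies\<close>

text \<open>An exponent of at least 2 makes the difference quotient at the corner 0 tend to
  0.\<close>

lemma has_real_derivative_min_power:
  "((\<lambda>s. (min s 0) ^ Suc (Suc k)) has_real_derivative real (Suc (Suc k)) * (min s 0) ^ Suc k) (at (s::real))"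
proof -
  consider "s < 0" | "s > 0" | "s = 0" by linarith
  then show ?thesis
  proof cases
    case 1
    have "((\<lambda>s. s ^ Suc (Suc k)) has_real_derivative real (Suc (Suc k)) * (min s 0) ^ Suc k) (at s)"
      using 1 DERIV_pow[of "Suc (Suc k)" s] by (simp add: min_def)
    then show ?thesis
      by (rule has_field_derivative_transform_within_open[where S="{..<0}"]) (use 1 in \<open>auto simp: min_def\<close>)
  next
    case 2
    have "((\<lambda>s. 0) has_real_derivative real (Suc (Suc k)) * (min s 0) ^ Suc k) (at s)" using 2 by (simp add: min_def)
    then show ?thesis
      by (rule has_field_derivative_transform_within_open[where S="{0<..}"]) (use 2 in \<open>auto simp: min_def\<close>)
  next
    case 3
    have "((\<lambda>y::real. (min y 0) ^ Suc (Suc k) / y) \<longlongrightarrow> 0) (at 0)"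
    proof (rule Lim_null_comparison)
      have "norm ((min y 0) ^ Suc (Suc k) / y) \<le> \<bar>y\<bar> ^ Suc k" for y :: real
        by (cases "y < 0") (auto simp: min_def abs_mult power_abs)
      then show "\<forall>\<^sub>F y in at 0. norm ((min y 0) ^ Suc (Suc k) / y) \<le> \<bar>y::real\<bar> ^ Suc k" by simp
      have "((\<lambda>y::real. \<bar>y\<bar> ^ Suc k) \<longlongrightarrow> \<bar>0\<bar> ^ Suc k) (at 0)" by (intro tendsto_intros)
      then show "((\<lambda>y::real. \<bar>y\<bar> ^ Suc k) \<longlongrightarrow> 0) (at 0)" by simp
    qed
    then show ?thesis unfolding 3 by (simp add: has_field_derivative_iff)
  qed
qed

context credit_migration
begin

definition clamped :: "real \<Rightarrow> real \<times> real \<Rightarrow> real" where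
  "clamped T z = v (fst z, max 0 (min T (snd z)))"

lemma v_strip_cont: "0 < T \<Longrightarrow> continuous_on (strip T) v"
  using sol by (simp add: obstacle_solution_def)

lemma clamped_cont: "0 < T \<Longrightarrow> continuous_on A (clamped T)"
  using continuous_on_clamp[OF v_strip_cont] unfolding clamped_def[abs_def] by (rule continuous_on_subset) auto

lemma clamped_eq: "t \<in> {0..T} \<Longrightarrow> clamped T (x, t) = v (x, t)"
  by (auto simp: clamped_def min_def max_def)

lemma v_le_1: "0 \<le> t \<Longrightarrow> v (x, t) \<le> 1"
proof -
  assume t: "0 \<le> t"
  let ?T = "t + 1"
  have T: "0 < ?T" using t by simp
  obtain vx vxx vt where
    "AE z in lebesgue_on (strip ?T). min (L_op \<delta> \<sigma>H \<sigma>L \<gamma> (v z) (vx z) (vxx z) (vt z)) (1 - v z) = 0"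
    using sol[OF T] unfolding obstacle_solution_def by blast
  then have "AE z in lebesgue_on (strip ?T). v z \<le> 1" by eventually_elim linarith
  from AE_strip_le[OF v_strip_cont[OF T] T this] t show ?thesis by auto
qed

lemma v_bounded:
  assumes T: "0 < T"
  obtains M0 where "0 \<le> M0" "\<And>x t. t \<in> {0..T} \<Longrightarrow> \<bar>v (x, t)\<bar> \<le> M0"
proof -
  obtain M0 where M0: "AE z in lebesgue_on (strip T). \<bar>v z\<bar> \<le> M0"
    using sol[OF T] by (auto simp: obstacle_solution_def W10_infty_def L_infty_def)
  have M1: "AE z in lebesgue_on (strip T). v z \<le> M0" "AE z in lebesgue_on (strip T). - v z \<le> M0"
    using M0 by (eventually_elim, linarith)+
  have "\<bar>v (x, t)\<bar> \<le> M0" if "t \<in> {0..T}" for x t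
    using AE_strip_le[OF v_strip_cont[OF T] T M1(1) that]
      AE_strip_le[of T "\<lambda>z. - v z", OF continuous_on_minus[OF v_strip_cont[OF T]] T M1(2) that]
    by (simp add: abs_le_iff minus_le_iff)
  moreover from this[of 0 0] T have "0 \<le> M0" by (auto intro: order_trans[OF abs_ge_zero])
  ultimately show ?thesis using that by blast
qed

lemma v_eq_1_left:
  assumes "0 < T" obtains B where "B > 0" "\<And>x t. t \<in> {0..T} \<Longrightarrow> x < - B \<Longrightarrow> v (x, t) = 1"
    "\<And>x t. t \<in> {0..T} \<Longrightarrow> B < x \<Longrightarrow> v (x, t) \<le> exp (- x)"
  using sol[OF assms] unfolding obstacle_solution_def by blast

lemma v_initial: "v (x, 0) = min 1 (exp (- x))"
  using sol[of 1] by (auto simp: obstacle_solution_def)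

lemma v_x_cont: "0 \<le> t \<Longrightarrow> continuous_on A (\<lambda>x. v (x, t))"
proof -
  assume t: "0 \<le> t"
  have "continuous_on A (\<lambda>x. clamped (t + 1) (x, t))"
    by (rule continuous_on_compose2[OF clamped_cont[of "t + 1" UNIV]]) (use t in \<open>auto intro!: continuous_intros\<close>)
  then show ?thesis using t by (simp add: clamped_eq)
qed

text \<open>w is constant on either side of \<eta>, so the weighted integral is a combination of two
  integrals of a continuous function. This is used for continuity in time and to expose the jump
  terms at \<eta>.\<close>

lemma weighted_integral_split:
  assumes f: "continuous_on {x1..x2} f" and x: "x1 \<le> \<eta>" "\<eta> \<le> x2"
  shows "integral {x1..x2} (\<lambda>x. w x * f x) = integral {x1..\<eta>} f / \<sigma>L\<^sup>2 + integral {\<eta>..x2} f / \<sigma>H\<^sup>2"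
    and "(\<lambda>x. w x * f x) integrable_on {x1..x2}"
proof -
  show i: "(\<lambda>x. w x * f x) integrable_on {x1..x2}"
    using continuous_times_bounded_borel_integrable[OF f w_borel] by (simp add: mult.commute)
  have "integral {x1..x2} (\<lambda>x. w x * f x) = integral {x1..\<eta>} (\<lambda>x. w x * f x) + integral {\<eta>..x2} (\<lambda>x. w x * f x)"
    using Henstock_Kurzweil_Integration.integral_combine[OF x i] by simp
  also have "integral {x1..\<eta>} (\<lambda>x. w x * f x) = integral {x1..\<eta>} (\<lambda>x. f x / \<sigma>L\<^sup>2)"
    by (intro Henstock_Kurzweil_Integration.integral_cong) (auto simp: w_def)
  also have "integral {\<eta>..x2} (\<lambda>x. w x * f x) = integral {\<eta>..x2} (\<lambda>x. f x / \<sigma>H\<^sup>2)"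
    by (rule integral_spike[of "{\<eta>}"]) (auto simp: w_def)
  finally show "integral {x1..x2} (\<lambda>x. w x * f x) = integral {x1..\<eta>} f / \<sigma>L\<^sup>2 + integral {\<eta>..x2} f / \<sigma>H\<^sup>2"
    by simp
qed

section \<open>Weighted energies and their increments in time\<close>

definition energy :: "(real \<Rightarrow> real) \<Rightarrow> (real \<Rightarrow> real) \<Rightarrow> real \<Rightarrow> real \<Rightarrow> real \<Rightarrow> real" where
  "energy \<psi> \<Phi> x1 x2 t = integral {x1..x2} (\<lambda>x. w x * (\<psi> x * \<Phi> (v (x, t) - K x)))"

lemma energy_integrand_cont:
  fixes \<psi> \<Phi> :: "real \<Rightarrow> real"
  assumes "continuous_on UNIV \<psi>" "continuous_on UNIV \<Phi>" "0 \<le> t"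
  shows "continuous_on A (\<lambda>x. \<psi> x * \<Phi> (v (x, t) - K x))"
proof -
  have "continuous_on A (\<lambda>x. v (x, t) - K x)" by (intro continuous_on_diff v_x_cont assms K_cont)
  then have "continuous_on A (\<lambda>x. \<Phi> (v (x, t) - K x))" by (rule continuous_on_compose2[OF assms(2)]) simp
  then show ?thesis using continuous_on_subset[OF assms(1)] by (intro continuous_on_mult) auto
qed

lemma energy_integrable:
  assumes "continuous_on UNIV \<psi>" "continuous_on UNIV \<Phi>" "0 \<le> t"
  shows "(\<lambda>x. w x * (\<psi> x * \<Phi> (v (x, t) - K x))) integrable_on {x1..x2}"
  using continuous_times_bounded_borel_integrable[OF energy_integrand_cont[OF assms] w_borel] by (simp add: mult.commute)

text \<open>Continuity of a parameter integral is applied to jointly continuous integrands; the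
  discontinuous weight w is first removed by the split at \<eta>.\<close>

lemma energy_cont:
  assumes \<psi>: "continuous_on UNIV \<psi>" and \<Phi>: "continuous_on UNIV \<Phi>" and x: "x1 \<le> \<eta>" "\<eta> \<le> x2"
  shows "continuous_on {0..T} (energy \<psi> \<Phi> x1 x2)"
proof (cases "T \<le> 0")
  case True
  then have "{0..T} \<subseteq> {0}" by auto
  then show ?thesis using continuous_on_sing continuous_on_subset by blast
next
  case False
  then have T: "0 < T" by simp
  let ?g = "\<lambda>t x. \<psi> x * \<Phi> (clamped T (x, t) - K x)"
  have c: "continuous_on A (\<lambda>(t, x). ?g t x)" for A
    unfolding case_prod_unfold
    by (intro continuous_intros continuous_on_compose2[OF \<psi>] continuous_on_compose2[OF \<Phi>]
        continuous_on_compose2[OF clamped_cont[OF T, of UNIV]] continuous_on_compose2[OF K_cont[of UNIV]]) auto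
  have c2: "continuous_on {0..T} (\<lambda>t. integral {a..b} (?g t))" for a b
    using integral_continuous_on_param[OF c, of "{0..T}" a b] by simp
  have "continuous_on {0..T} (\<lambda>t. integral {x1..\<eta>} (?g t) / \<sigma>L\<^sup>2 + integral {\<eta>..x2} (?g t) / \<sigma>H\<^sup>2)"
    by (intro continuous_intros c2) (use \<sigma>H \<sigma>L in auto)
  moreover have "integral {x1..\<eta>} (?g t) / \<sigma>L\<^sup>2 + integral {\<eta>..x2} (?g t) / \<sigma>H\<^sup>2 = energy \<psi> \<Phi> x1 x2 t" if "t \<in> {0..T}" for t
    unfolding energy_def using that by (subst weighted_integral_split[OF energy_integrand_cont[OF \<psi> \<Phi>] x]) (auto simp: clamped_eq)
  ultimately show ?thesis by (rule continuous_on_eq)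
qed

text \<open>The chain rule in t on almost every line of fixed x, followed by Fubini. Times above
  \<tau> > 0 are required because the time derivative is represented by r only there.\<close>

lemma energy_increment:
  assumes r: "bounded_borel r"
    and vr: "AE x in lborel. \<forall>s t. \<tau> < s \<longrightarrow> s \<le> t \<longrightarrow> t < T \<longrightarrow> v (x, t) - v (x, s) = integral {s..t} (\<lambda>t. r (x, t))"
    and st: "0 < \<tau>" "\<tau> < s" "s \<le> t" "t < T"
    and \<psi>: "continuous_on UNIV \<psi>"
    and \<Phi>: "\<And>s. (\<Phi> has_real_derivative m s) (at s)"
    and m: "continuous_on UNIV m" "\<And>r. \<exists>L. L-lipschitz_on {- r..r} m"
  shows "(\<lambda>u. integral {x1..x2} (\<lambda>x. \<psi> x * w x * (m (v (x, u) - K x) * r (x, u)))) integrable_on {s..t}"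
    and "energy \<psi> \<Phi> x1 x2 t - energy \<psi> \<Phi> x1 x2 s =
      integral {s..t} (\<lambda>u. integral {x1..x2} (\<lambda>x. \<psi> x * w x * (m (v (x, u) - K x) * r (x, u))))"
proof -
  have T: "0 < T" using st by simp
  define f where "f z = \<psi> (fst z) * w (fst z) * (m (clamped T z - K (fst z)) * r z)" for z
  \<comment> \<open>The continuous factors of f, collected so that compactness bounds them on the
    rectangle; w and r carry bounds of their own.\<close>
  define g where "g z = \<psi> (fst z) * m (clamped T z - K (fst z))" for z
  have cg: "continuous_on A g" for A
    unfolding g_def
    by (intro continuous_intros continuous_on_compose2[OF \<psi>] continuous_on_compose2[OF m(1)]
        clamped_cont[OF T] continuous_on_compose2[OF K_cont[of UNIV]]) auto
  obtain C where C: "\<And>z. \<bar>r z\<bar> \<le> C" "r \<in> borel_measurable borel" "0 \<le> C" using bounded_borelE[OF r] by metis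
  have wm: "(\<lambda>z::real \<times> real. w (fst z)) \<in> borel_measurable borel"
    using bounded_borel_fst[OF w_borel] by (simp add: bounded_borel_def)
  have fm: "f \<in> borel_measurable borel"
  proof -
    have "(\<lambda>z. g z * (w (fst z) * r z)) \<in> borel_measurable borel"
      by (intro borel_measurable_times wm C(2) borel_measurable_continuous_onI cg)
    then show ?thesis by (simp add: f_def[abs_def] g_def mult_ac)
  qed
  have "compact (g ` ({x1..x2} \<times> {s..t}))" by (intro compact_continuous_image cg compact_Times) auto
  then obtain D where D: "\<And>x u. x \<in> {x1..x2} \<Longrightarrow> u \<in> {s..t} \<Longrightarrow> \<bar>g (x, u)\<bar> \<le> D"
    by (fastforce dest!: compact_imp_bounded simp: bounded_iff)
  have fb: "\<bar>f (x, u)\<bar> \<le> D * (1 / \<sigma>H\<^sup>2 * C)" if "x \<in> {x1..x2}" "u \<in> {s..t}" for x u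
  proof -
    have "\<bar>f (x, u)\<bar> = \<bar>g (x, u)\<bar> * (w x * \<bar>r (x, u)\<bar>)"
      using w_pos[of x] by (simp add: f_def g_def abs_mult)
    also have "\<dots> \<le> D * (1 / \<sigma>H\<^sup>2 * C)"
      using D[OF that] w_bounds(2)[of x] w_pos[of x] C by (intro mult_mono) (auto intro: order_trans[OF abs_ge_zero])
    finally show ?thesis .
  qed
  note sw = integral_swap_bounded_borel[OF fm fb]
  have feq: "f (x, u) = \<psi> x * w x * (m (v (x, u) - K x) * r (x, u))" if "u \<in> {s..t}" for x u
    using that st by (simp add: f_def clamped_eq)
  have inner: "integral {x1..x2} (\<lambda>x. f (x, u)) = integral {x1..x2} (\<lambda>x. \<psi> x * w x * (m (v (x, u) - K x) * r (x, u)))"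
    if "u \<in> {s..t}" for u using feq[OF that] by simp
  show "(\<lambda>u. integral {x1..x2} (\<lambda>x. \<psi> x * w x * (m (v (x, u) - K x) * r (x, u)))) integrable_on {s..t}"
    by (rule integrable_eq[OF sw(2) inner])
  have c\<Phi>: "continuous_on UNIV \<Phi>" by (intro continuous_at_imp_continuous_on ballI DERIV_isCont[OF \<Phi>])
  have "energy \<psi> \<Phi> x1 x2 t - energy \<psi> \<Phi> x1 x2 s =
     integral {x1..x2} (\<lambda>x. w x * (\<psi> x * \<Phi> (v (x, t) - K x)) - w x * (\<psi> x * \<Phi> (v (x, s) - K x)))"
    unfolding energy_def
    by (intro Henstock_Kurzweil_Integration.integral_diff[symmetric] energy_integrable \<psi> c\<Phi>) (use st in auto)
  also have "\<dots> = integral {x1..x2} (\<lambda>x. integral {s..t} (\<lambda>u. f (x, u)))"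
  proof (rule integral_cong_AE_lborel)
    show "AE x in lborel. x \<in> {x1..x2} \<longrightarrow> w x * (\<psi> x * \<Phi> (v (x, t) - K x)) - w x * (\<psi> x * \<Phi> (v (x, s) - K x)) = integral {s..t} (\<lambda>u. f (x, u))"
      using vr
    proof eventually_elim
      case (elim x)
      have "\<Phi> (v (x, t) - K x) - \<Phi> (v (x, s) - K x) = integral {s..t} (\<lambda>u. m (v (x, u) - K x) * r (x, u))"
        by (rule absolutely_continuous_chain_rule[OF st(3) bounded_borel_slice(2)[OF r], of "\<lambda>u. v (x, u) - K x", OF _ \<Phi> m(2)])
          (use elim st in auto)
      then have "w x * (\<psi> x * \<Phi> (v (x, t) - K x)) - w x * (\<psi> x * \<Phi> (v (x, s) - K x))
        = (\<psi> x * w x) * integral {s..t} (\<lambda>u. m (v (x, u) - K x) * r (x, u))"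
        by (simp add: algebra_simps flip: right_diff_distrib)
      also have "\<dots> = integral {s..t} (\<lambda>u. f (x, u))"
        unfolding integral_mult_right[symmetric] by (intro Henstock_Kurzweil_Integration.integral_cong) (simp add: feq)
      finally show ?case by simp
    qed
  qed
  also have "\<dots> = integral {s..t} (\<lambda>u. integral {x1..x2} (\<lambda>x. f (x, u)))" by (rule sw(1))
  also have "\<dots> = integral {s..t} (\<lambda>u. integral {x1..x2} (\<lambda>x. \<psi> x * w x * (m (v (x, u) - K x) * r (x, u))))"
    by (intro Henstock_Kurzweil_Integration.integral_cong inner)
  finally show "energy \<psi> \<Phi> x1 x2 t - energy \<psi> \<Phi> x1 x2 s =
      integral {s..t} (\<lambda>u. integral {x1..x2} (\<lambda>x. \<psi> x * w x * (m (v (x, u) - K x) * r (x, u))))" .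
qed

end

section \<open>The profile is a lower bound\<close>

text \<open>The cubed negative part. Its derivative has to be continuously differentiable for
  \<open>slice_estimate\<close> and Lipschitz on bounded sets for
  \<open>energy_increment\<close>.\<close>

definition neg_cube :: "real \<Rightarrow> real" where "neg_cube s = - ((min s 0) ^ 3)"
definition neg_cube' :: "real \<Rightarrow> real" where "neg_cube' s = - 3 * (min s 0) ^ 2"
definition neg_cube'' :: "real \<Rightarrow> real" where "neg_cube'' s = - 6 * min s 0"

lemmas neg_cube_defs = neg_cube_def neg_cube'_def neg_cube''_def

lemma neg_cube_deriv: "(neg_cube has_real_derivative neg_cube' s) (at s)"
  unfolding neg_cube_def[abs_def] neg_cube'_def
  using DERIV_minus[OF has_real_derivative_min_power[of 1 s]] by (simp add: eval_nat_numeral)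

lemma neg_cube'_deriv: "(neg_cube' has_real_derivative neg_cube'' s) (at s)"
  unfolding neg_cube'_def[abs_def] neg_cube''_def
  using DERIV_cmult[OF has_real_derivative_min_power[of 0 s], of "- 3"] by (simp add: eval_nat_numeral)

lemma neg_cube_cont: "continuous_on UNIV neg_cube'" "continuous_on UNIV neg_cube''" "continuous_on UNIV neg_cube"
  unfolding neg_cube_defs[abs_def] by (intro continuous_intros)+

lemma neg_cube'_lipschitz: "\<exists>L. L-lipschitz_on {- r..r} neg_cube'"
proof -
  have "dist (neg_cube' s) (neg_cube' t) \<le> (6 * \<bar>r\<bar>) * dist s t" if "s \<in> {- r..r}" "t \<in> {- r..r}" for s t
  proof -
    have 1: "\<bar>min s 0 + min t 0\<bar> \<le> 2 * \<bar>r\<bar>" using that by (auto simp: min_def abs_le_iff)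
    have 2: "\<bar>min s 0 - min t 0\<bar> \<le> \<bar>s - t\<bar>" by (auto simp: min_def)
    have "neg_cube' s - neg_cube' t = - 3 * ((min s 0 + min t 0) * (min s 0 - min t 0))"
      by (simp add: neg_cube'_def power2_eq_square algebra_simps)
    then have "\<bar>neg_cube' s - neg_cube' t\<bar> = 3 * (\<bar>min s 0 + min t 0\<bar> * \<bar>min s 0 - min t 0\<bar>)" by (simp only: abs_mult) simp
    also have "\<dots> \<le> 3 * ((2 * \<bar>r\<bar>) * \<bar>s - t\<bar>)" by (intro mult_left_mono mult_mono 1 2) auto
    finally show ?thesis by (simp add: dist_real_def)
  qed
  then show ?thesis by (intro exI[of _ "6 * \<bar>r\<bar>"] lipschitz_onI) auto
qed

lemma neg_cube_nonneg: "0 \<le> neg_cube s" by (auto simp: neg_cube_def min_def power3_eq_cube mult_nonneg_nonpos mult_nonpos_nonpos)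

context credit_migration
begin

lemma exp_minus_derivs:
  "((\<lambda>x. exp (- x)) has_real_derivative - exp (- x)) (at (x::real))"
  "continuous_on UNIV (\<lambda>x::real. - exp (- x))" "continuous_on UNIV (\<lambda>x::real. exp (- x))"
  by (auto intro!: derivative_eq_intros continuous_intros)

text \<open>Where y < 0, the diffusion leaves the dissipation 3 (-y) h^2, and everything else is a
  cross term y^2 h. Of the coefficient 9/2, a part 3/2 comes from differentiating the weight and 3
  from the term -y in y' = h - y; the part 3 c is the drift.\<close>

lemma comparison_bulk_bound:
  fixes y h c :: real
  assumes "c = \<delta> * w x"
  shows "- 1/2 * (- e * neg_cube' y + e * neg_cube'' y * (h - y)) * h + \<delta> * w x * (e * neg_cube' y * h)
     = (if y < 0 then e * (- y) * (- 3 * h\<^sup>2 - (9/2 + 3 * c) * (- y) * h) else 0)"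
  using assms by (auto simp: neg_cube_defs min_def power2_eq_square algebra_simps)

theorem v_ge_K:
  assumes t0: "0 \<le> t0"
  shows "K x0 \<le> v (x0, t0)"
proof -
  define T where "T = t0 + 1"
  have T: "0 < T" "t0 < T" using t0 by (auto simp: T_def)
  obtain M where reg: "\<And>\<tau>. 0 < \<tau> \<Longrightarrow> \<tau> < T \<Longrightarrow> \<exists>p q r. derivatives p q r M \<tau> T"
    using regularity[OF T(1)] by blast
  obtain M0 where M0: "0 \<le> M0" "\<And>x t. t \<in> {0..T} \<Longrightarrow> \<bar>v (x, t)\<bar> \<le> M0"
    using v_bounded[OF T(1)] by metis
  obtain B where B: "B > 0" "\<And>x t. t \<in> {0..T} \<Longrightarrow> x < - B \<Longrightarrow> v (x, t) = 1"
    using v_eq_1_left[OF T(1)] by metis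
  \<comment> \<open>To the left of -B and of \<kappa> both v and K equal 1, so the left boundary
    term vanishes; being to the left of x0 makes x0 an interior point.\<close>
  define x1 where "x1 = min (- B - 1) (min (\<kappa> - 1) (x0 - 1))"
  have x1: "x1 < - B" "x1 < \<kappa>" "x1 < x0" "x1 \<le> \<eta>" using \<kappa>\<eta> by (auto simp: x1_def)
  \<comment> \<open>The largest value of the cross-term coefficient 9/2 + 3 \<delta> w. Completing
    the square gives -3 h^2 - c n h \<le> (c n)^2 / 12, and \<sigma>L^2 w \<ge> 1 turns the constant
    into a multiple of the energy density; this is the origin of C.\<close>
  define bm where "bm = 9/2 + 3 * (\<delta> * (1 / \<sigma>H\<^sup>2))"
  define C where "C = bm\<^sup>2 / 12 * \<sigma>L\<^sup>2"
  have bm: "0 < bm" unfolding bm_def using \<delta> by (intro add_pos_nonneg) auto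
  have C: "0 < C" unfolding C_def using bm \<sigma>L by (intro mult_pos_pos divide_pos_pos) auto
  \<comment> \<open>A bound of the flux term at R, half of exp(-R) \<open>neg_cube'\<close> h: the
    multiplier is at most 3 (M0 + 1)^2, and |h| is at most |M| + M0 + 1.\<close>
  define D where "D R = 3/2 * (M0 + 1)\<^sup>2 * (\<bar>M\<bar> + M0 + 1) * exp (- R)" for R
  have D: "0 \<le> D R" for R using M0 by (auto simp: D_def)
  let ?e = "\<lambda>x::real. exp (- x)"
  let ?F = "\<lambda>R. energy ?e neg_cube x1 R"
  have Fcont: "continuous_on {0..t0} (?F R)" if "\<eta> \<le> R" for R
    by (rule energy_cont[OF exp_minus_derivs(3) neg_cube_cont(3) x1(4) that])
  have Fnonneg: "0 \<le> ?F R t" if "0 \<le> t" for R t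
    unfolding energy_def
    by (rule Henstock_Kurzweil_Integration.integral_nonneg[OF energy_integrable[OF exp_minus_derivs(3) neg_cube_cont(3) that]])
      (use w_pos neg_cube_nonneg in \<open>auto intro!: mult_nonneg_nonneg simp: less_imp_le\<close>)
  have slice: "integral {x1..R} (\<lambda>x. ?e x * w x * (neg_cube' (v (x, t) - K x) * r (x, t))) \<le> C * ?F R t + D R"
    if R: "\<eta> \<le> R" and t: "t \<in> {0..T}" and b: "bounded_borel p" "bounded_borel q" "bounded_borel r"
      and rs: "regular p q r M t H" for R t p q r H
  proof -
    have t': "0 \<le> t" using t by simp
    define bulk where "bulk x = - 1/2 * (- ?e x * neg_cube' (v (x, t) - K x) + ?e x * neg_cube'' (v (x, t) - K x) * ((H x - S x) - (v (x, t) - K x))) * (H x - S x)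
       + \<delta> * w x * (?e x * neg_cube' (v (x, t) - K x) * (H x - S x))" for x
    have "(v (x, t) < K x \<and> neg_cube' (v (x, t) - K x) \<le> 0) \<or>
        (K x \<le> v (x, t) \<and> \<kappa> < x \<and> 0 \<le> neg_cube' (v (x, t) - K x)) \<or> neg_cube' (v (x, t) - K x) = 0" for x
      by (cases "v (x, t) < K x") (auto simp: neg_cube'_def min_def)
    note SE = slice_estimate[OF rs b order_trans[OF x1(4) R] exp_minus_derivs(1,2) _ neg_cube'_deriv neg_cube_cont(2) this, folded bulk_def]
    have bi: "bulk integrable_on {x1..R}" using SE(1) by simp
    have "bulk x \<le> C * (w x * (?e x * neg_cube (v (x, t) - K x)))" for x
    proof (cases "v (x, t) - K x < 0")
      case False
      then show ?thesis unfolding bulk_def comparison_bulk_bound[OF refl] by (simp add: neg_cube_def min_def)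
    next
      case True
      define n where "n = K x - v (x, t)"
      define h where "h = H x - S x"
      define c where "c = 9/2 + 3 * (\<delta> * w x)"
      have n: "0 < n" using True by (simp add: n_def)
      have "0 \<le> \<delta> * w x" "\<delta> * w x \<le> \<delta> * (1 / \<sigma>H\<^sup>2)"
        using \<delta> w_pos[of x] w_bounds(2)[of x] by (intro mult_nonneg_nonneg mult_left_mono; simp)+
      then have c: "0 \<le> c" "c \<le> bm" unfolding c_def bm_def by linarith+
      have "bulk x = ?e x * n * (- 3 * h\<^sup>2 - c * n * h)"
        unfolding bulk_def comparison_bulk_bound[OF refl] using True by (simp add: n_def h_def c_def)
      also have "\<dots> \<le> ?e x * n * ((c * n)\<^sup>2 / 12)"
      proof (rule mult_left_mono)
        have "0 \<le> (6 * h + c * n)\<^sup>2" by simp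
        then show "- 3 * h\<^sup>2 - c * n * h \<le> (c * n)\<^sup>2 / 12" by (simp add: power2_eq_square algebra_simps)
      qed (use n in auto)
      also have "\<dots> = (c\<^sup>2 / 12) * (?e x * n ^ 3)" by (simp add: power2_eq_square power3_eq_cube)
      also have "\<dots> \<le> (C * w x) * (?e x * n ^ 3)"
      proof (rule mult_right_mono)
        have "c\<^sup>2 / 12 \<le> bm\<^sup>2 / 12" using c by (auto intro: power_mono)
        also have "\<dots> = bm\<^sup>2 / 12 * (\<sigma>L\<^sup>2 * (1 / \<sigma>L\<^sup>2))" using \<sigma>L by simp
        also have "\<dots> \<le> bm\<^sup>2 / 12 * (\<sigma>L\<^sup>2 * w x)" using w_bounds(1)[of x] by (intro mult_left_mono) auto
        finally show "c\<^sup>2 / 12 \<le> C * w x" by (simp add: C_def mult.assoc)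
      qed (use n in auto)
      also have "n ^ 3 = neg_cube (v (x, t) - K x)" using True by (simp add: neg_cube_def n_def min_def power3_eq_cube algebra_simps)
      finally show ?thesis by (simp add: mult.assoc)
    qed
    then have "integral {x1..R} bulk \<le> integral {x1..R} (\<lambda>x. C * (w x * (?e x * neg_cube (v (x, t) - K x))))"
      by (intro integral_le bi integrable_on_mult_right energy_integrable exp_minus_derivs(3) neg_cube_cont(3) t')
    also have "\<dots> = C * ?F R t" by (simp add: energy_def)
    finally have 1: "integral {x1..R} bulk \<le> C * ?F R t" .
    have "v (x1, t) = 1" using B(2)[OF t x1(1)] .
    then have y1: "neg_cube' (v (x1, t) - K x1) = 0" using K_left[of x1] x1 by (simp add: neg_cube'_def)
    have "\<bar>neg_cube' (v (R, t) - K R)\<bar> \<le> 3 * (M0 + 1)\<^sup>2"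
    proof -
      have "\<bar>min (v (R, t) - K R) 0\<bar> \<le> M0 + 1"
        using M0(2)[OF t, of R] K_le_1[of R] K_pos[of R] by (auto simp: min_def)
      then have "\<bar>min (v (R, t) - K R) 0\<bar>\<^sup>2 \<le> (M0 + 1)\<^sup>2" by (intro power_mono) auto
      then show ?thesis by (simp add: neg_cube'_def abs_mult)
    qed
    moreover have "\<bar>H R - S R\<bar> \<le> \<bar>M\<bar> + M0 + 1"
    proof -
      have "\<bar>H R - v (R, t)\<bar> \<le> M" using rs by (auto simp: regular_slice_def)
      then show ?thesis using M0(2)[OF t, of R] S_pos[of R] S_le_1[of R] by linarith
    qed
    ultimately have "\<bar>neg_cube' (v (R, t) - K R)\<bar> * \<bar>H R - S R\<bar> \<le> 3 * (M0 + 1)\<^sup>2 * (\<bar>M\<bar> + M0 + 1)"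
      by (intro mult_mono) auto
    then have "neg_cube' (v (R, t) - K R) * (H R - S R) \<le> 3 * (M0 + 1)\<^sup>2 * (\<bar>M\<bar> + M0 + 1)"
      unfolding abs_mult[symmetric] by linarith
    then have "1/2 * ?e R * (neg_cube' (v (R, t) - K R) * (H R - S R)) \<le> 1/2 * ?e R * (3 * (M0 + 1)\<^sup>2 * (\<bar>M\<bar> + M0 + 1))"
      by (intro mult_left_mono) auto
    then have 2: "1/2 * (?e R * neg_cube' (v (R, t) - K R) * (H R - S R)) \<le> D R"
      unfolding D_def by (simp add: mult_ac)
    have "integral {x1..R} (\<lambda>x. ?e x * w x * (neg_cube' (v (x, t) - K x) * r (x, t)))
       \<le> 1/2 * (?e R * neg_cube' (v (R, t) - K R) * (H R - S R) - ?e x1 * neg_cube' (v (x1, t) - K x1) * (H x1 - S x1)) + integral {x1..R} bulk"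
      using SE(2) by simp
    with 1 2 y1 show ?thesis by simp
  qed
  \<comment> \<open>The representatives p, q, r are taken from \<tau> = s / 2 and change with s, but
    C and D R do not. This is what allows s to tend to 0.\<close>
  have incr: "?F R t - ?F R s \<le> integral {s..t} (\<lambda>u. C * ?F R u + D R)" if R: "\<eta> \<le> R" and st: "0 < s" "s \<le> t" "t \<le> t0" for R s t
  proof -
    have "0 < s / 2" "s / 2 < T" using st T by auto
    from reg[OF this] obtain p q r where b: "bounded_borel p" "bounded_borel q" "bounded_borel r"
      and vr: "AE x in lborel. \<forall>sa t. s / 2 < sa \<longrightarrow> sa \<le> t \<longrightarrow> t < T \<longrightarrow> v (x, t) - v (x, sa) = integral {sa..t} (\<lambda>t. r (x, t))"
      and rs: "AE t in lborel. t \<in> {s / 2<..<T} \<longrightarrow> (\<exists>H. regular p q r M t H)" unfolding regular_derivatives_def by blast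
    have st': "0 < s / 2" "s / 2 < s" "s \<le> t" "t < T" using st T by auto
    note EI = energy_increment[OF b(3) vr st' exp_minus_derivs(3) neg_cube_deriv neg_cube_cont(1) neg_cube'_lipschitz, of x1 R]
    have "AE u in lborel. u \<in> {s..t} \<longrightarrow> integral {x1..R} (\<lambda>x. ?e x * w x * (neg_cube' (v (x, u) - K x) * r (x, u))) \<le> C * ?F R u + D R"
      using rs
    proof eventually_elim
      case (elim u)
      show ?case
      proof
        assume "u \<in> {s..t}"
        then have u: "u \<in> {s / 2<..<T}" "u \<in> {0..T}" using st st' by auto
        with elim obtain H where "regular p q r M u H" by blast
        from slice[OF R u(2) b this]
        show "integral {x1..R} (\<lambda>x. ?e x * w x * (neg_cube' (v (x, u) - K x) * r (x, u))) \<le> C * ?F R u + D R" .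
      qed
    qed
    moreover have "(\<lambda>u. C * ?F R u + D R) integrable_on {s..t}"
      by (intro integrable_continuous_interval continuous_intros continuous_on_subset[OF Fcont[OF R]]) (use st in auto)
    ultimately have "integral {s..t} (\<lambda>u. integral {x1..R} (\<lambda>x. ?e x * w x * (neg_cube' (v (x, u) - K x) * r (x, u))))
       \<le> integral {s..t} (\<lambda>u. C * ?F R u + D R)"
      using EI(1) by (intro integral_mono_AE_lborel)
    then show ?thesis using EI(2) by simp
  qed
  \<comment> \<open>The comparison starts correctly because K lies below both 1 and exp(-x).\<close>
  have F0: "?F R 0 = 0" for R
  proof -
    have "neg_cube (v (x, 0) - K x) = 0" for x
      using K_le_1[of x] K_le_exp[of x] by (simp add: neg_cube_def v_initial min_def)
    then show ?thesis by (simp add: energy_def)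
  qed
  \<comment> \<open>The initial time is reached by continuity of the energy; since the integrand is
    nonnegative, the integral over {s..t} is at most the one over {0..t}.\<close>
  have le: "?F R t \<le> integral {0..t} (\<lambda>u. C * ?F R u + D R)" if R: "\<eta> \<le> R" and t: "t \<in> {0..t0}" for R t
  proof (cases "t = 0")
    case True then show ?thesis using F0 by simp
  next
    case False
    then have t: "0 < t" "t \<le> t0" using t by auto
    have ci: "continuous_on {0..t} (\<lambda>u. C * ?F R u + D R)"
      by (intro continuous_intros continuous_on_subset[OF Fcont[OF R]]) (use t in auto)
    have "(?F R \<longlongrightarrow> ?F R 0) (at 0 within {0..t})"
      using continuous_on_subset[OF Fcont[OF R], of "{0..t}"] t by (auto simp: continuous_on_def)
    then have "(?F R \<longlongrightarrow> ?F R 0) (at_right 0)"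
      using t by (simp add: at_within_Icc_at_right)
    then have "((\<lambda>s. ?F R t - ?F R s) \<longlongrightarrow> ?F R t - ?F R 0) (at_right 0)" by (intro tendsto_intros)
    moreover have "\<forall>\<^sub>F s in at_right 0. ?F R t - ?F R s \<le> integral {0..t} (\<lambda>u. C * ?F R u + D R)"
    proof -
      have "\<forall>\<^sub>F s in at_right 0. s < t" using t eventually_at_right by blast
      then show ?thesis using eventually_at_right_less[of 0]
      proof eventually_elim
        case (elim s)
        have "?F R t - ?F R s \<le> integral {s..t} (\<lambda>u. C * ?F R u + D R)" using incr[OF R] elim t by auto
        also have "\<dots> \<le> integral {0..t} (\<lambda>u. C * ?F R u + D R)"
          using elim Fnonneg C D
          by (intro integral_subset_le integrable_continuous_interval ci continuous_on_subset[OF ci])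
            (auto intro!: add_nonneg_nonneg mult_nonneg_nonneg simp: less_imp_le)
        finally show ?case .
      qed
    qed
    ultimately have "?F R t - ?F R 0 \<le> integral {0..t} (\<lambda>u. C * ?F R u + D R)"
      by (intro tendsto_upperbound[OF _ _ trivial_limit_at_right_real])
    then show ?thesis using F0 by simp
  qed
  have FD: "?F R t0 \<le> D R / C * exp (C * t0)" if R: "\<eta> \<le> R" for R
    by (rule integral_gronwall[OF Fcont[OF R] C D le[OF R]]) (use t0 in auto)
  let ?g = "\<lambda>x. ?e x * neg_cube (v (x, t0) - K x)"
  have cg: "continuous_on A ?g" for A
    by (rule energy_integrand_cont[OF exp_minus_derivs(3) neg_cube_cont(3) t0])
  \<comment> \<open>The window {x1..x0 + 1} has x0 in its interior and does not depend on R. Its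
    share of the energy is below a bound that tends to 0 as R grows.\<close>
  define R1 where "R1 = max \<eta> (x0 + 1)"
  have "integral {x1..x0 + 1} ?g / \<sigma>L\<^sup>2 \<le> D R / C * exp (C * t0)" if R: "R1 \<le> R" for R
  proof -
    have "integral {x1..x0 + 1} ?g / \<sigma>L\<^sup>2 = integral {x1..x0 + 1} (\<lambda>x. 1 / \<sigma>L\<^sup>2 * ?g x)" by simp
    also have "\<dots> \<le> integral {x1..x0 + 1} (\<lambda>x. w x * ?g x)"
      by (intro integral_le integrable_continuous_interval continuous_intros cg energy_integrable exp_minus_derivs(3) neg_cube_cont(3) t0
           mult_right_mono w_bounds mult_nonneg_nonneg neg_cube_nonneg) auto
    also have "\<dots> \<le> integral {x1..R} (\<lambda>x. w x * ?g x)"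
      by (intro integral_subset_le energy_integrable exp_minus_derivs(3) neg_cube_cont(3) t0)
        (use R w_pos neg_cube_nonneg in \<open>auto simp: R1_def less_imp_le intro!: mult_nonneg_nonneg\<close>)
    also have "\<dots> = ?F R t0" by (simp add: energy_def)
    also have "\<dots> \<le> D R / C * exp (C * t0)" using R by (intro FD) (simp add: R1_def)
    finally show ?thesis .
  qed
  moreover have "((\<lambda>R. D R / C * exp (C * t0)) \<longlongrightarrow> 0) at_top"
  proof -
    have "((\<lambda>R. exp (- R)) \<longlongrightarrow> (0::real)) at_top"
      by (intro filterlim_compose[OF exp_at_bot filterlim_uminus_at_bot_at_top])
    then have "((\<lambda>R. 3/2 * (M0 + 1)\<^sup>2 * (\<bar>M\<bar> + M0 + 1) * exp (- R) / C * exp (C * t0)) \<longlongrightarrow>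
       3/2 * (M0 + 1)\<^sup>2 * (\<bar>M\<bar> + M0 + 1) * 0 / C * exp (C * t0)) at_top"
      using C by (intro tendsto_intros) auto
    then show ?thesis by (simp add: D_def)
  qed
  ultimately have "integral {x1..x0 + 1} ?g / \<sigma>L\<^sup>2 \<le> 0"
    by (intro tendsto_lowerbound[OF _ _ trivial_limit_at_top_linorder])
      (auto intro: eventually_mono[OF eventually_ge_at_top[of R1]])
  then have "integral {x1..x0 + 1} ?g \<le> 0" using \<sigma>L by (simp add: divide_le_0_iff)
  moreover have "0 \<le> ?g x" for x using neg_cube_nonneg by (intro mult_nonneg_nonneg) auto
  moreover from this have "0 \<le> integral {x1..x0 + 1} ?g"
    by (intro Henstock_Kurzweil_Integration.integral_nonneg integrable_continuous_interval cg)
  ultimately have "integral {x1..x0 + 1} ?g = 0" by linarith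
  then have "?g x0 = 0"
    using integral_eq_0_iff[of x1 "x0 + 1" ?g] cg \<open>\<And>x. 0 \<le> ?g x\<close> x1 by auto
  then show ?thesis by (simp add: neg_cube_def min_def split: if_splits)
qed

section \<open>The Lyapunov functional\<close>


context
  fixes p q r M t H B
  assumes rs: "regular p q r M t H" and b: "bounded_borel p" "bounded_borel q" and t: "0 \<le> t"
    and bd: "(\<forall>x. x < - B \<longrightarrow> v (x, t) = 1) \<and> (\<forall>x. B < x \<longrightarrow> v (x, t) \<le> exp (- x))"
begin

lemmas left = bd[THEN conjunct1, rule_format] and right = bd[THEN conjunct2, rule_format]

lemma slice_deriv: "((\<lambda>x. v (x, t)) has_real_derivative H x - v (x, t)) (at x)"
  using rs by (auto simp: regular_slice_def)

lemma slice_exp_deriv: "((\<lambda>x. exp x * (v (x, t) - c)) has_real_derivative exp x * (H x - c)) (at x)"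
  using slice_deriv[of x] by (auto intro!: derivative_eq_intros simp: algebra_simps)

lemma slice_H_antimono: assumes "x \<le> y" shows "H y \<le> H x"
proof -
  have "bounded_borel (\<lambda>x. p (x, t) + q (x, t))" by (intro bounded_borel_add bounded_borel_slice b)
  moreover have "AE x in lborel. p (x, t) + q (x, t) \<le> 0"
    using rs unfolding regular_slice_def by (auto elim: eventually_mono)
  then have "AE z in lborel. z \<in> {x..y} \<longrightarrow> p (z, t) + q (z, t) \<le> 0" by eventually_elim auto
  ultimately have "integral {x..y} (\<lambda>x. p (x, t) + q (x, t)) \<le> integral {x..y} (\<lambda>x. 0)"
    by (intro integral_mono_AE_lborel bounded_borel_integral(1) bounded_borel_const) auto
  moreover have "H y - H x = integral {x..y} (\<lambda>x. p (x, t) + q (x, t))"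
    using rs assms by (auto simp: regular_slice_def)
  ultimately show ?thesis by simp
qed

lemma slice_H_left: assumes "x < - B" shows "H x = 1"
proof -
  have "((\<lambda>x. 1) has_real_derivative 0) (at x)" by simp
  then have "((\<lambda>x. v (x, t)) has_real_derivative 0) (at x)"
    by (rule has_field_derivative_transform_within_open[where S="{..<- B}"]) (use assms left in auto)
  from DERIV_unique[OF this slice_deriv] left[OF assms] show ?thesis by simp
qed

lemma slice_H_le_1: "H x \<le> 1"
  using slice_H_antimono[of "min x (- B - 1)" x] slice_H_left[of "min x (- B - 1)"] by auto

text \<open>For s \<le> x the derivative exp(s) (H s - H x) of exp(s) (v - H x) is nonnegative
  because H is nonincreasing, and far to the left v = 1 \<ge> H x. As v_x = H - v, this is the
  monotonicity of v.\<close>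

lemma slice_H_le_v: "H x \<le> v (x, t)"
proof -
  define x0 where "x0 = min x (- B - 1)"
  have x0: "x0 \<le> x" "x0 < - B" by (auto simp: x0_def)
  have "exp x0 * (v (x0, t) - H x) \<le> exp x * (v (x, t) - H x)"
  proof (rule DERIV_nonneg_imp_nondecreasing[OF x0(1), where f="\<lambda>s. exp s * (v (s, t) - H x)"])
    fix s assume "x0 \<le> s" "s \<le> x"
    then show "\<exists>d. ((\<lambda>s. exp s * (v (s, t) - H x)) has_real_derivative d) (at s) \<and> 0 \<le> d"
      using slice_exp_deriv[of "H x" s] slice_H_antimono[of s x] by (intro exI[of _ "exp s * (H s - H x)"]) auto
  qed
  moreover have "0 \<le> exp x0 * (v (x0, t) - H x)" using left[OF x0(2)] slice_H_le_1[of x] by simp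
  ultimately have "0 \<le> exp x * (v (x, t) - H x)" by linarith
  then show ?thesis by (simp add: zero_le_mult_iff)
qed

lemma slice_v_antimono: assumes "x \<le> y" shows "v (y, t) \<le> v (x, t)"
proof (rule DERIV_nonpos_imp_nonincreasing[OF assms, where f="\<lambda>x. v (x, t)"])
  fix s show "\<exists>d. ((\<lambda>x. v (x, t)) has_real_derivative d) (at s) \<and> d \<le> 0"
    using slice_deriv[of s] slice_H_le_v[of s] by (intro exI[of _ "H s - v (s, t)"]) auto
qed

text \<open>If H x = -a < 0, then H \<le> -a from x on, and exp(s) (v + a) is nonincreasing there.
  But v \<ge> K > 0 forces it to be at least exp(s) a, which is unbounded.\<close>

lemma slice_H_nonneg: "0 \<le> H x"
proof (rule ccontr)
  assume "\<not> 0 \<le> H x"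
  define a where "a = - H x"
  have a: "0 < a" using \<open>\<not> 0 \<le> H x\<close> by (simp add: a_def)
  define c where "c = exp x * (v (x, t) - H x)"
  \<comment> \<open>Chosen so that (1 + s) a exceeds c; the bound exp(s) \<ge> 1 + s then
    suffices.\<close>
  define s where "s = max x (\<bar>c\<bar> / a)"
  have "c \<ge> exp s * (v (s, t) - H x)"
    unfolding c_def
  proof (rule DERIV_nonpos_imp_nonincreasing[where f="\<lambda>s. exp s * (v (s, t) - H x)"])
    fix z assume "x \<le> z" "z \<le> s"
    then show "\<exists>d. ((\<lambda>s. exp s * (v (s, t) - H x)) has_real_derivative d) (at z) \<and> d \<le> 0"
      using slice_exp_deriv[of "H x" z] slice_H_antimono[of x z]
      by (intro exI[of _ "exp z * (H z - H x)"]) (auto simp: mult_nonneg_nonpos)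
  qed (simp add: s_def)
  moreover have "exp s * (v (s, t) - H x) \<ge> exp s * a"
    using v_ge_K[OF t, of s] K_pos[of s] by (intro mult_left_mono) (auto simp: a_def)
  moreover have "exp s * a \<ge> (1 + s) * a" using a by (intro mult_right_mono exp_ge_add_one_self) auto
  moreover have "(1 + s) * a > c"
  proof -
    have "\<bar>c\<bar> / a * a \<le> s * a" using a by (intro mult_right_mono) (auto simp: s_def)
    then show ?thesis using a by (simp add: algebra_simps)
  qed
  ultimately show False by linarith
qed

lemma slice_u_mono: assumes "x \<le> y" shows "exp x * v (x, t) \<le> exp y * v (y, t)"
proof (rule DERIV_nonneg_imp_nondecreasing[OF assms, where f="\<lambda>x. exp x * v (x, t)"])
  fix s show "\<exists>d. ((\<lambda>x. exp x * v (x, t)) has_real_derivative d) (at s) \<and> 0 \<le> d"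
    using slice_exp_deriv[of 0 s] slice_H_nonneg[of s] by (intro exI[of _ "exp s * H s"]) auto
qed

lemma slice_u_le_1: "exp x * v (x, t) \<le> 1"
proof -
  let ?z = "max x (B + 1)"
  have "exp x * v (x, t) \<le> exp ?z * v (?z, t)" by (rule slice_u_mono) simp
  also have "\<dots> \<le> exp ?z * exp (- ?z)" using right[of ?z] by (intro mult_left_mono) auto
  also have "\<dots> = 1" by (simp flip: exp_add)
  finally show ?thesis .
qed

text \<open>Since H decreases, the mean value theorem on [R - 1, R] bounds exp(R - 1) H R by the
  increment of exp(x) v there, and this function lies between exp(x) K and 1. The factor
  \<open>exp 1\<close> pays for the unit step.\<close>

lemma slice_H_tail: "exp R * H R \<le> exp 1 * (1 - exp (R - 1) * K (R - 1))"
proof -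
  have "((\<lambda>x. exp x * v (x, t)) has_real_derivative exp x * H x) (at x)" for x
    using slice_exp_deriv[of 0 x] by simp
  then obtain z where z: "R - 1 < z" "z < R" "exp R * v (R, t) - exp (R - 1) * v (R - 1, t) = exp z * H z"
    using MVT2[of "R - 1" R "\<lambda>x. exp x * v (x, t)" "\<lambda>x. exp x * H x"] by auto
  have "exp (R - 1) * H R \<le> exp z * H z"
    using slice_H_antimono[of z R] slice_H_nonneg z by (intro mult_mono) auto
  also have "\<dots> = exp R * v (R, t) - exp (R - 1) * v (R - 1, t)" using z by simp
  also have "\<dots> \<le> 1 - exp (R - 1) * K (R - 1)"
    using slice_u_le_1[of R] v_ge_K[OF t, of "R - 1"] by (intro diff_mono mult_left_mono) auto
  finally have "exp 1 * (exp (R - 1) * H R) \<le> exp 1 * (1 - exp (R - 1) * K (R - 1))" by (intro mult_left_mono) auto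
  then show ?thesis by (simp flip: exp_add mult.assoc)
qed

end

lemma v_t_cont: "0 < T \<Longrightarrow> continuous_on {0..T} (\<lambda>t. v (x, t))"
  by (rule continuous_on_compose2[OF v_strip_cont]) (auto simp: strip_def intro!: continuous_intros)

text \<open>Slices are regular only at almost every time; for fixed space points the inequalities
  compare continuous functions of t and therefore extend to every t > 0.\<close>

lemma v_spatial:
  assumes t: "0 < t"
  shows "x \<le> y \<Longrightarrow> v (y, t) \<le> v (x, t)" "v (x, t) \<le> exp (- x)"
proof -
  define T where "T = t + 1"
  define \<tau> where "\<tau> = t / 2"
  have T: "0 < T" and \<tau>: "0 < \<tau>" "\<tau> < T" and tJ: "t \<in> {\<tau><..<T}" using t by (auto simp: T_def \<tau>_def)
  obtain M where "\<And>\<tau>. 0 < \<tau> \<Longrightarrow> \<tau> < T \<Longrightarrow> \<exists>p q r. derivatives p q r M \<tau> T"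
    using regularity[OF T] by blast
  from this[OF \<tau>] obtain p q r where rd: "derivatives p q r M \<tau> T" by blast
  obtain B where B: "\<And>t. t \<in> {0..T} \<Longrightarrow> (\<forall>x. x < - B \<longrightarrow> v (x, t) = 1) \<and> (\<forall>x. B < x \<longrightarrow> v (x, t) \<le> exp (- x))"
    using v_eq_1_left[OF T] by metis
  have b: "bounded_borel p" "bounded_borel q" using rd by (auto simp: regular_derivatives_def)
  have c: "continuous_on {\<tau><..<T} (\<lambda>t. v (x, t))" for x
    using v_t_cont[OF T] by (rule continuous_on_subset) (use \<tau> in auto)
  have ae: "AE u in lborel. u \<in> {\<tau><..<T} \<longrightarrow> (\<forall>x y. x \<le> y \<longrightarrow> v (y, u) \<le> v (x, u)) \<and> (\<forall>x. exp x * v (x, u) \<le> 1)"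
  proof -
    have "AE u in lborel. u \<in> {\<tau><..<T} \<longrightarrow> (\<exists>H. regular p q r M u H)"
      using rd by (simp add: regular_derivatives_def)
    then show ?thesis
    proof eventually_elim
      case (elim u)
      show ?case
      proof
        assume u: "u \<in> {\<tau><..<T}"
        then obtain H where rs: "regular p q r M u H" using elim by blast
        have u0: "0 \<le> u" "u \<in> {0..T}" using u \<tau> by auto
        show "(\<forall>x y. x \<le> y \<longrightarrow> v (y, u) \<le> v (x, u)) \<and> (\<forall>x. exp x * v (x, u) \<le> 1)"
          using slice_v_antimono[OF rs b u0(1) B[OF u0(2)]] slice_u_le_1[OF rs b u0(1) B[OF u0(2)]] by blast
      qed
    qed
  qed
  show "v (y, t) \<le> v (x, t)" if "x \<le> y"
  proof -
    have "AE u in lborel. u \<in> {\<tau><..<T} \<longrightarrow> v (y, u) - v (x, u) \<le> 0"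
      using ae by eventually_elim (use that in auto)
    from AE_continuous_le[OF open_greaterThanLessThan continuous_on_diff[OF c c] this tJ] show ?thesis by simp
  qed
  have "AE u in lborel. u \<in> {\<tau><..<T} \<longrightarrow> exp x * v (x, u) \<le> 1"
    using ae by eventually_elim auto
  from AE_continuous_le[OF open_greaterThanLessThan continuous_on_mult[OF continuous_on_const c] this tJ]
  have "exp x * v (x, t) \<le> 1" .
  then show "v (x, t) \<le> exp (- x)" by (simp add: exp_minus field_simps)
qed

section \<open>The functional, its dissipation and the error of cutting off at R\<close>

abbreviation "lyapunov \<equiv> energy (\<lambda>x. exp x - exp \<kappa>) (\<lambda>s. s) \<kappa>"
abbreviation "excess \<equiv> energy (\<lambda>x. 1) (\<lambda>s. s) \<kappa>"

text \<open>The first term bounds half of the flux exp(R) H R, the second the boundary term \<delta>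
  exp(R) (v - K) / \<sigma>H^2 produced by the drift. Neither depends on time.\<close>

definition tail_error :: "real \<Rightarrow> real" where
  "tail_error R = exp 1 / 2 * (1 - exp (R - 1) * K (R - 1)) + \<delta> / \<sigma>H\<^sup>2 * (1 - exp R * K R)"

lemma exp_K_tendsto: "((\<lambda>x. exp x * K x) \<longlongrightarrow> 1) at_top"
  using profile by (auto simp: travelling_wave_profile_def)

lemma tail_error_tendsto: "(tail_error \<longlongrightarrow> 0) at_top"
proof -
  have "filterlim (\<lambda>R::real. R - 1) at_top at_top"
    using filterlim_tendsto_add_at_top[OF tendsto_const[of "-1::real"] filterlim_ident] by simp
  from filterlim_compose[OF exp_K_tendsto this]
  have "((\<lambda>R. exp 1 / 2 * (1 - exp (R - 1) * K (R - 1)) + \<delta> / \<sigma>H\<^sup>2 * (1 - exp R * K R)) \<longlongrightarrow>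
     exp 1 / 2 * (1 - 1) + \<delta> / \<sigma>H\<^sup>2 * (1 - 1)) at_top"
    by (intro tendsto_intros exp_K_tendsto)
  then show ?thesis by (simp add: tail_error_def[abs_def])
qed

lemma lyapunov_weight: "continuous_on UNIV (\<lambda>x::real. exp x - exp \<kappa>)" "continuous_on UNIV (\<lambda>x::real. exp x)"
   "((\<lambda>x. exp x - exp \<kappa>) has_real_derivative exp x) (at x)"
  by (auto intro!: continuous_intros derivative_eq_intros)

text \<open>With y = v - K and h = y' + y, the derivative of (exp x - exp \<kappa>) y is (exp x -
  exp \<kappa>) h + exp \<kappa> y. The zeroth-order term stems from the constant exp \<kappa> alone
  and is the source of the dissipation.\<close>

lemma integral_weight_flux:
  assumes rs: "regular p q r M t H" and t: "0 \<le> t" and ab: "a \<le> b" and h: "continuous_on UNIV H"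
  shows "integral {a..b} (\<lambda>x. (exp x - exp \<kappa>) * (H x - S x)) =
     (exp b - exp \<kappa>) * (v (b, t) - K b) - (exp a - exp \<kappa>) * (v (a, t) - K a) - exp \<kappa> * integral {a..b} (\<lambda>x. v (x, t) - K x)"
proof -
  let ?y = "\<lambda>x. v (x, t) - K x"
  have yd: "(?y has_real_derivative (H x - S x) - ?y x) (at x)" for x
  proof -
    have "((\<lambda>x. v (x, t)) has_real_derivative H x - v (x, t)) (at x)" using rs by (auto simp: regular_slice_def)
    from DERIV_diff[OF this K_deriv[of x]] show ?thesis by (rule DERIV_cong) algebra
  qed
  have "((\<lambda>x. (exp x - exp \<kappa>) * (H x - S x) + exp \<kappa> * ?y x) has_integral
      (exp b - exp \<kappa>) * ?y b - (exp a - exp \<kappa>) * ?y a) {a..b}"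
  proof (rule fundamental_theorem_of_calculus[OF ab])
    fix x
    have "((\<lambda>x. (exp x - exp \<kappa>) * ?y x) has_real_derivative (exp x - exp \<kappa>) * (H x - S x) + exp \<kappa> * ?y x) (at x)"
      by (rule DERIV_cong[OF DERIV_mult[OF lyapunov_weight(3) yd[of x]]]) algebra
    then show "((\<lambda>x. (exp x - exp \<kappa>) * ?y x) has_vector_derivative (exp x - exp \<kappa>) * (H x - S x) + exp \<kappa> * ?y x) (at x within {a..b})"
      unfolding has_real_derivative_iff_has_vector_derivative[symmetric] by (rule has_field_derivative_at_within)
  qed
  moreover have "integral {a..b} (\<lambda>x. (exp x - exp \<kappa>) * (H x - S x) + exp \<kappa> * ?y x) =
      integral {a..b} (\<lambda>x. (exp x - exp \<kappa>) * (H x - S x)) + exp \<kappa> * integral {a..b} ?y"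
  proof -
    have c: "continuous_on {a..b} (\<lambda>x. (exp x - exp \<kappa>) * (H x - S x))"
      by (intro continuous_intros continuous_on_subset[OF h] continuous_flux \<kappa>\<eta>) auto
    have cy: "continuous_on {a..b} ?y" by (intro continuous_on_diff v_x_cont t K_cont)
    have cy2: "continuous_on {a..b} (\<lambda>x. exp \<kappa> * ?y x)" by (intro continuous_on_mult continuous_on_const cy)
    show ?thesis
      using Henstock_Kurzweil_Integration.integral_add[OF integrable_continuous_interval[OF c] integrable_continuous_interval[OF cy2]]
      by simp
  qed
  ultimately show ?thesis by (simp add: integral_unique)
qed

lemma excess_pos: assumes "0 \<le> t" "a \<in> {\<kappa>..}" shows "0 \<le> w a * ((exp a - exp \<kappa>) * (v (a, t) - K a))" "0 \<le> w a * (1 * (v (a, t) - K a))"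
  using v_ge_K[OF assms(1), of a] w_pos[of a] assms(2) by (auto intro!: mult_nonneg_nonneg simp: less_imp_le)

lemma lyapunov_slice:
  assumes rs: "regular p q r M t H" and b: "bounded_borel p" "bounded_borel q" "bounded_borel r" and t: "0 \<le> t"
    and bd: "(\<forall>x. x < - B \<longrightarrow> v (x, t) = 1) \<and> (\<forall>x. B < x \<longrightarrow> v (x, t) \<le> exp (- x))"
    and R: "\<eta> \<le> R0" "R0 \<le> R"
  shows "integral {\<kappa>..R} (\<lambda>x. (exp x - exp \<kappa>) * w x * (1 * r (x, t))) \<le> tail_error R - \<delta> * exp \<kappa> * excess R0 t"
proof -
  note sl = rs b(1,2) t bd
  let ?y = "\<lambda>x. v (x, t) - K x" and ?h = "\<lambda>x. H x - S x" and ?\<psi> = "\<lambda>x. exp x - exp \<kappa>"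
  have \<eta>R: "\<eta> \<le> R" and \<kappa>R: "\<kappa> \<le> R" using R \<kappa>\<eta> by auto
  have bpq: "bounded_borel (\<lambda>x. p (x, t) + q (x, t))" by (intro bounded_borel_add bounded_borel_slice b)
  have cH: "continuous_on A H" for A
    by (rule indefinite_integral_continuous_on[OF bpq]) (use rs in \<open>auto simp: regular_slice_def\<close>)
  have ch: "continuous_on A ?h" for A by (intro continuous_intros cH continuous_flux \<kappa>\<eta>)
  have y0: "0 \<le> ?y x" for x using v_ge_K[OF t, of x] by simp
  \<comment> \<open>At \<kappa> the solution is trapped between K = 1 and the obstacle.\<close>
  have y\<kappa>: "?y \<kappa> = 0" using v_ge_K[OF t, of \<kappa>] v_le_1[OF t, of \<kappa>] K_left[of \<kappa>] by simp
  have uR: "exp R * ?y R \<le> 1 - exp R * K R" using slice_u_le_1[OF sl, of R] by (simp add: algebra_simps)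
  define bulk where "bulk x = - 1/2 * (exp x * 1 + ?\<psi> x * 0 * (?h x - ?y x)) * ?h x + \<delta> * w x * (?\<psi> x * 1 * ?h x)" for x
  have sgn: "(v (x, t) < K x \<and> (1::real) \<le> 0) \<or> (K x \<le> v (x, t) \<and> \<kappa> < x \<and> (0::real) \<le> 1) \<or> (1::real) = 0" if "\<kappa> < x" for x
    using v_ge_K[OF t, of x] that by auto
  have SE: "integral {\<kappa>..R} (\<lambda>x. ?\<psi> x * w x * (1 * r (x, t)))
      \<le> 1/2 * (?\<psi> R * 1 * ?h R - ?\<psi> \<kappa> * 1 * ?h \<kappa>) + integral {\<kappa>..R} bulk"
    unfolding bulk_def
    by (rule slice_estimate(2)[OF rs b \<kappa>R lyapunov_weight(3,2), of "\<lambda>_. 1" "\<lambda>_. 0"]) (use sgn in auto)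
  have bulk_eq: "bulk x = - 1/2 * (exp x * ?h x) + \<delta> * (w x * (?\<psi> x * ?h x))" for x by (simp add: bulk_def)
  have c1: "continuous_on A (\<lambda>x. ?\<psi> x * ?h x)" for A by (intro continuous_intros ch)
  note sp = weighted_integral_split[OF c1 less_imp_le[OF \<kappa>\<eta>] \<eta>R]
  have e1: "integral {\<kappa>..R} bulk = - 1/2 * integral {\<kappa>..R} (\<lambda>x. exp x * ?h x) + \<delta> * integral {\<kappa>..R} (\<lambda>x. w x * (?\<psi> x * ?h x))"
  proof -
    have "continuous_on {\<kappa>..R} (\<lambda>x. - 1/2 * (exp x * ?h x))" by (intro continuous_intros ch)
    from Henstock_Kurzweil_Integration.integral_add[OF integrable_continuous_interval[OF this] integrable_on_mult_right[OF sp(2), of \<delta>]]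
    show ?thesis unfolding bulk_eq[abs_def] by simp
  qed
  \<comment> \<open>exp(x) h is the derivative of exp(x) y, so what the integration by parts leaves
    over is a pure boundary term: zero at \<kappa>, and of favourable sign at R because of the
    factor -1/2.\<close>
  have e2: "integral {\<kappa>..R} (\<lambda>x. exp x * ?h x) = exp R * ?y R - exp \<kappa> * ?y \<kappa>"
  proof (rule integral_unique, rule fundamental_theorem_of_calculus[OF \<kappa>R])
    fix x
    have "((\<lambda>x. exp x * v (x, t)) has_real_derivative exp x * H x) (at x)"
      using slice_exp_deriv[OF sl, of 0 x] by simp
    moreover have "((\<lambda>x. exp x * K x) has_real_derivative exp x * S x) (at x)"
      by (rule DERIV_cong[OF DERIV_mult[OF DERIV_exp K_deriv[of x]]]) algebra
    ultimately have "((\<lambda>x. exp x * ?y x) has_real_derivative exp x * ?h x) (at x)"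
      unfolding right_diff_distrib by (rule DERIV_diff)
    then show "((\<lambda>x. exp x * ?y x) has_vector_derivative exp x * ?h x) (at x within {\<kappa>..R})"
      unfolding has_real_derivative_iff_has_vector_derivative[symmetric] by (rule has_field_derivative_at_within)
  qed
  \<comment> \<open>The integral is split where w jumps. The two boundary terms at \<eta> do not
    cancel; they leave minus the nonnegative value of (exp x - exp \<kappa>) y at \<eta> times 1 /
    \<sigma>H^2 - 1 / \<sigma>L^2, which may be dropped.\<close>
  have e3: "integral {\<kappa>..R} (\<lambda>x. w x * (?\<psi> x * ?h x)) \<le> exp R * ?y R / \<sigma>H\<^sup>2 - exp \<kappa> * excess R t"
  proof -
    have cy: "continuous_on A ?y" for A by (intro continuous_intros v_x_cont[OF t] K_cont)
    have f1: "integral {\<kappa>..R} (\<lambda>x. w x * (?\<psi> x * ?h x)) =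
        (?\<psi> \<eta> * ?y \<eta> - exp \<kappa> * integral {\<kappa>..\<eta>} ?y) / \<sigma>L\<^sup>2 + (?\<psi> R * ?y R - ?\<psi> \<eta> * ?y \<eta> - exp \<kappa> * integral {\<eta>..R} ?y) / \<sigma>H\<^sup>2"
      unfolding sp(1) integral_weight_flux[OF rs t less_imp_le[OF \<kappa>\<eta>] cH] integral_weight_flux[OF rs t \<eta>R cH] by simp
    have f2: "(?\<psi> \<eta> * ?y \<eta> - exp \<kappa> * integral {\<kappa>..\<eta>} ?y) / \<sigma>L\<^sup>2 + (?\<psi> R * ?y R - ?\<psi> \<eta> * ?y \<eta> - exp \<kappa> * integral {\<eta>..R} ?y) / \<sigma>H\<^sup>2
        = ?\<psi> R * ?y R / \<sigma>H\<^sup>2 - ?\<psi> \<eta> * ?y \<eta> * (1 / \<sigma>H\<^sup>2 - 1 / \<sigma>L\<^sup>2)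
        - exp \<kappa> * (integral {\<kappa>..\<eta>} ?y / \<sigma>L\<^sup>2 + integral {\<eta>..R} ?y / \<sigma>H\<^sup>2)"
    proof -
      have "(A - k * I) / L + (C - A - k * J) / N = C / N - A * (1 / N - 1 / L) - k * (I / L + J / N)"
        for A C I J L N k :: real by (simp add: divide_inverse algebra_simps)
      then show ?thesis .
    qed
    have f3: "integral {\<kappa>..\<eta>} ?y / \<sigma>L\<^sup>2 + integral {\<eta>..R} ?y / \<sigma>H\<^sup>2 = excess R t"
      unfolding energy_def using weighted_integral_split(1)[OF cy less_imp_le[OF \<kappa>\<eta>] \<eta>R] by simp
    have f4: "?\<psi> R * ?y R / \<sigma>H\<^sup>2 \<le> exp R * ?y R / \<sigma>H\<^sup>2"
      using y0 by (intro divide_right_mono mult_right_mono) auto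
    have f5: "0 \<le> ?\<psi> \<eta> * ?y \<eta> * (1 / \<sigma>H\<^sup>2 - 1 / \<sigma>L\<^sup>2)"
      using y0 \<kappa>\<eta> w_bounds[of \<eta>] by (intro mult_nonneg_nonneg) auto
    show ?thesis using f4 f5 unfolding f1 f2 f3 by linarith
  qed
  have "integral {\<kappa>..R} bulk \<le> - 1/2 * (exp R * ?y R - exp \<kappa> * ?y \<kappa>) + \<delta> * (exp R * ?y R / \<sigma>H\<^sup>2 - exp \<kappa> * excess R t)"
    unfolding e1 e2 using mult_left_mono[OF e3, of \<delta>] \<delta> by linarith
  also have "\<dots> \<le> \<delta> / \<sigma>H\<^sup>2 * (1 - exp R * K R) - \<delta> * exp \<kappa> * excess R t"
  proof -
    have "\<delta> / \<sigma>H\<^sup>2 * (exp R * ?y R) \<le> \<delta> / \<sigma>H\<^sup>2 * (1 - exp R * K R)" using uR \<delta> by (intro mult_left_mono) auto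
    moreover have "0 \<le> exp R * ?y R" using y0 by simp
    moreover have "\<delta> * (exp R * ?y R / \<sigma>H\<^sup>2 - exp \<kappa> * excess R t) =
        \<delta> / \<sigma>H\<^sup>2 * (exp R * ?y R) - \<delta> * exp \<kappa> * excess R t"
      by (simp add: right_diff_distrib[of \<delta>])
    moreover have "- 1/2 * (A - k * 0) + X \<le> D - E" if "C \<le> D" "0 \<le> A" "X = C - E" for A C D E X k :: real
      using that by simp
    ultimately show ?thesis unfolding y\<kappa> by blast
  qed
  finally have 1: "integral {\<kappa>..R} bulk \<le> \<delta> / \<sigma>H\<^sup>2 * (1 - exp R * K R) - \<delta> * exp \<kappa> * excess R t" .
  \<comment> \<open>The dissipation is retained only up to a fixed R0, so that R can tend to
    infinity in the error terms alone.\<close>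
  have "excess R0 t \<le> excess R t"
    unfolding energy_def using R excess_pos(2)[OF t]
    by (intro integral_subset_le energy_integrable t continuous_intros) auto
  then have 2: "\<delta> * exp \<kappa> * excess R0 t \<le> \<delta> * exp \<kappa> * excess R t" using \<delta> by (intro mult_left_mono) auto
  have "?\<psi> R * ?h R \<le> ?\<psi> R * H R" using S_pos[of R] \<kappa>R by (intro mult_left_mono) auto
  also have "\<dots> \<le> exp R * H R" using slice_H_nonneg[OF sl, of R] by (intro mult_right_mono) auto
  also have "\<dots> \<le> exp 1 * (1 - exp (R - 1) * K (R - 1))" by (rule slice_H_tail[OF sl])
  finally have "1/2 * (?\<psi> R * 1 * ?h R - ?\<psi> \<kappa> * 1 * ?h \<kappa>) \<le> exp 1 / 2 * (1 - exp (R - 1) * K (R - 1))" by simp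
  with SE 1 2 show ?thesis unfolding tail_error_def by linarith
qed

lemma lyapunov_increment:
  assumes st: "0 < s" "s \<le> t" and R: "\<eta> \<le> R0" "R0 \<le> R"
  shows "lyapunov R t - lyapunov R s \<le> tail_error R * (t - s) - \<delta> * exp \<kappa> * integral {s..t} (excess R0)"
proof -
  define T where "T = t + 1"
  have T: "0 < T" "t < T" using st by (auto simp: T_def)
  obtain M where "\<And>\<tau>. 0 < \<tau> \<Longrightarrow> \<tau> < T \<Longrightarrow> \<exists>p q r. derivatives p q r M \<tau> T"
    using regularity[OF T(1)] by blast
  from this[of "s / 2"] st T obtain p q r where rd: "derivatives p q r M (s / 2) T" by auto
  obtain B where B: "\<And>t. t \<in> {0..T} \<Longrightarrow> (\<forall>x. x < - B \<longrightarrow> v (x, t) = 1) \<and> (\<forall>x. B < x \<longrightarrow> v (x, t) \<le> exp (- x))"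
    using v_eq_1_left[OF T(1)] by metis
  have b: "bounded_borel p" "bounded_borel q" "bounded_borel r"
    and vr: "AE x in lborel. \<forall>sa t. s / 2 < sa \<longrightarrow> sa \<le> t \<longrightarrow> t < T \<longrightarrow> v (x, t) - v (x, sa) = integral {sa..t} (\<lambda>t. r (x, t))"
    and rs: "AE t in lborel. t \<in> {s / 2<..<T} \<longrightarrow> (\<exists>H. regular p q r M t H)"
    using rd unfolding regular_derivatives_def by blast+
  have st': "0 < s / 2" "s / 2 < s" "s \<le> t" "t < T" using st T by auto
  have lip: "\<exists>L. L-lipschitz_on {- r..r} (\<lambda>_::real. 1::real)" for r by (intro exI[of _ 0] lipschitz_onI) auto
  have \<kappa>R: "\<kappa> \<le> \<eta>" "\<eta> \<le> R" using \<kappa>\<eta> R by auto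
  note EI = energy_increment[OF b(3) vr st' lyapunov_weight(1), of "\<lambda>s. s" "\<lambda>_. 1", OF DERIV_ident continuous_on_const lip, of \<kappa> R]
  have "continuous_on {0..t} (excess R0)"
    by (rule energy_cont) (use R \<kappa>R in \<open>auto intro: continuous_intros\<close>)
  then have ce: "continuous_on {s..t} (excess R0)" by (rule continuous_on_subset) (use st in auto)
  have "AE u in lborel. u \<in> {s..t} \<longrightarrow> integral {\<kappa>..R} (\<lambda>x. (exp x - exp \<kappa>) * w x * (1 * r (x, u))) \<le> tail_error R - \<delta> * exp \<kappa> * excess R0 u"
    using rs
  proof eventually_elim
    case (elim u)
    show ?case
    proof
      assume "u \<in> {s..t}"
      then have u: "u \<in> {s / 2<..<T}" "u \<in> {0..T}" "0 \<le> u" using st st' by auto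
      with elim obtain H where "regular p q r M u H" by blast
      from lyapunov_slice[OF this b u(3) B[OF u(2)] R]
      show "integral {\<kappa>..R} (\<lambda>x. (exp x - exp \<kappa>) * w x * (1 * r (x, u))) \<le> tail_error R - \<delta> * exp \<kappa> * excess R0 u" .
    qed
  qed
  moreover have i: "(\<lambda>u. tail_error R - \<delta> * exp \<kappa> * excess R0 u) integrable_on {s..t}"
    by (intro integrable_continuous_interval continuous_intros ce)
  ultimately have "integral {s..t} (\<lambda>u. integral {\<kappa>..R} (\<lambda>x. (exp x - exp \<kappa>) * w x * (1 * r (x, u))))
     \<le> integral {s..t} (\<lambda>u. tail_error R - \<delta> * exp \<kappa> * excess R0 u)"
    using EI(1) by (intro integral_mono_AE_lborel)
  also have "\<dots> = tail_error R * (t - s) - \<delta> * exp \<kappa> * integral {s..t} (excess R0)"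
    using st by (subst Henstock_Kurzweil_Integration.integral_diff)
      (auto intro!: integrable_continuous_interval continuous_intros ce simp: mult.commute)
  finally show ?thesis using EI(2) by simp
qed

section \<open>Convergence\<close>


lemma lyapunov_nonneg: "0 \<le> t \<Longrightarrow> 0 \<le> lyapunov R t"
  unfolding energy_def
  by (rule Henstock_Kurzweil_Integration.integral_nonneg[OF energy_integrable[OF lyapunov_weight(1) continuous_on_id]])
    (use excess_pos(1) in auto)

lemma lyapunov_mono: "0 \<le> t \<Longrightarrow> R \<le> R' \<Longrightarrow> lyapunov R t \<le> lyapunov R' t"
  unfolding energy_def
  by (rule integral_subset_le[OF _ energy_integrable[OF lyapunov_weight(1) continuous_on_id]
        energy_integrable[OF lyapunov_weight(1) continuous_on_id]])
    (use excess_pos(1) in auto)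

text \<open>Up to R0 the weight is at most exp R0. Beyond R0 the density exp(x) (v - K) is at most 1
  - exp(x) K, a decaying exponential that does not depend on time; so the remainder is small
  uniformly in R and t.\<close>

lemma lyapunov_le_excess:
  obtains C where "0 \<le> C" "\<And>R R0 t. 0 < t \<Longrightarrow> \<eta> \<le> R0 \<Longrightarrow> R0 \<le> R \<Longrightarrow>
    lyapunov R t \<le> exp R0 * excess R0 t + C * exp (- (cH - 1) * R0)"
proof -
  obtain A where A: "\<And>x. \<eta> \<le> x \<Longrightarrow> 1 - exp x * K x = A * exp (- (cH - 1) * x)" using K_tail by blast
  have "0 \<le> A"
  proof -
    have "exp \<eta> * K \<eta> \<le> exp \<eta> * exp (- \<eta>)" using K_le_exp[of \<eta>] by (intro mult_left_mono) auto
    then have "0 \<le> A * exp (- (cH - 1) * \<eta>)" using A[of \<eta>] by (simp flip: exp_add)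
    then show ?thesis by (simp add: zero_le_mult_iff)
  qed
  \<comment> \<open>C exp(-(cH - 1) R0) is the integral of A / \<sigma>H^2 exp(-(cH - 1) x) from R0
    to infinity.\<close>
  define C where "C = A / \<sigma>H\<^sup>2 / (cH - 1)"
  have c1: "0 < cH - 1" using c_bounds by simp
  have C0: "0 \<le> C" unfolding C_def using \<open>0 \<le> A\<close> c1 by (intro divide_nonneg_nonneg) auto
  have "lyapunov R t \<le> exp R0 * excess R0 t + C * exp (- (cH - 1) * R0)"
    if t: "0 < t" and R: "\<eta> \<le> R0" "R0 \<le> R" for R R0 t
  proof -
    have t0: "0 \<le> t" and \<kappa>R: "\<kappa> \<le> R0" using t R \<kappa>\<eta> by auto
    let ?f = "\<lambda>x. w x * ((exp x - exp \<kappa>) * (v (x, t) - K x))"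
    have i: "?f integrable_on {a..b}" for a b
      by (rule energy_integrable[OF lyapunov_weight(1) continuous_on_id t0])
    have e1: "lyapunov R t = integral {\<kappa>..R0} ?f + integral {R0..R} ?f"
      unfolding energy_def using Henstock_Kurzweil_Integration.integral_combine[OF \<kappa>R R(2) i] by simp
    have e2: "integral {\<kappa>..R0} ?f \<le> integral {\<kappa>..R0} (\<lambda>x. exp R0 * (w x * (1 * (v (x, t) - K x))))"
    proof (rule integral_le[OF i integrable_on_mult_right[OF energy_integrable[OF continuous_on_const continuous_on_id t0]]])
      fix x assume x: "x \<in> {\<kappa>..R0}"
      have "(exp x - exp \<kappa>) * (w x * (1 * (v (x, t) - K x))) \<le> exp R0 * (w x * (1 * (v (x, t) - K x)))"
      proof (rule mult_right_mono)
        have "exp x \<le> exp R0" using x by simp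
        then show "exp x - exp \<kappa> \<le> exp R0" using exp_gt_zero[of \<kappa>] by linarith
      qed (use excess_pos(2)[OF t0] x in auto)
      then show "?f x \<le> exp R0 * (w x * (1 * (v (x, t) - K x)))" by (simp add: mult.left_commute)
    qed
    have e3: "integral {\<kappa>..R0} (\<lambda>x. exp R0 * (w x * (1 * (v (x, t) - K x)))) = exp R0 * excess R0 t" by (simp add: energy_def)
    have e4: "integral {R0..R} ?f \<le> C * exp (- (cH - 1) * R0) - C * exp (- (cH - 1) * R)"
    proof -
      have D: "((\<lambda>x. A / \<sigma>H\<^sup>2 * exp (- (cH - 1) * x)) has_integral
          (- C * exp (- (cH - 1) * R)) - (- C * exp (- (cH - 1) * R0))) {R0..R}"
      proof (rule fundamental_theorem_of_calculus[OF R(2)])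
        fix x
        have "((\<lambda>x. exp (- (cH - 1) * x)) has_real_derivative exp (- (cH - 1) * x) * (- (cH - 1))) (at x)"
          by (rule derivative_eq_intros refl)+ simp
        from DERIV_cmult[OF this, of "- C"]
        have "((\<lambda>x. - C * exp (- (cH - 1) * x)) has_real_derivative A / \<sigma>H\<^sup>2 * exp (- (cH - 1) * x)) (at x)"
        proof (rule DERIV_cong)
          have "cH - 1 \<noteq> 0" using c1 by linarith
          then have "C * (cH - 1) = A / \<sigma>H\<^sup>2" by (rule nonzero_eq_divide_eq[THEN iffD1, OF _ C_def])
          moreover have "- a * (e * (- k)) = a * k * e" for a e k :: real by simp
          ultimately show "- C * (exp (- (cH - 1) * x) * (- (cH - 1))) = A / \<sigma>H\<^sup>2 * exp (- (cH - 1) * x)" by (simp only:)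
        qed
        then show "((\<lambda>x. - C * exp (- (cH - 1) * x)) has_vector_derivative A / \<sigma>H\<^sup>2 * exp (- (cH - 1) * x)) (at x within {R0..R})"
          unfolding has_real_derivative_iff_has_vector_derivative[symmetric] by (rule has_field_derivative_at_within)
      qed
      have "integral {R0..R} ?f \<le> integral {R0..R} (\<lambda>x. A / \<sigma>H\<^sup>2 * exp (- (cH - 1) * x))"
      proof (rule integral_le[OF i has_integral_integrable[OF D]])
        fix x assume x: "x \<in> {R0..R}"
        have y0: "0 \<le> v (x, t) - K x" using v_ge_K[OF t0, of x] by simp
        have "exp x * v (x, t) \<le> exp x * exp (- x)" using v_spatial(2)[OF t, of x] by (intro mult_left_mono) auto
        then have "exp x * (v (x, t) - K x) \<le> 1 - exp x * K x" by (simp add: algebra_simps flip: exp_add)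
        also have "\<dots> = A * exp (- (cH - 1) * x)" using A[of x] x R by simp
        finally have 1: "exp x * (v (x, t) - K x) \<le> A * exp (- (cH - 1) * x)" .
        have "?f x \<le> 1 / \<sigma>H\<^sup>2 * (exp x * (v (x, t) - K x))"
          using w_bounds(2)[of x] x \<kappa>R y0 by (intro mult_mono mult_right_mono mult_nonneg_nonneg) auto
        also have "\<dots> \<le> 1 / \<sigma>H\<^sup>2 * (A * exp (- (cH - 1) * x))" using 1 by (intro mult_left_mono) auto
        finally show "?f x \<le> A / \<sigma>H\<^sup>2 * exp (- (cH - 1) * x)" by simp
      qed
      also have "\<dots> = C * exp (- (cH - 1) * R0) - C * exp (- (cH - 1) * R)" using integral_unique[OF D] by linarith
      finally show ?thesis .
    qed
    have "0 \<le> C * exp (- (cH - 1) * R)" using C0 by simp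
    with e1 e2 e3 e4 show ?thesis by linarith
  qed
  with C0 show thesis by (rule that)
qed

text \<open>The limit R to infinity at a fixed elapsed time c.\<close>

lemma le_if_le_tail_error:
  assumes "\<And>R. R1 \<le> R \<Longrightarrow> a \<le> b + tail_error R * c"
  shows "a \<le> b"
proof -
  have "((\<lambda>R. b + tail_error R * c) \<longlongrightarrow> b + 0 * c) at_top"
    by (intro tendsto_intros tail_error_tendsto)
  moreover have "\<forall>\<^sub>F R in at_top. a \<le> b + tail_error R * c"
    using eventually_ge_at_top[of R1] by eventually_elim (rule assms)
  ultimately have "a \<le> b + 0 * c" by (rule tendsto_lowerbound) simp
  then show ?thesis by simp
qed

text \<open>An excess that stays above \<epsilon> would make the nonnegative functional decrease at
  least linearly in time. The start is at time 1, since the increment estimate requires a positive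
  time.\<close>

lemma excess_small:
  assumes R0: "\<eta> \<le> R0" and \<epsilon>: "0 < \<epsilon>"
  shows "\<exists>s\<ge>1. excess R0 s \<le> \<epsilon>"
proof (rule ccontr)
  assume "\<not> ?thesis"
  then have large: "\<And>s. 1 \<le> s \<Longrightarrow> \<epsilon> < excess R0 s" by force
  obtain C where C: "0 \<le> C" "\<And>R R0 t. 0 < t \<Longrightarrow> \<eta> \<le> R0 \<Longrightarrow> R0 \<le> R \<Longrightarrow>
    lyapunov R t \<le> exp R0 * excess R0 t + C * exp (- (cH - 1) * R0)" using lyapunov_le_excess by metis
  \<comment> \<open>A bound of the functional at time 1 that holds for every cut-off R \<ge>
    R0.\<close>
  define N where "N = exp R0 * excess R0 1 + C * exp (- (cH - 1) * R0)"
  have "\<delta> * exp \<kappa> * (\<epsilon> * (t - 1)) \<le> N" if t: "1 \<le> t" for t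
  proof (rule le_if_le_tail_error)
    fix R assume R: "R0 \<le> R"
    have "continuous_on {0..t} (excess R0)"
      by (rule energy_cont[OF continuous_on_const continuous_on_id]) (use \<kappa>\<eta> R0 in auto)
    then have "continuous_on {1..t} (excess R0)" by (rule continuous_on_subset) auto
    then have "integral {1..t} (\<lambda>_. \<epsilon>) \<le> integral {1..t} (excess R0)"
      using large by (intro integral_le integrable_continuous_interval) (auto simp: less_imp_le)
    then have "\<delta> * exp \<kappa> * (\<epsilon> * (t - 1)) \<le> \<delta> * exp \<kappa> * integral {1..t} (excess R0)"
      using \<delta> t by (intro mult_left_mono) (auto simp: mult.commute)
    moreover have "lyapunov R t - lyapunov R 1 \<le> tail_error R * (t - 1) - \<delta> * exp \<kappa> * integral {1..t} (excess R0)"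
      by (rule lyapunov_increment) (use t R0 R in auto)
    moreover have "lyapunov R 1 \<le> N" unfolding N_def by (rule C(2)) (use R0 R in auto)
    moreover have "0 \<le> lyapunov R t" using lyapunov_nonneg t by simp
    ultimately show "\<delta> * exp \<kappa> * (\<epsilon> * (t - 1)) \<le> N + tail_error R * (t - 1)" by linarith
  qed
  moreover define d where "d = \<delta> * exp \<kappa> * \<epsilon>"
  ultimately have le: "d * (t - 1) \<le> N" if "1 \<le> t" for t using that by (simp add: mult.assoc)
  have d: "0 < d" using \<delta> \<epsilon> by (simp add: d_def)
  \<comment> \<open>The time is chosen so that the left-hand side is |N| + 1.\<close>
  have "d * ((\<bar>N\<bar> + 1) / d + 1 - 1) \<le> N" by (rule le) (use d in auto)
  then have "\<bar>N\<bar> + 1 \<le> N" using d by simp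
  then show False by linarith
qed

text \<open>Up to the tail error the functional does not increase, so smallness at a single time s
  persists. R0 is taken first, to make the spatial tail less than \<mu> / 2; then s is taken so that
  the excess up to R0, amplified by exp R0, is at most \<mu> / 2.\<close>

lemma lyapunov_tendsto_zero:
  assumes \<mu>: "0 < \<mu>"
  shows "\<exists>s>0. \<forall>t\<ge>s. \<forall>R. lyapunov R t \<le> \<mu>"
proof -
  obtain C where C: "0 \<le> C" "\<And>R R0 t. 0 < t \<Longrightarrow> \<eta> \<le> R0 \<Longrightarrow> R0 \<le> R \<Longrightarrow>
    lyapunov R t \<le> exp R0 * excess R0 t + C * exp (- (cH - 1) * R0)" using lyapunov_le_excess by metis
  have "((\<lambda>R. C * exp (- (cH - 1) * R)) \<longlongrightarrow> C * 0) at_top"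
  proof (intro tendsto_mult tendsto_const)
    have "filterlim (\<lambda>x. (cH - 1) * x) at_top at_top"
      using c_bounds by (intro filterlim_tendsto_pos_mult_at_top[OF tendsto_const] filterlim_ident) auto
    then show "((\<lambda>R. exp (- (cH - 1) * R)) \<longlongrightarrow> 0) at_top" unfolding mult_minus_left
      by (intro filterlim_compose[OF exp_at_bot] filterlim_compose[OF filterlim_uminus_at_bot_at_top])
  qed
  then have "\<forall>\<^sub>F R in at_top. C * exp (- (cH - 1) * R) < \<mu> / 2"
    by (rule order_tendstoD(2)) (use \<mu> in simp)
  then have "\<forall>\<^sub>F R in at_top. C * exp (- (cH - 1) * R) < \<mu> / 2 \<and> \<eta> \<le> R"
    using eventually_ge_at_top[of \<eta>] by eventually_elim auto
  then obtain R0 where R0: "C * exp (- (cH - 1) * R0) < \<mu> / 2" "\<eta> \<le> R0"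
    using eventually_happens'[OF trivial_limit_at_top_linorder] by blast
  obtain s where s: "1 \<le> s" "excess R0 s \<le> \<mu> / 2 * exp (- R0)"
    using excess_small[OF R0(2), of "\<mu> / 2 * exp (- R0)"] \<mu> by auto
  have ex: "0 \<le> excess R0 t" if "0 \<le> t" for t
    unfolding energy_def
    by (rule Henstock_Kurzweil_Integration.integral_nonneg[OF energy_integrable[OF continuous_on_const continuous_on_id that]])
      (use excess_pos(2)[OF that] in auto)
  have "lyapunov R t \<le> \<mu>" if t: "s \<le> t" for R t
  proof (rule le_if_le_tail_error)
    fix R' assume R': "max R R0 \<le> R'"
    have e1: "lyapunov R t \<le> lyapunov R' t" by (rule lyapunov_mono) (use s t R' in auto)
    have e2: "lyapunov R' t \<le> lyapunov R' s + tail_error R' * (t - s)"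
    proof -
      have "lyapunov R' t - lyapunov R' s \<le> tail_error R' * (t - s) - \<delta> * exp \<kappa> * integral {s..t} (excess R0)"
        by (rule lyapunov_increment) (use s t R0 R' in auto)
      moreover have "0 \<le> integral {s..t} (excess R0)"
      proof (rule Henstock_Kurzweil_Integration.integral_nonneg)
        have "continuous_on {0..t} (excess R0)"
          by (rule energy_cont[OF continuous_on_const continuous_on_id]) (use \<kappa>\<eta> R0 in auto)
        then show "excess R0 integrable_on {s..t}"
          by (intro integrable_continuous_interval) (rule continuous_on_subset, use s in auto)
      qed (use ex s in auto)
      then have "0 \<le> \<delta> * exp \<kappa> * integral {s..t} (excess R0)" using \<delta> by simp
      ultimately show ?thesis by linarith
    qed
    have e3: "lyapunov R' s \<le> exp R0 * excess R0 s + C * exp (- (cH - 1) * R0)"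
      by (rule C(2)) (use s R0 R' in auto)
    have e4: "exp R0 * excess R0 s \<le> exp R0 * (\<mu> / 2 * exp (- R0))"
      using s by (intro mult_left_mono) auto
    have e5: "exp R0 * (\<mu> / 2 * exp (- R0)) = \<mu> / 2" by (simp add: exp_minus)
    show "lyapunov R t \<le> \<mu> + tail_error R' * (t - s)" using e1 e2 e3 e4 e5 R0(1) by linarith
  qed
  with s show ?thesis by (intro exI[of _ s]) auto
qed

text \<open>K' = S - K is at least -1. Only this one-sided bound is needed.\<close>

lemma K_lipschitz: assumes "x \<le> y" shows "K x - K y \<le> y - x"
proof -
  have "x + K x \<le> y + K y"
  proof (rule DERIV_nonneg_imp_nondecreasing[OF assms, where f="\<lambda>x. x + K x"])
    fix z
    have "((\<lambda>x. x + K x) has_real_derivative 1 + (S z - K z)) (at z)"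
      by (rule DERIV_add[OF DERIV_ident K_deriv])
    moreover have "0 \<le> 1 + (S z - K z)" using S_pos[of z] K_le_1[of z] by linarith
    ultimately show "\<exists>d. ((\<lambda>x. x + K x) has_real_derivative d) (at z) \<and> 0 \<le> d" by blast
  qed
  then show ?thesis by linarith
qed

text \<open>A deviation of \<epsilon> at x spreads to the left: v is nonincreasing and K has slope
  at least -1, so v - K \<ge> \<epsilon> / 2 on [x - \<epsilon> / 2, x]. Close to \<kappa>, where
  the weight degenerates, 1 - K < \<epsilon> leaves no room for such a deviation, so the interval
  stays at least \<epsilon> / 2 to the right of \<kappa>.\<close>

theorem uniform_convergence: "uniform_limit UNIV (\<lambda>t \<xi>. v (\<xi>, t)) K at_top"
  unfolding uniform_limit_iff
proof (intro allI impI)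
  fix \<epsilon> :: real assume \<epsilon>: "0 < \<epsilon>"
  define d where "d = \<epsilon> / 2"
  define a where "a = exp (\<kappa> + d) - exp \<kappa>"
  have d: "0 < d" using \<epsilon> by (simp add: d_def)
  have a: "0 < a" using d by (simp add: a_def)
  \<comment> \<open>Half of what a deviation of \<epsilon> forces on the functional: w at least 1 /
    \<sigma>L^2, weight at least a and excess at least d, on an interval of length d.\<close>
  define \<mu> where "\<mu> = 1 / \<sigma>L\<^sup>2 * (a * d) * d / 2"
  have \<mu>: "0 < \<mu>" unfolding \<mu>_def using a d \<sigma>L by (intro divide_pos_pos mult_pos_pos) auto
  obtain s where s: "0 < s" "\<And>t R. s \<le> t \<Longrightarrow> lyapunov R t \<le> \<mu>" using lyapunov_tendsto_zero[OF \<mu>] by blast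
  have "v (x, t) - K x < \<epsilon>" if t: "s \<le> t" for x t
  proof (rule ccontr)
    assume "\<not> ?thesis"
    then have big: "\<epsilon> \<le> v (x, t) - K x" by simp
    have t0: "0 < t" "0 \<le> t" using s t by auto
    have "\<kappa> + \<epsilon> \<le> x"
    proof (rule ccontr)
      assume "\<not> ?thesis"
      moreover have "1 - K x < \<epsilon>"
        using K_lipschitz[of \<kappa> x] K_left[of \<kappa>] K_left[of x] \<epsilon> calculation by (cases "x \<le> \<kappa>") auto
      ultimately show False using v_le_1[OF t0(2), of x] big by linarith
    qed
    then have x: "\<kappa> + d \<le> x - d" by (simp add: d_def)
    let ?f = "\<lambda>z. w z * ((exp z - exp \<kappa>) * (v (z, t) - K z))"
    have i: "?f integrable_on {l..u}" for l u
      by (rule energy_integrable[OF lyapunov_weight(1) continuous_on_id t0(2)])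
    have "2 * \<mu> = integral {x - d..x} (\<lambda>_. 1 / \<sigma>L\<^sup>2 * (a * d))" using d by (simp add: \<mu>_def)
    also have "\<dots> \<le> integral {x - d..x} ?f"
    proof (rule integral_le[OF integrable_const_ivl i])
      fix z assume z: "z \<in> {x - d..x}"
      have "d \<le> v (z, t) - K z"
        using v_spatial(1)[OF t0(1), of z x] K_lipschitz[of z x] z big by (auto simp: d_def)
      moreover have "a \<le> exp z - exp \<kappa>" "\<kappa> \<le> z" using z x d by (auto simp: a_def)
      ultimately show "1 / \<sigma>L\<^sup>2 * (a * d) \<le> ?f z"
        using a d w_pos[of z] w_bounds(1)[of z] by (intro mult_mono mult_nonneg_nonneg) auto
    qed
    also have "\<dots> \<le> lyapunov x t"
      unfolding energy_def by (rule integral_subset_le[OF _ i i]) (use x d excess_pos(1)[OF t0(2)] in auto)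
    also have "\<dots> \<le> \<mu>" by (rule s(2)[OF t])
    finally show False using \<mu> by simp
  qed
  moreover have "K x \<le> v (x, t)" if "s \<le> t" for x t using v_ge_K that s(1) by simp
  ultimately have "\<forall>x. dist (v (x, t)) (K x) < \<epsilon>" if "s \<le> t" for t
    using that by (simp add: dist_real_def)
  then show "\<forall>\<^sub>F t in at_top. \<forall>x\<in>UNIV. dist (v (x, t)) (K x) < \<epsilon>"
    unfolding eventually_at_top_linorder by (intro exI[of _ s]) auto
qed

end

theorem theorem6p1:
  fixes \<delta> \<sigma>H \<sigma>L \<gamma> \<eta> \<kappa> :: real
    and v :: "real \<times> real \<Rightarrow> real" and K :: "real \<Rightarrow> real"
  assumes "0 < \<delta>" and "0 < \<sigma>H" and "\<sigma>H < \<sigma>L"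
    and "1/2 * \<sigma>H\<^sup>2 < \<delta>" and "\<delta> < 1/2 * \<sigma>L\<^sup>2"
    and "0 < \<gamma>" and "\<gamma> < 1"
    and "\<forall>T>0. obstacle_solution \<delta> \<sigma>H \<sigma>L \<gamma> T v"
    and "travelling_wave_profile (2 * \<delta> / \<sigma>H\<^sup>2) (2 * \<delta> / \<sigma>L\<^sup>2) \<gamma> K \<eta> \<kappa>"
  shows "uniform_limit UNIV (\<lambda>t \<xi>. v (\<xi>, t)) K at_top"
proof -
  interpret credit_migration \<delta> \<sigma>H \<sigma>L \<gamma> \<eta> \<kappa> v K
    using assms by unfold_locales auto
  show ?thesis by (rule uniform_convergence)
qed

end
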